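(* Let $n\ge 2$, $1<p<\infty$, let $\Omega\subset\mathbb{R}^n$ be open and bounded, and let $\sigma\in L^\infty_+(\Omega)$ be such that either $\sigma\ge 1$ almost everywhere in $\Omega$ or $\sigma\le 1$ almost everywhere in $\Omega$. Let $B\subseteq\Omega$ be a measurable set with positive measure. For every constant $\alpha>0$: (a) if $\sigma|_B\ge 1+\alpha$ (a.e.), then $\Lambda_0+\tilde\alpha\Lambda_B\le\Lambda_\sigma$, where $\tilde\alpha:=(p-1)\left(1-(1+\alpha)^{-\frac{1}{p-1}}\right)>0$; (b) if $\sigma|_B\le 1-\alpha$ (a.e.), then $\Lambda_0-\alpha\Lambda_B\ge\Lambda_\sigma$; (c) if $\Lambda_0+\alpha\Lambda_B\le\Lambda_\sigma$, then $B\subseteq\mathrm{conv}(\mathrm{supp}(|\sigma-1|))$ up to null sets, i.e. $m\left(B\setminus\mathrm{conv}(\mathrm{supp}(|\sigma-1|))\right)=0$; (d) if $\Lambda_0-\alpha\Lambda_B\ge\Lambda_\sigma$, then $B\subseteq\mathrm{conv}(\mathrm{supp}(|\sigma-1|))$ up to null sets, i.e. $m\left(B\setminus\mathrm{conv}(\mathrm{supp}(|\sigma-1|))\right)=0$.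
   Context: $m$ denotes $n$-dimensional Lebesgue measure. $L^\infty_+(\Omega)=\{f\in L^\infty(\Omega;\mathbb{R}) : \operatorname{ess\,inf} f>0\}$. Dirichlet-Neumann map: let $X=W^{1,p}(\Omega)/W^{1,p}_0(\Omega)$ with dual $X'$. For $\sigma\in L^\infty_+(\Omega)$ and $f\in X$ let $u_\sigma^f$ be the unique minimizer of $E_\sigma(u)=\int_\Omega \sigma|\nabla u|^p\,dx$ over $f+W^{1,p}_0(\Omega)$. Then $\Lambda_\sigma:X\to X'$ is the (nonlinear) map $$(\Lambda_\sigma(f),g)=\int_\Omega \sigma|\nabla u_\sigma^f|^{p-2}\nabla u_\sigma^f\cdot\nabla v^g\,dx,\qquad f,g\in X,$$ where $v^g\in W^{1,p}(\Omega)$ is any representative of $g$. $\Lambda_0$ denotes the Dirichlet-Neumann map for the homogeneous conductivity $\sigma_0=1$. For a measurable set $B\subseteq\Omega$, $\Lambda_B:X\to X'$ is defined by $$(\Lambda_B(f),g)=\int_B|\nabla u_0^f|^{p-2}\nabla u_0^f\cdot\nabla u_0^g\,dx,\qquad f,g\in X,$$ where $u_0^h$ is the unique minimizer of $\int_\Omega|\nabla u|^p\,dx$ over $h+W^{1,p}_0(\Omega)$. Order: for (possibly nonlinear) maps $\Lambda_1,\Lambda_2:X\to X'$, $\Lambda_1\ge\Lambda_2$ (equivalently $\Lambda_2\le\Lambda_1$) means $(\Lambda_1(f)-\Lambda_2(f),f)\ge 0$ for all $f\in X$. Essential support: for measurable $f:\Omega\to\mathbb{R}$, $\mathrm{supp}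 f$ is the complement in $\Omega$ of the union of all open sets $O\subseteq\Omega$ with $f|_O=0$ almost everywhere. (Closed) essential convex hull: for measurable $A\subset\mathbb{R}^n$, $\mathrm{conv}\,A$ is the intersection of all closed half-spaces $H_{\rho,t}=\{x\in\mathbb{R}^n : x\cdot\rho\le t\}$ ($\rho\in\mathbb{R}^n$, $t\in\mathbb{R}$) such that $m(A\setminus H_{\rho,t})=0$. *)

theory Defs
  imports "HOL-Analysis.Analysis" "HOL-Probability.Essential_Supremum"
begin

text \<open>
  Functions on \<open>\<Omega>\<close> are total functions whose values outside \<open>\<Omega>\<close> are irrelevant, and \<open>L\<^sup>p\<close>
  functions are not identified when they agree almost everywhere.  The quotient by
  \<open>W\<^sub>0\<^sup>1\<^sup>,\<^sup>p\<close> below performs both identifications, because functions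
  vanishing almost everywhere in \<open>\<Omega>\<close> belong to that space.
\<close>

definition Lp_on :: "'a::euclidean_space set \<Rightarrow> real \<Rightarrow> ('a \<Rightarrow> 'b::euclidean_space) set" where
  "Lp_on \<Omega> p = {f \<in> borel_measurable (lebesgue_on \<Omega>).
     integrable (lebesgue_on \<Omega>) (\<lambda>x. norm (f x) powr p)}"

definition loc_integrable :: "'a::euclidean_space set \<Rightarrow> ('a \<Rightarrow> 'b::euclidean_space) \<Rightarrow> bool" where
  "loc_integrable \<Omega> f \<longleftrightarrow> (\<forall>K. compact K \<and> K \<subseteq> \<Omega> \<longrightarrow> integrable (lebesgue_on K) f)"

primrec Ck :: "nat \<Rightarrow> ('a::euclidean_space \<Rightarrow> real) \<Rightarrow> bool" where
  "Ck 0 f \<longleftrightarrow> continuous_on UNIV f"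
| "Ck (Suc k) f \<longleftrightarrow> (\<forall>x. f differentiable at x) \<and>
     (\<forall>i\<in>Basis. Ck k (\<lambda>x. frechet_derivative f (at x) i))"

definition test_functions :: "'a::euclidean_space set \<Rightarrow> ('a \<Rightarrow> real) set" where
  "test_functions \<Omega> = {\<phi>. (\<forall>k. Ck k \<phi>) \<and>
     compact (closure {x. \<phi> x \<noteq> 0}) \<and> closure {x. \<phi> x \<noteq> 0} \<subseteq> \<Omega>}"

definition has_weak_grad ::
    "'a::euclidean_space set \<Rightarrow> ('a \<Rightarrow> real) \<Rightarrow> ('a \<Rightarrow> 'a) \<Rightarrow> bool" where
  "has_weak_grad \<Omega> u G \<longleftrightarrow> loc_integrable \<Omega> u \<and> loc_integrable \<Omega> G \<and>
     (\<forall>\<phi>\<in>test_functions \<Omega>. \<forall>i\<in>Basis.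
        (LINT x|lebesgue_on \<Omega>. u x * frechet_derivative \<phi> (at x) i)
          = - (LINT x|lebesgue_on \<Omega>. (G x \<bullet> i) * \<phi> x))"

text \<open>The weak gradient is unique up to null sets, so the choice is immaterial.\<close>

definition weak_grad :: "'a::euclidean_space set \<Rightarrow> ('a \<Rightarrow> real) \<Rightarrow> 'a \<Rightarrow> 'a" where
  "weak_grad \<Omega> u = (SOME G. has_weak_grad \<Omega> u G)"

definition W1p :: "'a::euclidean_space set \<Rightarrow> real \<Rightarrow> ('a \<Rightarrow> real) set" where
  "W1p \<Omega> p = {u \<in> Lp_on \<Omega> p. \<exists>G\<in>Lp_on \<Omega> p. has_weak_grad \<Omega> u G}"

definition W1p_norm :: "'a::euclidean_space set \<Rightarrow> real \<Rightarrow> ('a \<Rightarrow> real) \<Rightarrow> real" where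
  "W1p_norm \<Omega> p u =
     ((LINT x|lebesgue_on \<Omega>. \<bar>u x\<bar> powr p) +
      (LINT x|lebesgue_on \<Omega>. norm (weak_grad \<Omega> u x) powr p)) powr (1 / p)"

definition W1p_0 :: "'a::euclidean_space set \<Rightarrow> real \<Rightarrow> ('a \<Rightarrow> real) set" where
  "W1p_0 \<Omega> p = {u \<in> W1p \<Omega> p.
     \<forall>\<epsilon>>0. \<exists>\<phi>\<in>test_functions \<Omega>. W1p_norm \<Omega> p (\<lambda>x. u x - \<phi> x) < \<epsilon>}"

text \<open>
  The elements of \<open>X = W\<^sup>1\<^sup>,\<^sup>p / W\<^sub>0\<^sup>1\<^sup>,\<^sup>p\<close> are
  cosets, so \<open>f \<in> X\<close> is itself the affine space over which energies are minimized.
\<close>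

definition W1p_coset ::
    "'a::euclidean_space set \<Rightarrow> real \<Rightarrow> ('a \<Rightarrow> real) \<Rightarrow> ('a \<Rightarrow> real) set" where
  "W1p_coset \<Omega> p u = {\<lambda>x. u x + w x | w. w \<in> W1p_0 \<Omega> p}"

definition trace_space :: "'a::euclidean_space set \<Rightarrow> real \<Rightarrow> ('a \<Rightarrow> real) set set" where
  "trace_space \<Omega> p = W1p_coset \<Omega> p ` W1p \<Omega> p"

definition essinf :: "'a measure \<Rightarrow> ('a \<Rightarrow> real) \<Rightarrow> ereal" where
  "essinf M f = - esssup M (\<lambda>x. ereal (- f x))"

definition Linf_plus :: "'a::euclidean_space set \<Rightarrow> ('a \<Rightarrow> real) set" where
  "Linf_plus \<Omega> = {\<sigma> \<in> borel_measurable (lebesgue_on \<Omega>).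
     esssup (lebesgue_on \<Omega>) (\<lambda>x. ereal \<bar>\<sigma> x\<bar>) < \<infinity> \<and> essinf (lebesgue_on \<Omega>) \<sigma> > 0}"

definition energy ::
    "'a::euclidean_space set \<Rightarrow> real \<Rightarrow> ('a \<Rightarrow> real) \<Rightarrow> ('a \<Rightarrow> real) \<Rightarrow> real" where
  "energy \<Omega> p \<sigma> u = (LINT x|lebesgue_on \<Omega>. \<sigma> x * norm (weak_grad \<Omega> u x) powr p)"

text \<open>
  For \<open>f\<close> in the trace space the minimizer is unique up to null sets of \<open>\<Omega>\<close>, so
  the choice made by \<^const>\<open>arg_min_on\<close> is immaterial.
\<close>

definition p_potential ::
    "'a::euclidean_space set \<Rightarrow> real \<Rightarrow> ('a \<Rightarrow> real) \<Rightarrow> ('a \<Rightarrow> real) set \<Rightarrow> 'a \<Rightarrow> real" where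
  "p_potential \<Omega> p \<sigma> f = arg_min_on (energy \<Omega> p \<sigma>) f"

text \<open>
  A map \<open>X \<rightarrow> X'\<close> is rendered as its pairing \<open>(f, g) \<mapsto> (\<Lambda>(f), g)\<close>; only
  arguments in the trace space are relevant.  Since \<open>0 powr a = 0\<close>, the flux
  \<open>|\<xi>|\<^sup>p\<^sup>-\<^sup>2 \<xi>\<close> is \<open>0\<close> at \<open>\<xi> = 0\<close> also for \<open>p < 2\<close>.
\<close>

type_synonym 'a dn_type = "('a \<Rightarrow> real) set \<Rightarrow> ('a \<Rightarrow> real) set \<Rightarrow> real"

definition DN :: "'a::euclidean_space set \<Rightarrow> real \<Rightarrow> ('a \<Rightarrow> real) \<Rightarrow> 'a dn_type" where
  "DN \<Omega> p \<sigma> f g =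
     (let u = p_potential \<Omega> p \<sigma> f; v = (SOME v. v \<in> g) in
      LINT x|lebesgue_on \<Omega>. \<sigma> x * norm (weak_grad \<Omega> u x) powr (p - 2)
        * (weak_grad \<Omega> u x \<bullet> weak_grad \<Omega> v x))"

abbreviation DN0 :: "'a::euclidean_space set \<Rightarrow> real \<Rightarrow> 'a dn_type" where
  "DN0 \<Omega> p \<equiv> DN \<Omega> p (\<lambda>_. 1)"

definition DN_test :: "'a::euclidean_space set \<Rightarrow> real \<Rightarrow> 'a set \<Rightarrow> 'a dn_type" where
  "DN_test \<Omega> p B f g =
     (let u = p_potential \<Omega> p (\<lambda>_. 1) f; v = p_potential \<Omega> p (\<lambda>_. 1) g in
      LINT x|lebesgue_on B. norm (weak_grad \<Omega> u x) powr (p - 2)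
        * (weak_grad \<Omega> u x \<bullet> weak_grad \<Omega> v x))"

definition DN_le ::
    "'a::euclidean_space set \<Rightarrow> real \<Rightarrow> 'a dn_type \<Rightarrow> 'a dn_type \<Rightarrow> bool" where
  "DN_le \<Omega> p \<Lambda>1 \<Lambda>2 \<longleftrightarrow> (\<forall>f\<in>trace_space \<Omega> p. \<Lambda>2 f f - \<Lambda>1 f f \<ge> 0)"

definition ess_support :: "'a::euclidean_space set \<Rightarrow> ('a \<Rightarrow> real) \<Rightarrow> 'a set" where
  "ess_support \<Omega> f =
     \<Omega> - \<Union>{U. open U \<and> U \<subseteq> \<Omega> \<and> (AE x in lebesgue_on U. f x = 0)}"

definition ess_conv :: "'a::euclidean_space set \<Rightarrow> 'a set" where
  "ess_conv A = \<Inter>{{x. x \<bullet> \<rho> \<le> t} | \<rho> t. A - {x. x \<bullet> \<rho> \<le> t} \<in> null_sets lebesgue}"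

end

theory Submission
  imports Defs
begin


text \<open>
  On the diagonal the Dirichlet-Neumann map is the minimal energy: \<open>DN \<Omega> p \<sigma> f f\<close> is the minimum of
  \<open>energy \<Omega> p \<sigma>\<close> over the coset \<open>f\<close> (\<open>DN_diagonal\<close>), and \<open>DN_test \<Omega> p B f f\<close> is the part in \<open>B\<close> of the
  energy of the \<open>p\<close>-harmonic function \<open>u\<close> with boundary data \<open>f\<close>. With \<open>G\<close> for the gradient of \<open>u\<close>,
  everything rests on the two-sided estimate (\<open>DN_monotonicity\<close>)

  \<open>\<integral> (p - 1) (1 - \<sigma> powr (- 1 / (p - 1))) \<bar>G\<bar> powr p \<le> DN \<Omega> p \<sigma> f f - DN0 \<Omega> p f f \<le> \<integral> (\<sigma> - 1) \<bar>G\<bar> powr p\<close>.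

  The right inequality takes \<open>u\<close> as a competitor in the problem for \<open>\<sigma>\<close>. The left one is Young's
  inequality combined with the Euler-Lagrange equation of \<open>u\<close>. Parts (a) and (b) follow by
  comparing the integrands on and off \<open>B\<close>.

  For (c) and (d) the same estimate shows that the test inequality bounds the energy of \<open>u\<close> in \<open>B\<close> by a
  constant times its energy in the support of \<open>\<sigma> - 1\<close>, for all boundary data. If \<open>B\<close> left a
  half-space \<open>{x. x \<bullet> \<rho> \<le> t}\<close> containing that support, this would fail for Wolff's solutions
  \<open>u x = exp (s (x \<bullet> \<rho>)) a (s (x \<bullet> \<tau>))\<close> with \<open>\<tau>\<close> orthogonal to \<open>\<rho>\<close>: their energy density is
  \<open>s powr p * exp (p s (x \<bullet> \<rho>))\<close> up to a factor that lies between positive constants independent of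
  \<open>s\<close> (\<open>wolff_solutions\<close>), so for large \<open>s\<close> it is concentrated beyond the half-space (\<open>localized_energy\<close>). The profile \<open>a\<close> is found
  explicitly in polar coordinates (\<open>wolff_profile\<close>).

  The minimizers exist by the direct method (\<open>minimizer_exists\<close>). A pointwise uniform convexity
  inequality (\<open>powr_uniform_convexity\<close>) makes gradients of minimizing sequences Cauchy in \<open>L\<^sup>p\<close>, and
  Poincare's inequality controls the functions themselves. The fundamental lemma of the calculus
  of variations (\<open>fundamental_lemma\<close>) makes the choice in \<^const>\<open>weak_grad\<close> harmless.
\<close>

section \<open>Convexity of powers of the norm\<close>

lemma powr_le_sum_powr:
  fixes a b :: real
  assumes "0 \<le> a" "0 \<le> b" "0 < p"
  shows "(a + b) powr p \<le> 2 powr p * (a powr p + b powr p)"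
proof -
  have "(a + b) powr p \<le> (2 * max a b) powr p"
    using assms by (intro powr_mono2) auto
  also have "\<dots> = 2 powr p * max a b powr p"
    using assms by (simp add: powr_mult)
  also have "max a b powr p \<le> a powr p + b powr p"
    by (auto simp: max_def)
  finally show ?thesis by simp
qed

lemma norm_add_powr_le:
  fixes a b :: "'a::real_normed_vector"
  assumes "0 < p"
  shows "norm (a + b) powr p \<le> 2 powr p * (norm a powr p + norm b powr p)"
proof -
  have "norm (a + b) powr p \<le> (norm a + norm b) powr p"
    using assms by (intro powr_mono2 norm_triangle_ineq) auto
  also have "\<dots> \<le> 2 powr p * (norm a powr p + norm b powr p)"
    using assms by (intro powr_le_sum_powr) auto
  finally show ?thesis .
qed

text \<open>The gradient of \<open>norm z powr p / p\<close>. For \<open>p > 1\<close> its size \<open>norm z powr (p - 1)\<close> tends to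
  zero as \<open>z\<close> does, although the factor \<open>norm z powr (p - 2)\<close> blows up when \<open>p < 2\<close>.\<close>

definition flux :: "real \<Rightarrow> 'a::real_inner \<Rightarrow> 'a" where
  "flux p z = norm z powr (p - 2) *\<^sub>R z"

lemma norm_flux: "norm (flux p z) = norm z powr (p - 1)"
proof (cases "z = 0")
  case False
  then have "norm z powr (p - 2) * norm z powr 1 = norm z powr (p - 1)"
    by (simp only: powr_add[symmetric]) simp
  with False show ?thesis by (simp add: flux_def)
qed (simp add: flux_def)

lemma flux_inner_self: "flux p z \<bullet> z = norm z powr p"
proof (cases "z = 0")
  case False
  then have "norm z powr (p - 2) * norm z powr 2 = norm z powr p"
    by (simp only: powr_add[symmetric]) simp
  moreover have "norm z powr 2 = z \<bullet> z"
    using False by (simp add: dot_square_norm)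
  ultimately show ?thesis by (simp add: flux_def)
qed (simp add: flux_def)

lemma continuous_flux:
  assumes "1 < p"
  shows "isCont (flux p) (z :: 'a::real_inner)"
proof (cases "z = 0")
  case True
  have "((\<lambda>y::'a. norm y powr (p - 1)) \<longlongrightarrow> norm (0::'a) powr (p - 1)) (at 0)"
    using assms by (intro tendsto_powr' tendsto_intros) auto
  then have "((\<lambda>y::'a. norm (flux p y)) \<longlongrightarrow> 0) (at 0)"
    using assms by (simp add: norm_flux)
  then have "(flux p \<longlongrightarrow> 0) (at (0::'a))"
    by (rule tendsto_norm_zero_cancel)
  then show ?thesis using True by (simp add: isCont_def flux_def)
next
  case False
  then show ?thesis unfolding flux_def
    by (intro continuous_intros) auto
qed

text \<open>Young's inequality for the conjugate exponents \<open>p\<close> and \<open>p / (p - 1)\<close>.\<close>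

lemma tangent_real:
  fixes s t :: real
  assumes "1 < p" "0 \<le> s" "0 \<le> t"
  shows "p * (t powr (p - 1) * s) \<le> s powr p + (p - 1) * t powr p"
proof -
  define q where "q = p / (p - 1)"
  have q: "1 < q" "1/p + 1/q = 1" "(p - 1) * q = p"
    using assms by (auto simp: q_def field_simps)
  have "s * t powr (p - 1) \<le> s powr p / p + (t powr (p - 1)) powr q / q"
    using assms q by (intro Youngs_inequality) auto
  also have "(t powr (p - 1)) powr q = t powr p"
    by (simp add: powr_powr q)
  finally have "p * (s * t powr (p - 1)) \<le> p * (s powr p / p + t powr p / q)"
    using assms by (intro mult_left_mono) auto
  also have "\<dots> = s powr p + (p - 1) * t powr p"
    using assms by (simp add: q_def field_simps)
  finally show ?thesis by (simp add: mult_ac)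
qed

text \<open>The graph of the convex function \<open>\<lambda>z. norm z powr p\<close> lies above its tangent plane at \<open>a\<close>; the
  form given here uses \<open>flux p a \<bullet> a = norm a powr p\<close>.\<close>

lemma tangent_norm:
  fixes a b :: "'a::real_inner"
  assumes "1 < p"
  shows "p * (flux p a \<bullet> b) \<le> norm b powr p + (p - 1) * norm a powr p"
proof -
  have "flux p a \<bullet> b \<le> norm (flux p a) * norm b" by (rule norm_cauchy_schwarz)
  also have "\<dots> = norm a powr (p - 1) * norm b" by (simp add: norm_flux)
  finally have "p * (flux p a \<bullet> b) \<le> p * (norm a powr (p - 1) * norm b)"
    using assms by simp
  also have "\<dots> \<le> norm b powr p + (p - 1) * norm a powr p"
    using assms by (intro tangent_real) auto
  finally show ?thesis .
qed

text \<open>Replacing \<open>a\<close> by \<open>c *\<^sub>R a\<close> in the unweighted inequality and multiplying by \<open>w\<close> leaves the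
  left-hand side unchanged exactly when \<open>w * c powr (p - 1) = 1\<close>. This choice of \<open>c\<close> is the
  origin of the exponent \<open>- 1 / (p - 1)\<close> in the lower bound for the Dirichlet-Neumann map.\<close>

lemma tangent_norm_weighted:
  fixes a b :: "'a::real_inner"
  assumes "1 < p" "0 < w"
  shows "p * (flux p a \<bullet> b) \<le> w * norm b powr p + (p - 1) * w powr (- (1 / (p - 1))) * norm a powr p"
proof -
  define c where "c = w powr (- (1 / (p - 1)))"
  have c: "0 < c" using assms by (simp add: c_def)
  have cp: "w * c powr (p - 1) = 1" "w * c powr p = c"
  proof -
    have "c powr (p - 1) = w powr (- 1)"
      using assms by (simp add: c_def powr_powr)
    then show 1: "w * c powr (p - 1) = 1" using assms by (simp add: powr_minus)
    have "c powr p = c powr (p - 1) * c powr 1" by (simp only: powr_add[symmetric]) simp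
    then show "w * c powr p = c" using 1 c by simp
  qed
  have fc: "flux p (c *\<^sub>R a) = c powr (p - 1) *\<^sub>R flux p a"
  proof -
    have "c powr (p - 2) * c powr 1 = c powr (p - 1)" by (simp only: powr_add[symmetric]) simp
    then show ?thesis using c by (simp add: flux_def powr_mult)
  qed
  have "w * (p * (flux p (c *\<^sub>R a) \<bullet> b)) \<le> w * (norm b powr p + (p - 1) * norm (c *\<^sub>R a) powr p)"
    using assms by (intro mult_left_mono tangent_norm) auto
  also have "w * (p * (flux p (c *\<^sub>R a) \<bullet> b)) = (w * c powr (p - 1)) * (p * (flux p a \<bullet> b))"
    by (simp add: fc)
  also have "w * (norm b powr p + (p - 1) * norm (c *\<^sub>R a) powr p)
     = w * norm b powr p + (p - 1) * (w * c powr p) * norm a powr p"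
    using c by (simp add: powr_mult algebra_simps)
  finally show ?thesis unfolding cp by (simp add: c_def)
qed

text \<open>By the mean value theorem the increments over the two halves of \<open>[x, y]\<close> are governed by values
  of the strictly increasing derivative, and the right half has the larger one.\<close>

lemma powr_midpoint_strict:
  fixes x y :: real
  assumes "1 < p" "0 \<le> x" "x < y"
  shows "((x + y) / 2) powr p < (x powr p + y powr p) / 2"
proof -
  define m where "m = (x + y) / 2"
  have m: "x < m" "m < y" "m - x = y - m" using assms by (auto simp: m_def field_simps)
  have incr: "\<exists>z. a < z \<and> z < b \<and> b powr p - a powr p = (b - a) * (p * z powr (p - 1))"
    if "0 \<le> a" "a < b" for a b :: real
  proof -
    have "continuous_on {a..b} (\<lambda>t. t powr p)"
      using assms that by (intro continuous_on_powr') auto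
    moreover have "((\<lambda>t. t powr p) has_derivative (\<lambda>h. h * (p * x powr (p - 1)))) (at x)"
      if "a < x" "x < b" for x
    proof -
      have "((\<lambda>t. t powr p) has_real_derivative p * x powr (p - 1)) (at x)"
        using that \<open>0 \<le> a\<close> by (intro has_real_derivative_powr) auto
      then show ?thesis
        by (rule has_derivative_eq_rhs[OF has_field_derivative_imp_has_derivative]) (rule ext, rule mult.commute)
    qed
    ultimately obtain z where "a < z" "z < b" "b powr p - a powr p = (b - a) * (p * z powr (p - 1))"
      using mvt[OF \<open>a < b\<close>, of "\<lambda>t. t powr p" "\<lambda>x h. h * (p * x powr (p - 1))"] by blast
    then show ?thesis by blast
  qed
  obtain u where u: "x < u" "u < m" "m powr p - x powr p = (m - x) * (p * u powr (p - 1))"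
    using incr[of x m] assms(2) m(1) by blast
  obtain v where v: "m < v" "v < y" "y powr p - m powr p = (y - m) * (p * v powr (p - 1))"
    using incr[of m y] order_trans[OF assms(2) less_imp_le[OF m(1)]] m(2) by blast
  have "u powr (p - 1) < v powr (p - 1)"
    using assms u v by (intro powr_less_mono2) auto
  then have "m powr p - x powr p < y powr p - m powr p"
    unfolding u(3) v(3) m(3) using assms(1) m(2) by (intro mult_strict_left_mono) simp_all
  then show ?thesis by (simp add: m_def)
qed

text \<open>Two separate reasons: if the norms differ, the power function is strictly convex; if they agree,
  the parallelogram law makes the midpoint shorter.\<close>

lemma norm_midpoint_strict:
  fixes a b :: "'a::real_inner"
  assumes "1 < p" "a \<noteq> b"
  shows "norm ((1/2) *\<^sub>R (a + b)) powr p < (norm a powr p + norm b powr p) / 2"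
proof (cases "norm a = norm b")
  case False
  have "norm ((1/2) *\<^sub>R (a + b)) powr p \<le> ((norm a + norm b) / 2) powr p"
    using assms norm_triangle_ineq[of a b] by (intro powr_mono2) auto
  also have "\<dots> < (norm a powr p + norm b powr p) / 2"
  proof (cases "norm a < norm b")
    case True
    then show ?thesis using powr_midpoint_strict[of p "norm a" "norm b"] assms by simp
  next
    case False
    then show ?thesis
      using \<open>norm a \<noteq> norm b\<close> powr_midpoint_strict[of p "norm b" "norm a"] assms by (simp add: add.commute)
  qed
  finally show ?thesis .
next
  case True
  have "(norm (a + b))\<^sup>2 + (norm (a - b))\<^sup>2 = 2 * (norm a)\<^sup>2 + 2 * (norm b)\<^sup>2"
    by (simp add: power2_norm_eq_inner algebra_simps inner_commute)
  moreover have "0 < (norm (a - b))\<^sup>2" using assms by simp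
  ultimately have "(norm (a + b))\<^sup>2 < 4 * (norm b)\<^sup>2" unfolding True by linarith
  then have "(norm (a + b))\<^sup>2 < (2 * norm a)\<^sup>2" by (simp add: power_mult_distrib True)
  then have "norm (a + b) < 2 * norm a" by (rule power2_less_imp_less) simp
  then have "norm ((1/2) *\<^sub>R (a + b)) powr p < norm a powr p"
    using assms by (intro powr_less_mono2) auto
  then show ?thesis using True by simp
qed

lemma norm_midpoint:
  fixes a b :: "'a::real_inner"
  assumes "1 < p"
  shows "norm ((1/2) *\<^sub>R (a + b)) powr p \<le> (norm a powr p + norm b powr p) / 2"
proof (cases "a = b")
  case True
  then have "(1/2) *\<^sub>R (a + b) = b" by (simp add: scaleR_2[symmetric])
  then show ?thesis using True by simp
qed (use norm_midpoint_strict[OF assms, of a b] in auto)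

text \<open>A pointwise form of uniform convexity, the same for all \<open>p > 1\<close>, whereas Clarkson's inequalities
  take different forms below and above the exponent 2. All terms
  are homogeneous of degree \<open>p\<close>, hence it suffices to look at the compact sphere \<open>S\<close>. Where
  \<open>norm (a - b) powr p \<le> e\<close> there is nothing to do; on the compact rest \<open>K\<close> the convexity gap \<open>h\<close> is
  positive by strict convexity and therefore bounded below.\<close>

lemma powr_uniform_convexity:
  fixes p e :: real
  assumes "1 < p" "0 < e"
  obtains C where "0 \<le> C" "\<And>a b :: 'a::euclidean_space. norm (a - b) powr p \<le> e * (norm a powr p + norm b powr p)
     + C * ((norm a powr p + norm b powr p) / 2 - norm ((1/2) *\<^sub>R (a + b)) powr p)"
proof -
  define S where "S = {z :: 'a \<times> 'a. norm (fst z) powr p + norm (snd z) powr p = 1}"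
  define K where "K = S \<inter> {z. e \<le> norm (fst z - snd z) powr p}"
  define h where "h z = (norm (fst z) powr p + norm (snd z) powr p) / 2 - norm ((1/2) *\<^sub>R (fst z + snd z)) powr p"
    for z :: "'a \<times> 'a"
  have cont: "continuous_on UNIV h"
    "continuous_on UNIV (\<lambda>z::'a\<times>'a. norm (fst z) powr p + norm (snd z) powr p)"
    "continuous_on UNIV (\<lambda>z::'a\<times>'a. norm (fst z - snd z) powr p)"
    unfolding h_def using assms by (intro continuous_intros continuous_on_powr'; auto)+
  have bdd: "norm z \<le> 2" if "z \<in> S" for z
  proof -
    have "norm (fst z) powr p + norm (snd z) powr p = 1" using that by (simp add: S_def)
    moreover have "0 \<le> norm (fst z) powr p" "0 \<le> norm (snd z) powr p" by simp_all
    ultimately have "norm (fst z) powr p \<le> 1" "norm (snd z) powr p \<le> 1" by linarith+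
    then have "norm (fst z) \<le> 1" "norm (snd z) \<le> 1"
      using assms powr_less_mono2[of p 1 "norm (fst z)"] powr_less_mono2[of p 1 "norm (snd z)"]
      by (auto simp: not_less[symmetric])
    then show ?thesis using norm_Pair_le[of "fst z" "snd z"] by simp
  qed
  have "closed S"
    using continuous_closed_preimage[OF cont(2) closed_UNIV, of "{1}"] by (simp add: S_def vimage_def)
  then have "compact S" unfolding compact_eq_bounded_closed bounded_iff using bdd by blast
  moreover have "closed {z::'a\<times>'a. e \<le> norm (fst z - snd z) powr p}"
    using continuous_closed_preimage[OF cont(3) closed_UNIV, of "{e..}"] by (simp add: vimage_def)
  ultimately have "compact K" unfolding K_def by (rule compact_Int_closed)
  have hpos: "0 < h z" if "z \<in> K" for z
  proof -
    have "fst z \<noteq> snd z" using that assms by (auto simp: K_def)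
    then show ?thesis using norm_midpoint_strict[OF assms(1), of "fst z" "snd z"] by (simp add: h_def)
  qed
  obtain h0 where h0: "0 < h0" "\<And>z. z \<in> K \<Longrightarrow> h0 \<le> h z"
  proof (cases "K = {}")
    case True then show ?thesis using that[of 1] by auto
  next
    case False
    then obtain z0 where "z0 \<in> K" "\<forall>z\<in>K. h z0 \<le> h z"
      using continuous_attains_inf[OF \<open>compact K\<close>] cont(1) continuous_on_subset by blast
    then show ?thesis using that[of "h z0"] hpos by auto
  qed
  have hnn: "0 \<le> h z" for z
    using norm_midpoint[OF assms(1), of "fst z" "snd z"] by (simp add: h_def)
  define C where "C = 2 powr p / h0"
  have C0: "0 \<le> C" using h0 by (simp add: C_def)
  have unit: "norm (fst z - snd z) powr p \<le> e + C * h z" if "z \<in> S" for z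
  proof (cases "z \<in> K")
    case True
    have "norm (fst z - snd z) powr p \<le> 2 powr p"
      using norm_add_powr_le[of p "fst z" "- snd z"] that assms by (simp add: S_def)
    also have "\<dots> = C * h0" using h0 by (simp add: C_def)
    also have "\<dots> \<le> C * h z" using C0 h0(2)[OF True] by (intro mult_left_mono)
    finally show ?thesis using assms by simp
  next
    case False
    then have "norm (fst z - snd z) powr p \<le> e" using that by (auto simp: K_def)
    then show ?thesis using C0 hnn[of z] mult_nonneg_nonneg[of C "h z"] by linarith
  qed
  have "norm (a - b) powr p \<le> e * (norm a powr p + norm b powr p)
     + C * ((norm a powr p + norm b powr p) / 2 - norm ((1/2) *\<^sub>R (a + b)) powr p)" for a b :: 'a
  proof (cases "a = 0 \<and> b = 0")
    case False
    define N where "N = norm a powr p + norm b powr p"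
    have N: "0 < N" using False by (auto simp: N_def add_pos_nonneg add_nonneg_pos)
    define s where "s = N powr (- (1/p))"
    have s: "0 < s" "s powr p * N = 1" using N assms unfolding s_def powr_powr by (auto simp: powr_minus)
    have sc: "norm (s *\<^sub>R x) powr p = s powr p * norm x powr p" for x :: 'a
      using s by (simp add: powr_mult)
    have "(s *\<^sub>R a, s *\<^sub>R b) \<in> S"
      using s(2) unfolding S_def mem_Collect_eq fst_conv snd_conv sc N_def distrib_left .
    from unit[OF this] have "norm (s *\<^sub>R (a - b)) powr p \<le> e
       + C * ((norm (s *\<^sub>R a) powr p + norm (s *\<^sub>R b) powr p) / 2 - norm (s *\<^sub>R ((1/2) *\<^sub>R (a + b))) powr p)"
      by (simp add: h_def scaleR_diff_right scaleR_add_right)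
    then have "s powr p * norm (a - b) powr p \<le> s powr p * (e * N
       + C * (N / 2 - norm ((1/2) *\<^sub>R (a + b)) powr p))"
      unfolding sc using arg_cong[OF s(2), of "\<lambda>t. e * t"] by (simp add: N_def algebra_simps)
    then have "norm (a - b) powr p \<le> e * N + C * (N / 2 - norm ((1/2) *\<^sub>R (a + b)) powr p)"
      using s by simp
    then show ?thesis by (simp add: N_def)
  qed auto
  with C0 that show ?thesis by blast
qed


section \<open>Lebesgue spaces\<close>

lemma measurable_lebesgue_on_AE:
  fixes f g :: "'a::euclidean_space \<Rightarrow> 'b::euclidean_space"
  assumes S: "S \<in> sets lebesgue" and f: "f \<in> borel_measurable (lebesgue_on S)"
    and ae: "AE x in lebesgue_on S. f x = g x"
  shows "g \<in> borel_measurable (lebesgue_on S)"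
proof -
  have "(\<lambda>x. if x \<in> S then f x else 0) \<in> borel_measurable lebesgue"
    using S f by (simp add: borel_measurable_if)
  moreover have "AE x in lebesgue. (if x \<in> S then f x else 0) = (if x \<in> S then g x else 0)"
    using ae S by (auto simp: AE_restrict_space_iff elim!: eventually_mono)
  ultimately have "(\<lambda>x. if x \<in> S then g x else 0) \<in> borel_measurable lebesgue"
    by (rule borel_measurable_AE)
  then show ?thesis using S by (simp add: borel_measurable_if)
qed

text \<open>The \<open>p\<close>-th power of the \<open>L\<^sup>p\<close> norm. Below it serves to express convergence, for which the
  quasi-triangle inequality \<open>Lpow_add_le\<close> is as good as Minkowski's inequality.\<close>

definition Lpow :: "'a::euclidean_space set \<Rightarrow> real \<Rightarrow> ('a \<Rightarrow> 'b::euclidean_space) \<Rightarrow> real" where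
  "Lpow S p f = (LINT x|lebesgue_on S. norm (f x) powr p)"

lemma Lpow_nonneg: "0 \<le> Lpow S p f"
  by (simp add: Lpow_def)

lemma Lp_onD:
  assumes "f \<in> Lp_on S p"
  shows "f \<in> borel_measurable (lebesgue_on S)" "integrable (lebesgue_on S) (\<lambda>x. norm (f x) powr p)"
  using assms by (auto simp: Lp_on_def)

lemma Lp_on_bound:
  assumes "g \<in> borel_measurable (lebesgue_on S)" "integrable (lebesgue_on S) h"
    and "AE x in lebesgue_on S. norm (g x) powr p \<le> h x"
  shows "g \<in> Lp_on S p"
proof -
  note [measurable] = assms(1)
  have "integrable (lebesgue_on S) (\<lambda>x. norm (g x) powr p)"
    by (rule Bochner_Integration.integrable_bound[OF assms(2)])
       (use assms(3) in \<open>auto elim!: eventually_mono\<close>)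
  with assms(1) show ?thesis by (simp add: Lp_on_def)
qed

lemma Lp_on_add:
  assumes "0 < p" "f \<in> Lp_on S p" "g \<in> Lp_on S p"
  shows "(\<lambda>x. f x + g x) \<in> Lp_on S p"
proof (rule Lp_on_bound)
  note [measurable] = assms(2,3)[THEN Lp_onD(1)]
  show "(\<lambda>x. f x + g x) \<in> borel_measurable (lebesgue_on S)" by measurable
  show "integrable (lebesgue_on S) (\<lambda>x. 2 powr p * (norm (f x) powr p + norm (g x) powr p))"
    using assms by (intro integrable_mult_right Bochner_Integration.integrable_add Lp_onD)
qed (use norm_add_powr_le[OF assms(1)] in auto)

lemma Lp_on_scaleR:
  assumes "f \<in> Lp_on S p"
  shows "(\<lambda>x. c *\<^sub>R f x) \<in> Lp_on S p"
proof (rule Lp_on_bound)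
  note [measurable] = assms[THEN Lp_onD(1)]
  show "(\<lambda>x. c *\<^sub>R f x) \<in> borel_measurable (lebesgue_on S)" by measurable
  show "integrable (lebesgue_on S) (\<lambda>x. \<bar>c\<bar> powr p * norm (f x) powr p)"
    using assms by (intro integrable_mult_right Lp_onD)
qed (simp add: powr_mult)

lemma Lp_on_diff:
  assumes "0 < p" "f \<in> Lp_on S p" "g \<in> Lp_on S p"
  shows "(\<lambda>x. f x - g x) \<in> Lp_on S p"
  using Lp_on_add[OF assms(1,2) Lp_on_scaleR[OF assms(3), of "-1"]] by simp

lemma Lp_on_AE:
  assumes "S \<in> sets lebesgue" "f \<in> Lp_on S p" "AE x in lebesgue_on S. f x = g x"
  shows "g \<in> Lp_on S p"
  by (rule Lp_on_bound[OF measurable_lebesgue_on_AE[OF assms(1) _ assms(3)] Lp_onD(2)[OF assms(2)]])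
     (use assms(2,3) in \<open>auto dest: Lp_onD elim!: eventually_mono\<close>)

lemma Lpow_cong_AE:
  assumes "f \<in> borel_measurable (lebesgue_on S)" "g \<in> borel_measurable (lebesgue_on S)"
    "AE x in lebesgue_on S. f x = g x"
  shows "Lpow S p f = Lpow S p g"
  unfolding Lpow_def
  by (rule integral_cong_AE) (use assms in \<open>auto elim!: eventually_mono\<close>)

lemma Lpow_add_le:
  assumes "0 < p" "f \<in> Lp_on S p" "g \<in> Lp_on S p"
  shows "Lpow S p (\<lambda>x. f x + g x) \<le> 2 powr p * (Lpow S p f + Lpow S p g)"
proof -
  have "Lpow S p (\<lambda>x. f x + g x) \<le> (LINT x|lebesgue_on S. 2 powr p * (norm (f x) powr p + norm (g x) powr p))"
    unfolding Lpow_def using assms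
    by (intro integral_mono integrable_mult_right Bochner_Integration.integrable_add Lp_onD(2) norm_add_powr_le Lp_on_add)
  also have "\<dots> = 2 powr p * (Lpow S p f + Lpow S p g)"
    using assms by (simp add: Lpow_def Lp_onD)
  finally show ?thesis .
qed

lemma Lpow_minus_commute: "Lpow S p (\<lambda>x. f x - g x) = Lpow S p (\<lambda>x. g x - f x)"
  by (simp add: Lpow_def norm_minus_commute)

lemma nn_integral_Lpow:
  assumes "f \<in> Lp_on S p"
  shows "(\<integral>\<^sup>+ x. ennreal (norm (f x) powr p) \<partial>lebesgue_on S) = ennreal (Lpow S p f)"
  unfolding Lpow_def using assms by (intro nn_integral_eq_integral Lp_onD) auto

text \<open>If \<open>d k\<close> is the \<open>p\<close>-th power of the \<open>k\<close>-th increment, then \<open>\<Sum>k. 2 ^ k * d k\<close> has finite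
  integral and is finite almost everywhere. At such a point the increments decay geometrically.\<close>

lemma fast_Cauchy_AE_convergent:
  fixes f :: "nat \<Rightarrow> 'a::euclidean_space \<Rightarrow> 'b::euclidean_space"
  assumes p: "0 < p" and f: "\<And>k. f k \<in> Lp_on S p"
    and small: "\<And>k. Lpow S p (\<lambda>x. f (Suc k) x - f k x) \<le> (1/4) ^ k"
  shows "AE x in lebesgue_on S. convergent (\<lambda>k. f k x)"
proof -
  define d where "d k x = norm (f (Suc k) x - f k x) powr p" for k x
  note [measurable] = f[THEN Lp_onD(1)]
  have md[measurable]: "d k \<in> borel_measurable (lebesgue_on S)" for k
    unfolding d_def by measurable
  have "(\<integral>\<^sup>+ x. (\<Sum>k. ennreal (2 ^ k * d k x)) \<partial>lebesgue_on S)
      = (\<Sum>k. \<integral>\<^sup>+ x. ennreal (2 ^ k * d k x) \<partial>lebesgue_on S)"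
    by (rule nn_integral_suminf) measurable
  also have "\<dots> \<le> (\<Sum>k. ennreal ((1/2) ^ k))"
  proof (rule suminf_le)
    fix k
    have "(\<integral>\<^sup>+ x. ennreal (2 ^ k * d k x) \<partial>lebesgue_on S)
        = ennreal (2 ^ k) * (\<integral>\<^sup>+ x. ennreal (d k x) \<partial>lebesgue_on S)"
      by (subst nn_integral_cmult[symmetric]) (auto simp: ennreal_mult d_def)
    also have "\<dots> = ennreal (2 ^ k * Lpow S p (\<lambda>x. f (Suc k) x - f k x))"
      unfolding d_def using nn_integral_Lpow[OF Lp_on_diff[OF p f f]]
      by (simp add: ennreal_mult Lpow_nonneg)
    also have "\<dots> \<le> ennreal (2 ^ k * (1/4) ^ k)"
      using small by (intro ennreal_leI mult_left_mono) auto
    also have "2 ^ k * (1/4) ^ k = (1/2::real) ^ k" by (simp add: power_mult_distrib[symmetric])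
    finally show "(\<integral>\<^sup>+ x. ennreal (2 ^ k * d k x) \<partial>lebesgue_on S) \<le> ennreal ((1/2) ^ k)" .
  qed auto
  also have "\<dots> < \<infinity>"
    by (subst suminf_ennreal2) (auto intro!: summable_geometric)
  finally have "AE x in lebesgue_on S. (\<Sum>k. ennreal (2 ^ k * d k x)) \<noteq> \<infinity>"
    by (intro nn_integral_PInf_AE) auto
  then show ?thesis
  proof eventually_elim
    case (elim x)
    have "summable (\<lambda>k. 2 ^ k * d k x)"
      using elim by (intro summable_suminf_not_top) (auto simp: d_def)
    then have "bounded (range (\<lambda>k. 2 ^ k * d k x))"
      using summable_LIMSEQ_zero convergent_imp_bounded by blast
    then obtain B where "\<forall>y\<in>range (\<lambda>k. 2 ^ k * d k x). norm y \<le> B" by (auto simp only: bounded_iff)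
    then have B: "2 ^ k * d k x \<le> B" for k by (auto simp: d_def)
    have B0: "0 \<le> B" using order_trans[OF _ B[of 0], of 0] by (simp add: d_def)
    have le: "norm (f (Suc k) x - f k x) \<le> B powr (1/p) * ((1/2) powr (1/p)) ^ k" for k
    proof -
      have "norm (f (Suc k) x - f k x) = d k x powr (1/p)"
        using p by (simp add: d_def powr_powr)
      also have "\<dots> \<le> (B * (1/2) ^ k) powr (1/p)"
        using B[of k] p by (intro powr_mono2) (auto simp: d_def field_simps power_one_over)
      also have "\<dots> = B powr (1/p) * ((1/2) powr real k) powr (1/p)"
        using B0 by (simp add: powr_mult powr_realpow)
      also have "\<dots> = B powr (1/p) * ((1/2) powr (1/p)) ^ k"
        by (subst powr_powr, subst powr_power) auto
      finally show ?thesis .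
    qed
    have su: "summable (\<lambda>k. B powr (1/p) * ((1/2::real) powr (1/p)) ^ k)"
      using p powr_less_mono2[of "1/p" "1/2" 1] by (intro summable_mult summable_geometric) auto
    have "summable (\<lambda>k. f (Suc k) x - f k x)"
      by (rule summable_comparison_test'[OF su, of 0]) (rule le)
    then have "(\<lambda>n. \<Sum>k<n. f (Suc k) x - f k x) \<longlonglongrightarrow> (\<Sum>k. f (Suc k) x - f k x)"
      by (rule summable_LIMSEQ)
    then have "(\<lambda>n. f 0 x + (f n x - f 0 x)) \<longlonglongrightarrow> f 0 x + (\<Sum>k. f (Suc k) x - f k x)"
      unfolding sum_lessThan_telescope[of "\<lambda>k. f k x"] by (intro tendsto_intros)
    then show ?case by (auto simp: convergent_def)
  qed
qed

text \<open>Completeness of \<open>L\<^sup>p\<close>: a rapidly converging subsequence has a pointwise limit almost everywhere,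
  and Fatou's lemma turns the Cauchy property into convergence to that limit.\<close>

proposition Lp_on_complete:
  fixes f :: "nat \<Rightarrow> 'a::euclidean_space \<Rightarrow> 'b::euclidean_space"
  assumes p: "0 < p" and f: "\<And>k. f k \<in> Lp_on S p"
    and Cauchy: "\<And>e. 0 < e \<Longrightarrow> \<exists>N. \<forall>j\<ge>N. \<forall>k\<ge>N. Lpow S p (\<lambda>x. f j x - f k x) < e"
  obtains g where "g \<in> Lp_on S p" "(\<lambda>k. Lpow S p (\<lambda>x. f k x - g x)) \<longlonglongrightarrow> 0"
proof -
  have "\<exists>N. \<forall>j\<ge>N. \<forall>k\<ge>N. Lpow S p (\<lambda>x. f j x - f k x) < (1/4) ^ i" for i :: nat
    by (rule Cauchy) simp
  then obtain N where N: "\<And>i j k. N i \<le> j \<Longrightarrow> N i \<le> k \<Longrightarrow> Lpow S p (\<lambda>x. f j x - f k x) < (1/4) ^ i"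
    by metis
  \<comment> \<open>The summand \<open>k\<close> makes \<open>r\<close> strictly increasing, the sum puts \<open>r k\<close> and \<open>r (Suc k)\<close> above \<open>N k\<close>.\<close>
  define r where "r k = k + (\<Sum>i\<le>k. N i)" for k
  have r: "strict_mono r" by (rule strict_monoI_Suc) (simp add: r_def)
  have rN: "N k \<le> r k" "N k \<le> r (Suc k)" for k
    using member_le_sum[of k "{..k}" N] by (simp_all add: r_def)
  have ae: "AE x in lebesgue_on S. convergent (\<lambda>k. f (r k) x)"
    using f N rN by (intro fast_Cauchy_AE_convergent[OF p]) (auto intro: less_imp_le)
  define g where "g x = lim (\<lambda>k. f (r k) x)" for x
  note [measurable] = f[THEN Lp_onD(1)]
  have g[measurable]: "g \<in> borel_measurable (lebesgue_on S)" unfolding g_def by measurable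
  have fatou: "(\<integral>\<^sup>+ x. ennreal (norm (f k x - g x) powr p) \<partial>lebesgue_on S) \<le> ennreal e"
    if k: "\<And>j. n \<le> j \<Longrightarrow> Lpow S p (\<lambda>x. f k x - f j x) < e" for n k e
  proof -
    have "(\<integral>\<^sup>+ x. ennreal (norm (f k x - g x) powr p) \<partial>lebesgue_on S)
      \<le> (\<integral>\<^sup>+ x. liminf (\<lambda>j. ennreal (norm (f k x - f (r j) x) powr p)) \<partial>lebesgue_on S)"
    proof (rule nn_integral_mono_AE, use ae in eventually_elim)
      case (elim x)
      then have "(\<lambda>j. f (r j) x) \<longlonglongrightarrow> g x" by (simp add: g_def convergent_LIMSEQ_iff)
      then have "(\<lambda>j. ennreal (norm (f k x - f (r j) x) powr p)) \<longlonglongrightarrow> ennreal (norm (f k x - g x) powr p)"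
        using p by (intro tendsto_ennrealI tendsto_powr' tendsto_intros) auto
      then show ?case using lim_imp_Liminf[OF sequentially_bot] by (metis order_refl)
    qed
    also have "\<dots> \<le> liminf (\<lambda>j. \<integral>\<^sup>+ x. ennreal (norm (f k x - f (r j) x) powr p) \<partial>lebesgue_on S)"
      by (rule nn_integral_liminf) measurable
    also have "\<dots> \<le> ennreal e"
    proof (rule Liminf_le)
      show "\<forall>\<^sub>F j in sequentially. (\<integral>\<^sup>+ x. ennreal (norm (f k x - f (r j) x) powr p) \<partial>lebesgue_on S) \<le> ennreal e"
        using eventually_ge_at_top[of n]
      proof eventually_elim
        case (elim j)
        then have "n \<le> r j" using strict_mono_imp_increasing[OF r, of j] by simp
        then show ?case
          using k[of "r j"] nn_integral_Lpow[OF Lp_on_diff[OF p f f], of k "r j"]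
          by (auto intro!: ennreal_leI)
      qed
    qed simp
    finally show ?thesis .
  qed
  have diff: "(\<lambda>x. f k x - g x) \<in> Lp_on S p \<and> Lpow S p (\<lambda>x. f k x - g x) \<le> e"
    if k: "0 \<le> e" "\<And>j. n \<le> j \<Longrightarrow> Lpow S p (\<lambda>x. f k x - f j x) < e" for n k e
  proof -
    note F = fatou[OF k(2)]
    have "integrable (lebesgue_on S) (\<lambda>x. norm (f k x - g x) powr p)"
      using le_less_trans[OF F ennreal_less_top] by (intro integrableI_nonneg) auto
    then have L: "(\<lambda>x. f k x - g x) \<in> Lp_on S p" by (simp add: Lp_on_def)
    from F[unfolded nn_integral_Lpow[OF L]] k(1) L show ?thesis by (simp add: ennreal_le_iff)
  qed
  have ev: "\<exists>n. \<forall>k\<ge>n. (\<lambda>x. f k x - g x) \<in> Lp_on S p \<and> Lpow S p (\<lambda>x. f k x - g x) \<le> e" if "0 < e" for e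
    using Cauchy[OF that] diff that by (meson less_imp_le)
  from ev[of 1] obtain n where "(\<lambda>x. f n x - g x) \<in> Lp_on S p" by auto
  from Lp_on_diff[OF p f[of n] this] have "g \<in> Lp_on S p" by simp
  moreover have "(\<lambda>k. Lpow S p (\<lambda>x. f k x - g x)) \<longlonglongrightarrow> 0"
  proof (rule LIMSEQ_I)
    fix e :: real assume "0 < e"
    then obtain n where "\<forall>k\<ge>n. Lpow S p (\<lambda>x. f k x - g x) \<le> e / 2" using ev[of "e/2"] by auto
    then show "\<exists>n. \<forall>k\<ge>n. norm (Lpow S p (\<lambda>x. f k x - g x) - 0) < e"
      using \<open>0 < e\<close> by (intro exI[of _ n]) (force simp: abs_of_nonneg[OF Lpow_nonneg])
  qed
  ultimately show ?thesis using that by blast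
qed

text \<open>On sets of finite measure this elementary bound takes the place of Hoelder's inequality.\<close>

lemma norm_le_powr_bound:
  fixes t d p :: real
  assumes "1 \<le> p" "0 < d" "0 \<le> t"
  shows "t \<le> d + d powr (1 - p) * t powr p"
proof (cases "t \<le> d")
  case True
  then show ?thesis using assms by (simp add: add_increasing2)
next
  case False
  then have "d powr (p - 1) \<le> t powr (p - 1)" using assms by (intro powr_mono2) auto
  then have "d powr (1 - p) * d powr (p - 1) * t \<le> d powr (1 - p) * t powr (p - 1) * t powr 1"
    using assms by (simp add: mult_left_mono mult_right_mono)
  moreover have "d powr (1 - p) * d powr (p - 1) = 1"
    using assms by (simp add: powr_add[symmetric])
  moreover have "t powr (p - 1) * t powr 1 = t powr p" by (simp only: powr_add[symmetric]) simp
  ultimately have "t \<le> d powr (1 - p) * t powr p" by (simp add: mult.assoc)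
  then show ?thesis using assms by simp
qed

lemma Lp_on_integrable:
  assumes "S \<in> lmeasurable" "1 \<le> p" "f \<in> Lp_on S p"
  shows "integrable (lebesgue_on S) f"
    and "0 < d \<Longrightarrow> (LINT x|lebesgue_on S. norm (f x)) \<le> d * measure lebesgue S + d powr (1 - p) * Lpow S p f"
proof -
  have S: "S \<in> sets lebesgue" using assms by (simp add: fmeasurableD)
  have fin: "emeasure (lebesgue_on S) (space (lebesgue_on S)) \<noteq> \<infinity>"
    using assms(1) S by (simp add: emeasure_restrict_space fmeasurable_def less_top)
  interpret finite_measure "lebesgue_on S" by standard (use fin in simp)
  note [measurable] = Lp_onD(1)[OF assms(3)]
  have b: "integrable (lebesgue_on S) (\<lambda>x. d + d powr (1 - p) * norm (f x) powr p)" for d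
    using assms by (intro Bochner_Integration.integrable_add integrable_mult_right Lp_onD) auto
  show i: "integrable (lebesgue_on S) f"
    by (rule Bochner_Integration.integrable_bound[OF b[of 1]])
       (use norm_le_powr_bound[of p 1] assms in auto)
  assume d: "0 < d"
  have "(LINT x|lebesgue_on S. norm (f x)) \<le> (LINT x|lebesgue_on S. d + d powr (1 - p) * norm (f x) powr p)"
    using i b assms d by (intro integral_mono norm_le_powr_bound) auto
  also have "\<dots> = d * measure lebesgue S + d powr (1 - p) * Lpow S p f"
    using assms S by (simp add: Lpow_def Lp_onD measure_restrict_space)
  finally show "(LINT x|lebesgue_on S. norm (f x)) \<le> d * measure lebesgue S + d powr (1 - p) * Lpow S p f" .
qed

lemma Lpow_tendsto_L1:
  fixes f :: "nat \<Rightarrow> 'a::euclidean_space \<Rightarrow> 'b::euclidean_space"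
  assumes S: "S \<in> lmeasurable" and p: "1 \<le> p" and f: "\<And>k. f k \<in> Lp_on S p"
    and lim: "(\<lambda>k. Lpow S p (f k)) \<longlonglongrightarrow> 0"
  shows "(\<lambda>k. LINT x|lebesgue_on S. norm (f k x)) \<longlonglongrightarrow> 0"
proof (rule LIMSEQ_I)
  fix e :: real assume e: "0 < e"
  define d where "d = e / (2 * (measure lebesgue S + 1))"
  have m: "0 < measure lebesgue S + 1" by (simp add: add_nonneg_pos)
  have d: "0 < d" "d * measure lebesgue S < e / 2"
    using e m by (auto simp: d_def field_simps)
  have "(\<lambda>k. d powr (1 - p) * Lpow S p (f k)) \<longlonglongrightarrow> d powr (1 - p) * 0"
    by (intro tendsto_intros lim)
  then have "\<forall>\<^sub>F k in sequentially. d powr (1 - p) * Lpow S p (f k) < e / 2"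
    using e by (intro order_tendstoD(2)) auto
  then have "\<forall>\<^sub>F k in sequentially. norm ((LINT x|lebesgue_on S. norm (f k x)) - 0) < e"
  proof eventually_elim
    case (elim k)
    then show ?case using Lp_on_integrable(2)[OF S p f d(1), of k] d(2) by simp
  qed
  then show "\<exists>n. \<forall>k\<ge>n. norm ((LINT x|lebesgue_on S. norm (f k x)) - 0) < e"
    by (simp add: eventually_sequentially)
qed

text \<open>\<open>L\<^sup>p\<close> limits may be taken inside integrals against bounded functions, which is how weak gradients
  pass to the limit.\<close>

lemma Lpow_tendsto_bounded_pairing:
  fixes f :: "nat \<Rightarrow> 'a::euclidean_space \<Rightarrow> 'b::euclidean_space"
  assumes S: "S \<in> lmeasurable" and p: "1 \<le> p" and f: "\<And>k. f k \<in> Lp_on S p"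
    and lim: "(\<lambda>k. Lpow S p (f k)) \<longlonglongrightarrow> 0"
    and h: "h \<in> borel_measurable (lebesgue_on S)" "\<And>x. x \<in> S \<Longrightarrow> norm (h x) \<le> M"
  shows "(\<lambda>k. LINT x|lebesgue_on S. h x \<bullet> f k x) \<longlonglongrightarrow> 0"
proof (rule Lim_null_comparison)
  have "norm (LINT x|lebesgue_on S. h x \<bullet> f k x) \<le> M * (LINT x|lebesgue_on S. norm (f k x))" for k
  proof -
    have i: "integrable (lebesgue_on S) (\<lambda>x. M * norm (f k x))"
      using Lp_on_integrable(1)[OF S p f] by simp
    have le: "norm (h x \<bullet> f k x) \<le> M * norm (f k x)" if "x \<in> S" for x
      using h(2)[OF that] Cauchy_Schwarz_ineq2[of "h x" "f k x"] mult_right_mono[of "norm (h x)" M "norm (f k x)"]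
      by simp
    note [measurable] = h(1) Lp_onD(1)[OF f]
    have "integrable (lebesgue_on S) (\<lambda>x. h x \<bullet> f k x)"
      by (rule Bochner_Integration.integrable_bound[OF i]) (use le in \<open>auto intro!: AE_I2 order_trans[OF _ abs_ge_self]\<close>)
    then have "norm (LINT x|lebesgue_on S. h x \<bullet> f k x) \<le> (LINT x|lebesgue_on S. M * norm (f k x))"
      by (intro order_trans[OF integral_norm_bound integral_mono] i) (use le in auto)
    then show ?thesis by simp
  qed
  then show "\<forall>\<^sub>F k in sequentially. norm (LINT x|lebesgue_on S. h x \<bullet> f k x) \<le> M * (LINT x|lebesgue_on S. norm (f k x))"
    by simp
  show "(\<lambda>k. M * (LINT x|lebesgue_on S. norm (f k x))) \<longlonglongrightarrow> 0"
    using tendsto_mult[OF tendsto_const Lpow_tendsto_L1[OF S p f lim], of M] by simp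
qed


section \<open>Smooth functions\<close>

lemma Ck_imp_continuous:
  assumes "Ck k f"
  shows "continuous_on UNIV f"
proof (cases k)
  case (Suc j)
  with assms have "f differentiable_on UNIV" by (simp add: differentiable_on_def)
  then show ?thesis by (rule differentiable_imp_continuous_on)
qed (use assms in simp)

lemma Ck_SucD: "Ck (Suc k) f \<Longrightarrow> Ck k f"
proof (induction k arbitrary: f)
  case 0
  then show ?case using Ck_imp_continuous[OF 0] by simp
next
  case (Suc k)
  then have "Ck k (\<lambda>x. frechet_derivative f (at x) i)" if "i \<in> Basis" for i
    using that Suc.IH[of "\<lambda>x. frechet_derivative f (at x) i"] unfolding Ck.simps(2)[of "Suc k" f] by blast
  with Suc.prems show ?case by simp
qed

lemma Ck_const: "Ck k (\<lambda>x. c)"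
  by (induction k arbitrary: c) (auto simp: frechet_derivative_const)

lemma Ck_add:
  assumes "Ck k f" "Ck k g"
  shows "Ck k (\<lambda>x. f x + g x)"
  using assms
proof (induction k arbitrary: f g)
  case (Suc k)
  then have d: "f differentiable at x" "g differentiable at x" for x by auto
  have "(\<lambda>x. frechet_derivative (\<lambda>x. f x + g x) (at x) i)
      = (\<lambda>x. frechet_derivative f (at x) i + frechet_derivative g (at x) i)" for i
    by (rule ext, subst frechet_derivative_at[symmetric,
         OF has_derivative_add[OF d[unfolded frechet_derivative_works]]]) simp
  with Suc d show ?case by auto
qed (auto intro: continuous_intros)

lemma Ck_mult:
  assumes "Ck k f" "Ck k g"
  shows "Ck k (\<lambda>x. f x * g x)"
  using assms
proof (induction k arbitrary: f g)
  case (Suc k)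
  then have d: "f differentiable at x" "g differentiable at x" for x by auto
  have "(\<lambda>x. frechet_derivative (\<lambda>x. f x * g x) (at x) i)
      = (\<lambda>x. f x * frechet_derivative g (at x) i + frechet_derivative f (at x) i * g x)" for i
    by (rule ext, subst frechet_derivative_at[symmetric,
         OF has_derivative_mult[OF d[unfolded frechet_derivative_works]]]) simp
  moreover have "Ck k f" "Ck k g" using Suc.prems by (auto dest!: Ck_SucD simp del: Ck.simps)
  ultimately show ?case using Suc d by (auto intro!: Ck_add)
qed (auto intro: continuous_intros)

lemma Ck_prod:
  assumes "finite I" "\<And>i. i \<in> I \<Longrightarrow> Ck k (f i)"
  shows "Ck k (\<lambda>x. \<Prod>i\<in>I. f i x)"
  using assms by (induction I rule: finite_induct) (auto intro: Ck_const Ck_mult)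

text \<open>A smooth function of one variable is represented by the sequence \<open>F\<close> of its derivatives.\<close>

lemma Ck_compose_affine:
  fixes F :: "nat \<Rightarrow> real \<Rightarrow> real"
  assumes F: "\<And>j t. (F j has_real_derivative F (Suc j) t) (at t)"
  shows "Ck k (\<lambda>x. F j (x \<bullet> v + c))"
proof (induction k arbitrary: j)
  case 0
  have "continuous_on UNIV (F j)"
    using F DERIV_isCont continuous_at_imp_continuous_on by blast
  then show ?case by (auto intro!: continuous_intros continuous_on_compose2[of UNIV "F j"])
next
  case (Suc k)
  have d: "((\<lambda>x. F j (x \<bullet> v + c)) has_derivative (\<lambda>h. (h \<bullet> v) * F (Suc j) (x \<bullet> v + c))) (at x)" for x
    by (rule has_derivative_eq_rhs[OF has_derivative_compose[OF _ F[unfolded has_field_derivative_def]]])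
       (auto intro!: derivative_eq_intros)
  have "(\<lambda>x. frechet_derivative (\<lambda>x. F j (x \<bullet> v + c)) (at x) i) = (\<lambda>x. (i \<bullet> v) * F (Suc j) (x \<bullet> v + c))" for i
    by (rule ext, subst frechet_derivative_at[symmetric, OF d]) simp
  moreover have "(\<lambda>x. F j (x \<bullet> v + c)) differentiable at x" for x
    using d differentiable_def by blast
  ultimately show ?case using Suc by (auto intro!: Ck_mult Ck_const)
qed

text \<open>For \<open>q = 1\<close> this is the standard smooth function \<open>exp (- 1 / t)\<close>, extended by zero. The polynomial
  \<open>q\<close> makes the family closed under differentiation.\<close>

definition exp_inverse :: "real poly \<Rightarrow> real \<Rightarrow> real" where
  "exp_inverse q t = (if 0 < t then poly q (1 / t) * exp (- (1 / t)) else 0)"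

lemma poly_times_exp_minus_tendsto_0:
  fixes q :: "real poly"
  shows "((\<lambda>y. poly q y * exp (- y)) \<longlongrightarrow> 0) at_top"
proof -
  have "((\<lambda>y. \<Sum>i\<le>degree q. coeff q i * (y ^ i / exp y)) \<longlongrightarrow> (\<Sum>i\<le>degree q. coeff q i * 0)) at_top"
    by (intro tendsto_intros tendsto_power_div_exp_0)
  then show ?thesis
    by (simp add: poly_altdef sum_distrib_right exp_minus field_simps sum_divide_distrib)
qed

text \<open>At \<open>t = 0\<close> the difference quotient from the right is \<open>y * poly q y * exp (- y)\<close> with
  \<open>y = 1 / h\<close>, and the exponential wins.\<close>

lemma exp_inverse_derivative:
  "(exp_inverse q has_real_derivative exp_inverse ([:0, 0, 1:] * (q - pderiv q)) t) (at t)"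
proof -
  consider "0 < t" | "t < 0" | "t = 0" by linarith
  then show ?thesis
  proof cases
    case 1
    have "((\<lambda>t. poly q (1 / t) * exp (- (1 / t))) has_real_derivative
       exp_inverse ([:0, 0, 1:] * (q - pderiv q)) t) (at t)"
      using 1 by (auto intro!: derivative_eq_intros DERIV_chain2[OF poly_DERIV]
            simp: exp_inverse_def field_simps power2_eq_square)
    then show ?thesis
      by (rule has_field_derivative_transform_within_open[of _ _ _ "{0<..}"]) (use 1 in \<open>auto simp: exp_inverse_def\<close>)
  next
    case 2
    have "((\<lambda>t. 0) has_real_derivative exp_inverse ([:0, 0, 1:] * (q - pderiv q)) t) (at t)"
      using 2 by (auto simp: exp_inverse_def)
    then show ?thesis
      by (rule has_field_derivative_transform_within_open[of _ _ _ "{..<0}"]) (use 2 in \<open>auto simp: exp_inverse_def\<close>)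
  next
    case 3
    have "((\<lambda>h. poly ([:0, 1:] * q) (inverse h) * exp (- (inverse h))) \<longlongrightarrow> 0) (at_right 0)"
      by (rule filterlim_compose[OF poly_times_exp_minus_tendsto_0 filterlim_inverse_at_top_right])
    then have "((\<lambda>h. exp_inverse q h / h) \<longlongrightarrow> 0) (at_right 0)"
      by (rule Lim_transform_eventually)
         (auto simp: eventually_at_filter exp_inverse_def divide_simps)
    moreover have "((\<lambda>h. exp_inverse q h / h) \<longlongrightarrow> 0) (at_left 0)"
      by (rule Lim_transform_eventually[OF tendsto_const])
         (auto simp: eventually_at_filter exp_inverse_def)
    ultimately have "((\<lambda>h. exp_inverse q h / h) \<longlongrightarrow> 0) (at 0)" by (rule filterlim_split_at[rotated])
    then show ?thesis using 3 by (simp add: has_field_derivative_iff exp_inverse_def)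
  qed
qed

lemma Ck_exp_inverse: "Ck k (\<lambda>x. exp_inverse 1 (x \<bullet> v + c))"
  using Ck_compose_affine[of "\<lambda>j. exp_inverse (((\<lambda>q. [:0, 0, 1:] * (q - pderiv q)) ^^ j) 1)" k 0 v c]
    exp_inverse_derivative by simp

text \<open>A product of functions \<open>exp (- 1 / ((n + 1) t))\<close> of the distances \<open>t\<close> to the faces of the box. It is
  smooth, supported in the closed box, and tends to the indicator of the open box as \<open>n\<close> grows.\<close>

definition box_bump :: "'a::euclidean_space \<Rightarrow> 'a \<Rightarrow> nat \<Rightarrow> 'a \<Rightarrow> real" where
  "box_bump a b n x = (\<Prod>i\<in>Basis. exp_inverse 1 (real (Suc n) * (x \<bullet> i - a \<bullet> i))
      * exp_inverse 1 (real (Suc n) * (b \<bullet> i - x \<bullet> i)))"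

lemma exp_inverse_bounds: "0 \<le> exp_inverse 1 t" "exp_inverse 1 t \<le> 1"
  by (auto simp: exp_inverse_def)

lemma box_bump_bounds: "0 \<le> box_bump a b n x" "box_bump a b n x \<le> 1"
  unfolding box_bump_def
  by (auto intro!: prod_nonneg prod_le_1 mult_nonneg_nonneg mult_le_one exp_inverse_bounds)

lemma box_bump_outside: "x \<notin> box a b \<Longrightarrow> box_bump a b n x = 0"
  by (force simp: box_bump_def mem_box exp_inverse_def mult_le_0_iff zero_less_mult_iff)

lemma Ck_box_bump: "Ck k (box_bump a b n)"
proof -
  have "Ck k (\<lambda>x. \<Prod>i\<in>Basis. exp_inverse 1 (x \<bullet> (real (Suc n) *\<^sub>R i) + (- real (Suc n) * (a \<bullet> i)))
      * exp_inverse 1 (x \<bullet> (- real (Suc n) *\<^sub>R i) + real (Suc n) * (b \<bullet> i)))"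
    by (intro Ck_prod Ck_mult Ck_exp_inverse finite_Basis)
  then show ?thesis by (simp add: box_bump_def[abs_def] algebra_simps)
qed

lemma box_bump_test_function:
  assumes "cbox a b \<subseteq> \<Omega>"
  shows "box_bump a b n \<in> test_functions \<Omega>"
proof -
  have "{x. box_bump a b n x \<noteq> 0} \<subseteq> cbox a b"
    using box_bump_outside[of _ a b n] box_subset_cbox[of a b] by blast
  then have c: "closure {x. box_bump a b n x \<noteq> 0} \<subseteq> cbox a b"
    by (rule closure_minimal) (rule closed_cbox)
  then have "compact (closure {x. box_bump a b n x \<noteq> 0})"
    by (meson bounded_cbox bounded_subset closed_closure compact_eq_bounded_closed)
  with c assms show ?thesis by (auto simp: test_functions_def Ck_box_bump)
qed

lemma box_bump_tendsto_indicator: "(\<lambda>n. box_bump a b n x) \<longlonglongrightarrow> indicator (box a b) x"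
proof (cases "x \<in> box a b")
  case True
  have lim: "(\<lambda>n. exp_inverse 1 (real (Suc n) * t)) \<longlonglongrightarrow> 1" if "0 < t" for t
  proof -
    have "(\<lambda>n. exp (- (inverse (real (Suc n)) * inverse t))) \<longlonglongrightarrow> exp (- (0 * inverse t))"
      by (intro tendsto_intros LIMSEQ_inverse_real_of_nat)
    moreover have "exp_inverse 1 (real (Suc n) * t) = exp (- (inverse (real (Suc n)) * inverse t))" for n
      using that by (simp add: exp_inverse_def zero_less_mult_iff divide_inverse)
    ultimately show ?thesis by simp
  qed
  have "(\<lambda>n. box_bump a b n x) \<longlonglongrightarrow> (\<Prod>i\<in>(Basis::'a set). 1 * 1)"
    unfolding box_bump_def using True
    by (intro tendsto_prod tendsto_mult lim) (auto simp: mem_box)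
  then show ?thesis using True by simp
qed (simp add: box_bump_outside)

lemma closure_nonzero_subset:
  assumes "\<And>x. f x = 0 \<Longrightarrow> g x = 0 \<Longrightarrow> h x = 0"
  shows "closure {x. h x \<noteq> (0::real)} \<subseteq> closure {x. f x \<noteq> (0::real)} \<union> closure {x. g x \<noteq> (0::real)}"
  unfolding closure_Un[symmetric] by (rule closure_mono) (use assms in blast)

lemma test_functions_combine:
  assumes "f \<in> test_functions \<Omega>" "g \<in> test_functions \<Omega>"
  shows "(\<lambda>x. f x + g x) \<in> test_functions \<Omega>" "(\<lambda>x. c * f x) \<in> test_functions \<Omega>"
proof -
  have *: "(\<lambda>x. h x) \<in> test_functions \<Omega>"
    if "\<And>k. Ck k h" "\<And>x. f x = 0 \<Longrightarrow> g x = 0 \<Longrightarrow> h x = 0" for h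
  proof -
    note sub = closure_nonzero_subset[of f g h, OF that(2)]
    have "compact (closure {x. h x \<noteq> 0})"
    proof -
      have "compact (closure {x. f x \<noteq> 0} \<union> closure {x. g x \<noteq> 0})"
        using assms unfolding test_functions_def by blast
      from bounded_subset[OF compact_imp_bounded[OF this] sub] show ?thesis
        by (simp only: compact_eq_bounded_closed closed_closure simp_thms)
    qed
    moreover have "closure {x. h x \<noteq> 0} \<subseteq> \<Omega>"
      using sub assms unfolding test_functions_def by blast
    ultimately show ?thesis using that(1) by (simp add: test_functions_def)
  qed
  have "Ck k f" "Ck k g" for k using assms by (simp_all add: test_functions_def)
  then show "(\<lambda>x. f x + g x) \<in> test_functions \<Omega>" "(\<lambda>x. c * f x) \<in> test_functions \<Omega>"
    by (simp_all add: *[of "\<lambda>x. f x + g x"] *[of "\<lambda>x. c * f x"] Ck_add Ck_mult Ck_const)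
qed

lemma zero_test_function: "(\<lambda>x. 0) \<in> test_functions \<Omega>"
  by (simp add: test_functions_def Ck_const)

definition grad :: "('a::euclidean_space \<Rightarrow> real) \<Rightarrow> 'a \<Rightarrow> 'a" where
  "grad \<phi> x = (\<Sum>i\<in>Basis. frechet_derivative \<phi> (at x) i *\<^sub>R i)"

lemma grad_inner_Basis: "i \<in> Basis \<Longrightarrow> grad \<phi> x \<bullet> i = frechet_derivative \<phi> (at x) i"
  by (simp add: grad_def inner_sum_left inner_Basis if_distrib sum.delta cong: if_cong)

lemma has_derivative_grad:
  assumes "\<phi> differentiable at x"
  shows "(\<phi> has_derivative (\<lambda>h. grad \<phi> x \<bullet> h)) (at x)"
proof -
  have l: "linear (frechet_derivative \<phi> (at x))" using assms by (rule linear_frechet_derivative)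
  have "frechet_derivative \<phi> (at x) h = grad \<phi> x \<bullet> h" for h
  proof -
    have "frechet_derivative \<phi> (at x) h = frechet_derivative \<phi> (at x) (\<Sum>i\<in>Basis. (h \<bullet> i) *\<^sub>R i)"
      by (simp add: euclidean_representation)
    also have "\<dots> = grad \<phi> x \<bullet> h"
      using l by (simp add: linear_sum linear_scale grad_def inner_sum_left inner_sum_right mult.commute inner_commute o_def)
    finally show ?thesis .
  qed
  then have "frechet_derivative \<phi> (at x) = (\<lambda>h. grad \<phi> x \<bullet> h)" ..
  then show ?thesis using assms[unfolded frechet_derivative_works] by simp
qed

lemma test_function_calculus:
  assumes "\<phi> \<in> test_functions \<Omega>"
  shows "(\<phi> has_derivative (\<lambda>h. grad \<phi> x \<bullet> h)) (at x)"
    and "continuous_on UNIV \<phi>" and "continuous_on UNIV (grad \<phi>)"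
    and "x \<notin> closure {x. \<phi> x \<noteq> 0} \<Longrightarrow> \<phi> x = 0 \<and> grad \<phi> x = 0"
proof -
  have C: "Ck k \<phi>" for k using assms by (simp add: test_functions_def)
  show d: "(\<phi> has_derivative (\<lambda>h. grad \<phi> x \<bullet> h)) (at x)" for x
    using C[of "Suc 0"] by (intro has_derivative_grad) auto
  show "continuous_on UNIV \<phi>" using C Ck_imp_continuous by blast
  have "continuous_on UNIV (\<lambda>x. frechet_derivative \<phi> (at x) i)" if "i \<in> Basis" for i
    using C[of "Suc 0"] that by auto
  then show "continuous_on UNIV (grad \<phi>)"
    unfolding grad_def[abs_def] by (intro continuous_intros) auto
  assume x: "x \<notin> closure {x. \<phi> x \<noteq> 0}"
  have "((\<lambda>x. 0::real) has_derivative (\<lambda>h. grad \<phi> x \<bullet> h)) (at x)"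
    by (rule has_derivative_transform_within_open[OF d[of x], of "- closure {x. \<phi> x \<noteq> 0}"])
       (use x closure_subset[of "{x. \<phi> x \<noteq> 0}"] in auto)
  from has_derivative_unique[OF this has_derivative_const]
  have "grad \<phi> x \<bullet> grad \<phi> x = 0" by meson
  moreover have "\<phi> x = 0" using x closure_subset[of "{x. \<phi> x \<noteq> 0}"] by auto
  ultimately show "\<phi> x = 0 \<and> grad \<phi> x = 0" by simp
qed

section \<open>Integration by parts\<close>

lemma integrable_compact_support:
  fixes f :: "'a::euclidean_space \<Rightarrow> 'b::{banach, second_countable_topology}"
  assumes "compact K" "continuous_on UNIV f" "\<And>x. x \<notin> K \<Longrightarrow> f x = 0"
  shows "integrable lborel f"
proof -
  have "(\<lambda>x. indicator K x *\<^sub>R f x) = f" using assms(3) by (auto simp: indicator_def)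
  moreover have "integrable lborel (\<lambda>x. indicator K x *\<^sub>R f x)"
    by (rule borel_integrable_compact[OF assms(1) continuous_on_subset[OF assms(2)]]) simp
  ultimately show ?thesis by simp
qed

lemma integral_translate:
  fixes f :: "'a::euclidean_space \<Rightarrow> real"
  assumes "f \<in> borel_measurable borel"
  shows "(LINT x|lborel. f (c + x)) = integral\<^sup>L lborel f"
proof -
  have "integral\<^sup>L (distr lborel borel ((+) c)) f = (LINT x|lborel. f (c + x))"
    using assms by (intro integral_distr) auto
  then show ?thesis by (simp add: lborel_distr_plus)
qed

text \<open>The difference quotients \<open>q n\<close> of \<open>f\<close> have integral zero because Lebesgue measure is translation
  invariant. They are bounded by \<open>B\<close> (mean value theorem), vanish outside one ball \<open>D\<close>, and
  converge to \<open>g\<close>.\<close>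

lemma integral_directional_derivative_zero:
  fixes f g :: "'a::euclidean_space \<Rightarrow> real"
  assumes K: "compact K" and f: "continuous_on UNIV f" "\<And>x. x \<notin> K \<Longrightarrow> f x = 0"
    and g: "continuous_on UNIV g" "\<And>x. x \<notin> K \<Longrightarrow> g x = 0"
    and deriv: "\<And>x. ((\<lambda>t. f (x + t *\<^sub>R v)) has_real_derivative g x) (at 0)"
  shows "integral\<^sup>L lborel g = 0"
proof -
  have deriv': "((\<lambda>t. f (x + t *\<^sub>R v)) has_real_derivative g (x + s *\<^sub>R v)) (at s)" for x s
  proof -
    have "((\<lambda>t. f ((x + s *\<^sub>R v) + (t + - s) *\<^sub>R v)) has_real_derivative g (x + s *\<^sub>R v)) (at s)"
      using deriv[of "x + s *\<^sub>R v"] DERIV_shift[of "\<lambda>t. f ((x + s *\<^sub>R v) + t *\<^sub>R v)" _ s "- s"] by simp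
    then show ?thesis by (simp add: algebra_simps)
  qed
  obtain B where B: "0 \<le> B" "\<And>x. \<bar>g x\<bar> \<le> B"
  proof -
    have "compact (g ` K)" by (rule compact_continuous_image[OF continuous_on_subset[OF g(1)] K]) simp
    then obtain b where "\<forall>y\<in>g ` K. norm y \<le> b" using compact_imp_bounded bounded_iff by blast
    then have "\<bar>g x\<bar> \<le> max b 0" for x using g(2)[of x] by (cases "x \<in> K") (auto simp: le_max_iff_disj)
    then show ?thesis using that[of "max b 0"] by auto
  qed
  obtain R where R: "\<And>x. x \<in> K \<Longrightarrow> norm x \<le> R" using compact_imp_bounded[OF K] bounded_iff by blast
  define D where "D = cball (0::'a) (R + norm v)"
  define q where "q n x = real (Suc n) * (f (inverse (real (Suc n)) *\<^sub>R v + x) - f x)" for n x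
  have qB: "\<bar>q n x\<bar> \<le> B" for n x
  proof -
    have "\<exists>z. 0 < z \<and> z < inverse (real (Suc n)) \<and> f (x + inverse (real (Suc n)) *\<^sub>R v) - f (x + 0 *\<^sub>R v)
        = (inverse (real (Suc n)) - 0) * g (x + z *\<^sub>R v)"
      by (rule MVT2) (use deriv' in auto)
    then obtain z where "f (x + inverse (real (Suc n)) *\<^sub>R v) - f x = inverse (real (Suc n)) * g (x + z *\<^sub>R v)"
      by auto
    then have "q n x = g (x + z *\<^sub>R v)" unfolding q_def by (simp add: add.commute)
    then show ?thesis using B by simp
  qed
  have q0: "q n x = 0" if "x \<notin> D" for n x
  proof -
    have "R < norm x" using that norm_ge_zero[of v] unfolding D_def mem_cball_0 by linarith
    then have "x \<notin> K" using R[of x] by auto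
    moreover have "inverse (real (Suc n)) *\<^sub>R v + x \<notin> K"
    proof
      assume "inverse (real (Suc n)) *\<^sub>R v + x \<in> K"
      then have "norm (inverse (real (Suc n)) *\<^sub>R v + x) \<le> R" by (rule R)
      moreover have "norm x \<le> norm (inverse (real (Suc n)) *\<^sub>R v + x) + norm (inverse (real (Suc n)) *\<^sub>R v)"
        using norm_triangle_ineq4[of "inverse (real (Suc n)) *\<^sub>R v + x" "inverse (real (Suc n)) *\<^sub>R v"] by simp
      moreover have "norm (inverse (real (Suc n)) *\<^sub>R v) \<le> norm v"
        using mult_right_mono[of "inverse (real (Suc n))" 1 "norm v"] by (simp add: field_simps)
      ultimately show False using that by (simp add: D_def)
    qed
    ultimately show ?thesis by (simp add: q_def f(2))
  qed
  have [measurable]: "f \<in> borel_measurable borel" "g \<in> borel_measurable borel"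
    using f(1) g(1) by (auto intro: borel_measurable_continuous_onI)
  have [measurable]: "q n \<in> borel_measurable borel" for n
    unfolding q_def by measurable
  have fi: "integrable lborel f" by (rule integrable_compact_support[OF K f])
  have "integral\<^sup>L lborel (q n) = 0" for n
  proof -
    have "integrable lborel (\<lambda>x. f (inverse (real (Suc n)) *\<^sub>R v + x))"
    proof (rule integrable_compact_support)
      show "compact ((\<lambda>x. x - inverse (real (Suc n)) *\<^sub>R v) ` K)"
        by (intro compact_continuous_image continuous_intros K)
      show "continuous_on UNIV (\<lambda>x. f (inverse (real (Suc n)) *\<^sub>R v + x))"
        by (rule continuous_on_compose2[OF f(1)]) (auto intro!: continuous_intros)
      fix x assume "x \<notin> (\<lambda>x. x - inverse (real (Suc n)) *\<^sub>R v) ` K"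
      then have "inverse (real (Suc n)) *\<^sub>R v + x \<notin> K" by (force simp: image_iff)
      then show "f (inverse (real (Suc n)) *\<^sub>R v + x) = 0" by (rule f(2))
    qed
    then show ?thesis unfolding q_def using fi by (simp add: integral_translate)
  qed
  then have q_int: "integral\<^sup>L lborel (q n) = 0" for n .
  have "(\<lambda>n. integral\<^sup>L lborel (q n)) \<longlonglongrightarrow> integral\<^sup>L lborel g"
  proof (rule integral_dominated_convergence)
    show "integrable lborel (\<lambda>x. indicator D x *\<^sub>R B)"
      by (rule borel_integrable_compact) (auto simp: D_def)
    show "AE x in lborel. (\<lambda>n. q n x) \<longlonglongrightarrow> g x"
    proof (rule AE_I2)
      fix x
      have "((\<lambda>t. (f (x + t *\<^sub>R v) - f x) / t) \<longlongrightarrow> g x) (at 0)"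
        using deriv[of x] by (simp add: has_field_derivative_iff)
      moreover have "filterlim (\<lambda>n. inverse (real (Suc n))) (at 0) sequentially"
        using LIMSEQ_inverse_real_of_nat by (simp add: filterlim_at)
      ultimately have "(\<lambda>n. (f (x + inverse (real (Suc n)) *\<^sub>R v) - f x) / inverse (real (Suc n))) \<longlonglongrightarrow> g x"
        by (rule filterlim_compose)
      then show "(\<lambda>n. q n x) \<longlonglongrightarrow> g x" unfolding q_def by (simp add: divide_inverse mult.commute add.commute)
    qed
    show "AE x in lborel. norm (q n x) \<le> indicator D x *\<^sub>R B" for n
      using qB[of n] q0[of _ n] by (auto simp: indicator_def)
  qed auto
  then have "(\<lambda>n. 0) \<longlonglongrightarrow> integral\<^sup>L lborel g" unfolding q_int .
  then show ?thesis by (simp add: LIMSEQ_const_iff)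
qed

lemma integral_lebesgue_on_compact_support:
  fixes f :: "'a::euclidean_space \<Rightarrow> real"
  assumes "open \<Omega>" "continuous_on UNIV f" "\<And>x. x \<notin> \<Omega> \<Longrightarrow> f x = 0"
  shows "integral\<^sup>L (lebesgue_on \<Omega>) f = integral\<^sup>L lborel f"
proof -
  have "\<Omega> \<in> sets lebesgue" using assms(1) by auto
  then have "integral\<^sup>L (lebesgue_on \<Omega>) f = integral\<^sup>L lebesgue (\<lambda>x. indicator \<Omega> x *\<^sub>R f x)"
    by (intro integral_restrict_space) simp
  also have "(\<lambda>x. indicator \<Omega> x *\<^sub>R f x) = f" using assms(3) by (auto simp: indicator_def fun_eq_iff)
  also have "integral\<^sup>L lebesgue f = integral\<^sup>L lborel f"
    using assms(2) by (intro integral_completion) (auto intro: borel_measurable_continuous_onI)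
  finally show ?thesis .
qed

lemma has_derivative_imp_directional:
  fixes u :: "'a::real_inner \<Rightarrow> real"
  assumes "(u has_derivative (\<lambda>h. G \<bullet> h)) (at x)"
  shows "((\<lambda>t. u (x + t *\<^sub>R v)) has_real_derivative G \<bullet> v) (at 0)"
proof -
  have "((\<lambda>t. u (x + t *\<^sub>R v)) has_derivative (\<lambda>t. G \<bullet> (t *\<^sub>R v))) (at 0)"
    by (rule has_derivative_compose[of "\<lambda>t. x + t *\<^sub>R v" "\<lambda>t. t *\<^sub>R v" 0 UNIV u "\<lambda>h. G \<bullet> h"])
       (use assms in \<open>auto intro!: derivative_eq_intros\<close>)
  then show ?thesis by (simp add: has_field_derivative_def mult.commute[of _ "G \<bullet> v"])
qed

text \<open>The directional derivative of \<open>\<lambda>x. u x * \<phi> x\<close> has integral zero. An arbitrary direction \<open>v\<close> is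
  allowed because the divergence of Wolff's solutions is computed in a frame adapted to them.\<close>

proposition integration_by_parts:
  fixes u :: "'a::euclidean_space \<Rightarrow> real"
  assumes "open \<Omega>" and \<phi>: "\<phi> \<in> test_functions \<Omega>"
    and u: "\<And>x. (u has_derivative (\<lambda>h. G x \<bullet> h)) (at x)" and G: "continuous_on UNIV G"
  shows "(LINT x|lebesgue_on \<Omega>. u x * (grad \<phi> x \<bullet> v)) = - (LINT x|lebesgue_on \<Omega>. (G x \<bullet> v) * \<phi> x)"
proof -
  define K where "K = closure {x. \<phi> x \<noteq> 0}"
  have K: "compact K" "K \<subseteq> \<Omega>" using \<phi> by (auto simp: K_def test_functions_def)
  note cal = test_function_calculus[OF \<phi>, folded K_def]
  have cu: "continuous_on UNIV u"
    using has_derivative_continuous[OF u] by (intro continuous_at_imp_continuous_on) simp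
  note cont = cu G cal(2,3)
  have c: "continuous_on UNIV (\<lambda>x. u x * \<phi> x)" "continuous_on UNIV (\<lambda>x. u x * (grad \<phi> x \<bullet> v))"
    "continuous_on UNIV (\<lambda>x. (G x \<bullet> v) * \<phi> x)"
    by (intro continuous_intros cont)+
  have z: "\<phi> x = 0" "grad \<phi> x = 0" if "x \<notin> K" for x using cal(4)[OF that] by auto
  have z': "\<phi> x = 0" "grad \<phi> x = 0" if "x \<notin> \<Omega>" for x using z K(2) that by blast+
  have i: "integrable lborel (\<lambda>x. u x * (grad \<phi> x \<bullet> v))" "integrable lborel (\<lambda>x. (G x \<bullet> v) * \<phi> x)"
    using z by (simp_all add: integrable_compact_support[OF K(1)] c)
  have "integral\<^sup>L lborel (\<lambda>x. u x * (grad \<phi> x \<bullet> v) + (G x \<bullet> v) * \<phi> x) = 0"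
  proof (rule integral_directional_derivative_zero[OF K(1), of "\<lambda>x. u x * \<phi> x" _ v])
    show "continuous_on UNIV (\<lambda>x. u x * \<phi> x)" by (rule c)
    show "continuous_on UNIV (\<lambda>x. u x * (grad \<phi> x \<bullet> v) + (G x \<bullet> v) * \<phi> x)"
      by (intro continuous_on_add c)
    show "((\<lambda>t. u (x + t *\<^sub>R v) * \<phi> (x + t *\<^sub>R v)) has_real_derivative
        u x * (grad \<phi> x \<bullet> v) + (G x \<bullet> v) * \<phi> x) (at 0)" for x
      using DERIV_mult[OF has_derivative_imp_directional[OF u] has_derivative_imp_directional[OF cal(1)], of x v x v]
      by (simp add: algebra_simps)
  qed (simp_all add: z)
  moreover have "(LINT x|lebesgue_on \<Omega>. u x * (grad \<phi> x \<bullet> v)) = integral\<^sup>L lborel (\<lambda>x. u x * (grad \<phi> x \<bullet> v))"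
    "(LINT x|lebesgue_on \<Omega>. (G x \<bullet> v) * \<phi> x) = integral\<^sup>L lborel (\<lambda>x. (G x \<bullet> v) * \<phi> x)"
    using z' by (simp_all add: integral_lebesgue_on_compact_support[OF \<open>open \<Omega>\<close>] c)
  ultimately show ?thesis using i by simp
qed


section \<open>Weak gradients\<close>

lemma loc_integrable_times_test:
  fixes F :: "'a::euclidean_space \<Rightarrow> 'b::euclidean_space"
  assumes F: "loc_integrable \<Omega> F" and K: "compact K" "K \<subseteq> \<Omega>" and \<Omega>: "open \<Omega>"
    and f: "continuous_on UNIV f" "\<And>x. x \<notin> K \<Longrightarrow> f x = (0::real)"
  shows "integrable (lebesgue_on \<Omega>) (\<lambda>x. f x *\<^sub>R F x)"
proof -
  have KL: "K \<in> sets lebesgue" using K(1) by (simp add: compact_imp_closed)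
  have "integrable (lebesgue_on K) F" using F K by (auto simp: loc_integrable_def)
  then have i: "integrable lebesgue (\<lambda>x. if x \<in> K then F x else 0)"
    using KL by (simp add: Lebesgue_Measure.integrable_restrict_UNIV)
  have "compact (f ` K)" by (rule compact_continuous_image[OF continuous_on_subset[OF f(1)] K(1)]) simp
  then obtain b where "\<forall>y\<in>f ` K. norm y \<le> b" using compact_imp_bounded bounded_iff by metis
  then have b: "\<bar>f x\<bar> \<le> b" if "x \<in> K" for x using that by auto
  have fm[measurable]: "f \<in> borel_measurable lebesgue"
    using f(1) by (intro measurable_completion) (auto intro: borel_measurable_continuous_onI)
  note [measurable] = borel_measurable_integrable[OF i]
  have "integrable lebesgue (\<lambda>x. f x *\<^sub>R (if x \<in> K then F x else 0))"
  proof (rule Bochner_Integration.integrable_bound[OF integrable_scaleR_right[OF i, of b]])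
    have "norm (f x *\<^sub>R (if x \<in> K then F x else 0)) \<le> norm (b *\<^sub>R (if x \<in> K then F x else 0))" for x
      using b[of x] by (auto intro!: mult_right_mono)
    then show "AE x in lebesgue. norm (f x *\<^sub>R (if x \<in> K then F x else 0)) \<le> norm (b *\<^sub>R (if x \<in> K then F x else 0))"
      by simp
  qed measurable
  also have "(\<lambda>x. f x *\<^sub>R (if x \<in> K then F x else 0)) = (\<lambda>x. if x \<in> \<Omega> then f x *\<^sub>R F x else 0)"
    using K(2) f(2) by (auto simp: fun_eq_iff)
  finally show ?thesis using \<Omega> by (simp add: Lebesgue_Measure.integrable_restrict_UNIV)
qed

text \<open>Open boxes generate the Borel sets and are stable under intersection, so Dynkin's argument extends
  the vanishing of the integrals from boxes to all Borel sets.\<close>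

lemma AE_zero_if_integral_boxes_zero:
  fixes h :: "'a::euclidean_space \<Rightarrow> real"
  assumes h: "integrable lborel h"
    and total: "integral\<^sup>L lborel h = 0"
    and boxes: "\<And>a b. (LINT x|lborel. indicator (box a b) x * h x) = 0"
  shows "AE x in lborel. h x = 0"
proof -
  have all: "(LINT x:A|lborel. h x) = 0" if "A \<in> sets borel" for A
  proof -
    let ?G = "range (\<lambda>(a, b). box a b :: 'a set)"
    have "Int_stable ?G" by (auto simp: Int_stable_def box_Int_box)
    moreover have "?G \<subseteq> Pow UNIV" by simp
    moreover have "A \<in> sigma_sets UNIV ?G"
      using that unfolding borel_eq_box by (simp add: sets_measure_of)
    ultimately show ?thesis
    proof (induction rule: sigma_sets_induct_disjoint)
      case (basic A)
      then show ?case using boxes by (auto simp: set_lebesgue_integral_def)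
    next
      case (compl A)
      then have A: "A \<in> sets lborel" by (simp add: borel_eq_box sets_measure_of)
      have "(LINT x:UNIV - A|lborel. h x) = (LINT x|lborel. h x - indicator A x * h x)"
        unfolding set_lebesgue_integral_def
        by (intro Bochner_Integration.integral_cong) (auto simp: indicator_def)
      also have "\<dots> = 0"
        using compl h total integrable_mult_indicator[OF A h] by (simp add: set_lebesgue_integral_def)
      finally show ?case .
    next
      case (union A)
      then have A: "A i \<in> sets lborel" for i by (auto simp: borel_eq_box sets_measure_of)
      have "(LINT x:(\<Union>i. A i)|lborel. h x) = (\<Sum>i. LINT x:A i|lborel. h x)"
      proof (rule lebesgue_integral_countable_add)
        show "A i \<inter> A j = {}" if "i \<noteq> j" for i j
          using union(1) that by (auto simp: disjoint_family_on_def)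
        show "set_integrable lborel (\<Union>i. A i) h"
          unfolding set_integrable_def using A h by (intro integrable_mult_indicator) auto
      qed (rule A)
      also have "\<dots> = 0" using union(3) by simp
      finally show ?case .
    qed (simp add: set_lebesgue_integral_def)
  qed
  show ?thesis
    by (rule density_unique_real[OF h, of "\<lambda>_. 0"]) (use all in \<open>auto simp: set_lebesgue_integral_def\<close>)
qed

text \<open>Testing with \<^const>\<open>box_bump\<close> and letting \<open>n\<close> grow shows that \<open>H\<close> has integral zero over every
  open box whose closure lies in \<open>\<Omega>\<close>. Since \<open>H\<close> is only locally integrable, the conclusion is
  first drawn inside one closed box and then on a countable cover of \<open>\<Omega>\<close>.\<close>

proposition fundamental_lemma:
  fixes H :: "'a::euclidean_space \<Rightarrow> real"
  assumes \<Omega>: "open \<Omega>" and H: "loc_integrable \<Omega> H"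
    and test: "\<And>\<phi>. \<phi> \<in> test_functions \<Omega> \<Longrightarrow> (LINT x|lebesgue_on \<Omega>. H x * \<phi> x) = 0"
  shows "AE x in lebesgue_on \<Omega>. H x = 0"
proof -
  have \<Omega>L: "\<Omega> \<in> sets lebesgue" using \<Omega> by simp
  have local: "AE x in lebesgue. x \<in> cbox a b \<longrightarrow> H x = 0" if ab: "cbox a b \<subseteq> \<Omega>" for a b
  proof -
    define h where "h x = indicator (box a b) x * H x" for x
    have "integrable (lebesgue_on (cbox a b)) H" using H ab by (auto simp: loc_integrable_def)
    then have "integrable lebesgue (\<lambda>x. if x \<in> cbox a b then H x else 0)"
      by (subst Lebesgue_Measure.integrable_restrict_UNIV) auto
    then have "integrable lebesgue (\<lambda>x. indicator (box a b) x *\<^sub>R (if x \<in> cbox a b then H x else 0))"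
      by (intro integrable_mult_indicator) auto
    also have "(\<lambda>x. indicator (box a b) x *\<^sub>R (if x \<in> cbox a b then H x else 0)) = h"
      using box_subset_cbox[of a b] by (auto simp: h_def indicator_def fun_eq_iff)
    finally have h: "integrable lebesgue h" .
    have boxes: "(LINT x|lebesgue. indicator (box c d) x * h x) = 0" for c d
    proof -
      obtain a' b' where ab': "box a b \<inter> box c d = box a' b'" using box_Int_box by blast
      have eq: "indicator (box c d) x * h x = indicator (box a' b') x * h x" for x
        using ab' by (auto simp: h_def indicator_def)
      show ?thesis
      proof (cases "box a' b' = {}")
        case True
        then show ?thesis unfolding eq by simp
      next
        case False
        have "cbox a' b' = closure (box a' b')" using False by (simp add: closure_box)
        also have "\<dots> \<subseteq> closure (cbox a b)" using ab' box_subset_cbox[of a b] by (intro closure_mono) blast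
        finally have "cbox a' b' \<subseteq> \<Omega>" using ab by simp
        then have \<chi>: "box_bump a' b' n \<in> test_functions \<Omega>" for n by (rule box_bump_test_function)
        have bm: "box_bump a' b' n \<in> borel_measurable lebesgue" for n
          using test_function_calculus(2)[OF \<chi>]
          by (intro measurable_completion) (auto intro: borel_measurable_continuous_onI)
        have "(LINT x|lebesgue. box_bump a' b' n x * h x) = 0" for n
        proof -
          have "(\<lambda>x. box_bump a' b' n x * h x) = (\<lambda>x. indicator \<Omega> x *\<^sub>R (H x * box_bump a' b' n x))"
          proof
            fix x
            show "box_bump a' b' n x * h x = indicator \<Omega> x *\<^sub>R (H x * box_bump a' b' n x)"
            proof (cases "x \<in> box a' b'")
              case True
              then have "x \<in> box a b" using ab' by auto
              moreover then have "x \<in> \<Omega>" using ab box_subset_cbox[of a b] by auto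
              ultimately show ?thesis by (simp add: h_def)
            qed (simp add: box_bump_outside)
          qed
          then show ?thesis using test[OF \<chi>[of n]] \<Omega>L by (simp add: integral_restrict_space)
        qed
        moreover have "(\<lambda>n. LINT x|lebesgue. box_bump a' b' n x * h x)
            \<longlonglongrightarrow> (LINT x|lebesgue. indicator (box a' b') x * h x)"
        proof (rule integral_dominated_convergence)
          show "integrable lebesgue (\<lambda>x. norm (h x))" using h by simp
          show "AE x in lebesgue. (\<lambda>n. box_bump a' b' n x * h x) \<longlonglongrightarrow> indicator (box a' b') x * h x"
            by (intro AE_I2 tendsto_mult tendsto_const box_bump_tendsto_indicator)
          show "AE x in lebesgue. norm (box_bump a' b' n x * h x) \<le> norm (h x)" for n
          proof (rule AE_I2)
            fix x
            have "\<bar>box_bump a' b' n x\<bar> * \<bar>h x\<bar> \<le> 1 * \<bar>h x\<bar>"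
              using box_bump_bounds[of a' b' n x] by (intro mult_right_mono) auto
            then show "norm (box_bump a' b' n x * h x) \<le> norm (h x)" by (simp add: abs_mult)
          qed
        qed (intro borel_measurable_times borel_measurable_indicator bm borel_measurable_integrable[OF h]; simp)+
        ultimately have "(LINT x|lebesgue. indicator (box a' b') x * h x) = 0"
          by (simp add: LIMSEQ_const_iff)
        then show ?thesis unfolding eq .
      qed
    qed
    obtain h' where h'[measurable]: "h' \<in> borel_measurable lborel" and ae: "AE x in lborel. h x = h' x"
      using completion_ex_borel_measurable_real[OF borel_measurable_integrable[OF h]] by blast
    have ae': "AE x in lebesgue. h x = h' x" using ae by (rule AE_completion)
    have h'L[measurable]: "h' \<in> borel_measurable lebesgue" using h' by (rule measurable_completion)
    have "integrable lebesgue h'"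
      using h integrable_cong_AE[OF borel_measurable_integrable[OF h] h'L ae'] by simp
    then have ih': "integrable lborel h'" using h' by (simp add: integrable_completion)
    have boxes': "(LINT x|lborel. indicator (box c d) x * h' x) = 0" for c d
    proof -
      have bi: "indicat_real (box c d) \<in> borel_measurable lebesgue"
        by (rule borel_measurable_indicator) simp
      have "(LINT x|lborel. indicator (box c d) x * h' x) = (LINT x|lebesgue. indicator (box c d) x * h' x)"
        by (rule integral_completion[symmetric]) measurable
      also have "\<dots> = (LINT x|lebesgue. indicator (box c d) x * h x)"
        using ae'
        by (intro integral_cong_AE borel_measurable_times bi h'L borel_measurable_integrable[OF h])
           (auto elim!: eventually_mono)
      finally show ?thesis using boxes by simp
    qed
    have "integral\<^sup>L lborel h' = (LINT x|lborel. indicator (box a b) x * h' x)"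
      using ae by (intro integral_cong_AE) (auto simp: h_def indicator_def elim!: eventually_mono)
    with boxes' have "integral\<^sup>L lborel h' = 0" by simp
    from AE_zero_if_integral_boxes_zero[OF ih' this boxes'] have "AE x in lebesgue. h' x = 0"
      by (rule AE_completion)
    moreover have "AE x in lebesgue. x \<notin> cbox a b - box a b"
      by (rule AE_not_in) (use negligible_frontier_interval in \<open>simp add: negligible_iff_null_sets\<close>)
    ultimately show ?thesis using ae'
      by eventually_elim (auto simp: h_def indicator_def split: if_splits)
  qed
  obtain D where D: "countable D" "D \<subseteq> Pow \<Omega>" "\<And>X. X \<in> D \<Longrightarrow> \<exists>a b. X = cbox a b" "\<Union>D = \<Omega>"
    using open_countable_Union_open_cbox[OF \<Omega>] by metis
  have "AE x in lebesgue. \<forall>X\<in>D. x \<in> X \<longrightarrow> H x = 0"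
    unfolding AE_ball_countable[OF D(1)]
  proof
    fix X assume X: "X \<in> D"
    then obtain a b where "X = cbox a b" using D(3) by blast
    with X D(2) local[of a b] show "AE x in lebesgue. x \<in> X \<longrightarrow> H x = 0" by blast
  qed
  then have "AE x in lebesgue. x \<in> \<Omega> \<longrightarrow> H x = 0"
    by eventually_elim (use D(4) in blast)
  then show ?thesis using \<Omega>L by (simp add: AE_restrict_space_iff)
qed

lemma loc_integrable_inner:
  "loc_integrable \<Omega> F \<Longrightarrow> loc_integrable \<Omega> (\<lambda>x. F x \<bullet> v)"
  by (auto simp: loc_integrable_def)

lemma test_integrable:
  fixes F :: "'a::euclidean_space \<Rightarrow> real"
  assumes F: "loc_integrable \<Omega> F" and \<Omega>: "open \<Omega>" and \<phi>: "\<phi> \<in> test_functions \<Omega>"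
  shows "integrable (lebesgue_on \<Omega>) (\<lambda>x. F x * \<phi> x)" "integrable (lebesgue_on \<Omega>) (\<lambda>x. F x * (grad \<phi> x \<bullet> v))"
proof -
  let ?K = "closure {x. \<phi> x \<noteq> 0}"
  have K: "compact ?K" "?K \<subseteq> \<Omega>" using \<phi> by (simp_all add: test_functions_def)
  note cal = test_function_calculus[OF \<phi>]
  have c: "continuous_on UNIV (\<lambda>x. grad \<phi> x \<bullet> v)" by (intro continuous_intros cal)
  have z: "\<phi> x = 0" "grad \<phi> x \<bullet> v = 0" if "x \<notin> ?K" for x using cal(4)[OF that] by auto
  show "integrable (lebesgue_on \<Omega>) (\<lambda>x. F x * \<phi> x)"
    using loc_integrable_times_test[OF F K \<Omega> cal(2) z(1)] by (simp add: mult.commute)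
  show "integrable (lebesgue_on \<Omega>) (\<lambda>x. F x * (grad \<phi> x \<bullet> v))"
    using loc_integrable_times_test[OF F K \<Omega> c z(2)] by (simp add: mult.commute)
qed

lemma has_weak_grad_alt:
  "has_weak_grad \<Omega> u G \<longleftrightarrow> loc_integrable \<Omega> u \<and> loc_integrable \<Omega> G \<and>
     (\<forall>\<phi>\<in>test_functions \<Omega>. \<forall>i\<in>Basis.
        (LINT x|lebesgue_on \<Omega>. u x * (grad \<phi> x \<bullet> i)) = - (LINT x|lebesgue_on \<Omega>. (G x \<bullet> i) * \<phi> x))"
  by (simp add: has_weak_grad_def grad_inner_Basis)

proposition weak_grad_unique:
  fixes \<Omega> :: "'a::euclidean_space set"
  assumes \<Omega>: "open \<Omega>" and G: "has_weak_grad \<Omega> u G" and G': "has_weak_grad \<Omega> u G'"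
  shows "AE x in lebesgue_on \<Omega>. G x = G' x"
proof -
  have L: "loc_integrable \<Omega> G" "loc_integrable \<Omega> G'" using G G' by (auto simp: has_weak_grad_alt)
  have "AE x in lebesgue_on \<Omega>. G x \<bullet> i - G' x \<bullet> i = 0" if i: "i \<in> Basis" for i
  proof (rule fundamental_lemma[OF \<Omega>])
    show "loc_integrable \<Omega> (\<lambda>x. G x \<bullet> i - G' x \<bullet> i)"
      using L by (auto simp: loc_integrable_def)
    fix \<phi> assume \<phi>: "\<phi> \<in> test_functions \<Omega>"
    have "(LINT x|lebesgue_on \<Omega>. (G x \<bullet> i) * \<phi> x) = (LINT x|lebesgue_on \<Omega>. (G' x \<bullet> i) * \<phi> x)"
    proof -
      have "- (LINT x|lebesgue_on \<Omega>. (G x \<bullet> i) * \<phi> x) = - (LINT x|lebesgue_on \<Omega>. (G' x \<bullet> i) * \<phi> x)"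
        using G G' \<phi> i unfolding has_weak_grad_alt by simp
      then show ?thesis by simp
    qed
    then show "(LINT x|lebesgue_on \<Omega>. (G x \<bullet> i - G' x \<bullet> i) * \<phi> x) = 0"
      using test_integrable(1)[OF loc_integrable_inner \<Omega> \<phi>, of G i]
        test_integrable(1)[OF loc_integrable_inner \<Omega> \<phi>, of G' i] L
      by (simp add: left_diff_distrib)
  qed
  then have "AE x in lebesgue_on \<Omega>. \<forall>i\<in>Basis. G x \<bullet> i - G' x \<bullet> i = 0"
    by (simp add: AE_finite_all)
  then show ?thesis
    by eventually_elim (auto intro: euclidean_eqI)
qed


section \<open>Sobolev functions on a bounded open set\<close>

locale sobolev_domain =
  fixes \<Omega> :: "'a::euclidean_space set" and p :: real
  assumes open_dom: "open \<Omega>" and bounded_dom: "bounded \<Omega>" and p_gt_1: "1 < p"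
begin

abbreviation \<mu> :: "'a measure" where "\<mu> \<equiv> lebesgue_on \<Omega>"

lemma dom_lmeasurable: "\<Omega> \<in> lmeasurable"
  using lmeasurable_open[OF bounded_dom open_dom] .

lemma dom_sets[simp]: "\<Omega> \<in> sets lebesgue"
  using open_dom by simp

lemma p_pos: "0 < p" and p_ge_1: "1 \<le> p" using p_gt_1 by auto

lemma Lp_loc_integrable:
  fixes f :: "'a \<Rightarrow> 'b::euclidean_space"
  assumes "f \<in> Lp_on \<Omega> p"
  shows "loc_integrable \<Omega> f"
  unfolding loc_integrable_def
proof safe
  fix K assume K: "compact K" "K \<subseteq> \<Omega>"
  then have KL: "K \<in> sets lebesgue" by (simp add: compact_imp_closed)
  have "integrable (\<mu>) f"
    using Lp_on_integrable(1)[OF dom_lmeasurable p_ge_1 assms] .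
  then have "integrable lebesgue (\<lambda>x. indicator \<Omega> x *\<^sub>R f x)"
    by (simp add: integrable_restrict_space)
  then have "integrable lebesgue (\<lambda>x. indicator K x *\<^sub>R (indicator \<Omega> x *\<^sub>R f x))"
    by (rule integrable_mult_indicator[OF KL])
  also have "(\<lambda>x. indicator K x *\<^sub>R (indicator \<Omega> x *\<^sub>R f x)) = (\<lambda>x. indicator K x *\<^sub>R f x)"
    using K(2) by (auto simp: fun_eq_iff indicator_def)
  finally show "integrable (lebesgue_on K) f"
    using KL by (simp add: integrable_restrict_space)
qed

lemma continuous_in_Lp:
  fixes f :: "'a \<Rightarrow> 'b::euclidean_space"
  assumes "continuous_on UNIV f"
  shows "f \<in> Lp_on \<Omega> p"
proof -
  have c: "compact (closure \<Omega>)" using bounded_dom by (simp add: compact_closure)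
  have "compact (f ` closure \<Omega>)"
    by (rule compact_continuous_image[OF continuous_on_subset[OF assms] c]) simp
  then obtain b where "\<forall>y\<in>f ` closure \<Omega>. norm y \<le> b" using compact_imp_bounded bounded_iff by metis
  then have b: "norm (f x) \<le> b" if "x \<in> \<Omega>" for x using that closure_subset[of \<Omega>] by auto
  have "f \<in> borel_measurable lebesgue"
    using assms by (intro measurable_completion) (auto intro: borel_measurable_continuous_onI)
  then have m: "f \<in> borel_measurable (\<mu>)" by (rule measurable_restrict_space1)
  have "emeasure (\<mu>) (space (\<mu>)) \<noteq> \<infinity>"
    using dom_lmeasurable by (simp add: emeasure_restrict_space fmeasurable_def less_top)
  then interpret finite_measure "\<mu>" by standard
  show ?thesis
    by (rule Lp_on_bound[OF m, of "\<lambda>_. b powr p"])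
       (use b p_pos in \<open>auto intro!: AE_I2 powr_mono2\<close>)
qed

text \<open>The gradient is an explicit second component, which frees the arguments below from the choice
  made by \<^const>\<open>weak_grad\<close>; lemmas \<open>sob_weak_grad\<close> and \<open>sob_unique\<close> translate between both.\<close>

definition sob :: "('a \<Rightarrow> real) \<Rightarrow> ('a \<Rightarrow> 'a) \<Rightarrow> bool" where
  "sob u G \<longleftrightarrow> u \<in> Lp_on \<Omega> p \<and> G \<in> Lp_on \<Omega> p \<and> has_weak_grad \<Omega> u G"

lemma sobD:
  assumes "sob u G"
  shows "u \<in> Lp_on \<Omega> p" "G \<in> Lp_on \<Omega> p" "has_weak_grad \<Omega> u G"
  using assms by (auto simp: sob_def)

lemma sob_iff:
  "sob u G \<longleftrightarrow> u \<in> Lp_on \<Omega> p \<and> G \<in> Lp_on \<Omega> p \<and>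
     (\<forall>\<phi>\<in>test_functions \<Omega>. \<forall>i\<in>Basis.
        (LINT x|\<mu>. u x * (grad \<phi> x \<bullet> i)) = - (LINT x|\<mu>. (G x \<bullet> i) * \<phi> x))"
  using Lp_loc_integrable[of u] Lp_loc_integrable[of G] by (auto simp: sob_def has_weak_grad_alt)

lemma sob_unique:
  assumes "sob u G" "sob u H"
  shows "AE x in \<mu>. G x = H x"
  using assms by (intro weak_grad_unique[OF open_dom]) (auto simp: sob_def)

lemma sob_weak_grad: "sob u G \<Longrightarrow> sob u (weak_grad \<Omega> u)"
proof -
  assume u: "sob u G"
  then have w: "has_weak_grad \<Omega> u (weak_grad \<Omega> u)"
    unfolding weak_grad_def by (intro someI[of "has_weak_grad \<Omega> u" G]) (rule sobD)
  have "AE x in \<mu>. G x = weak_grad \<Omega> u x"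
    using weak_grad_unique[OF open_dom sobD(3)[OF u] w] .
  then have "weak_grad \<Omega> u \<in> Lp_on \<Omega> p"
    by (rule Lp_on_AE[OF dom_sets sobD(2)[OF u]])
  with w u show ?thesis by (simp add: sob_def)
qed

lemma W1p_iff: "u \<in> W1p \<Omega> p \<longleftrightarrow> sob u (weak_grad \<Omega> u)"
  using sob_weak_grad by (auto simp: W1p_def sob_def)

lemma sob_W1p: "sob u G \<Longrightarrow> u \<in> W1p \<Omega> p"
  using sob_weak_grad W1p_iff by blast

lemma weak_grad_AE: "sob u G \<Longrightarrow> AE x in \<mu>. weak_grad \<Omega> u x = G x"
  using sob_unique sob_weak_grad by blast

lemma sob_add:
  assumes u: "sob u G" and v: "sob v H"
  shows "sob (\<lambda>x. u x + c * v x) (\<lambda>x. G x + c *\<^sub>R H x)"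
  unfolding sob_iff
proof (intro conjI ballI)
  show "(\<lambda>x. u x + c * v x) \<in> Lp_on \<Omega> p"
    using Lp_on_add[OF p_pos sobD(1)[OF u] Lp_on_scaleR[OF sobD(1)[OF v], of c]] by simp
  show "(\<lambda>x. G x + c *\<^sub>R H x) \<in> Lp_on \<Omega> p"
    by (intro Lp_on_add[OF p_pos sobD(2)[OF u]] Lp_on_scaleR sobD(2)[OF v])
  fix \<phi> and i :: 'a assume \<phi>: "\<phi> \<in> test_functions \<Omega>" and i: "i \<in> Basis"
  note I = test_integrable(2)[OF Lp_loc_integrable[OF sobD(1)] open_dom \<phi>]
    and J = test_integrable(1)[OF loc_integrable_inner[OF Lp_loc_integrable[OF sobD(2)]] open_dom \<phi>]
  have "(LINT x|\<mu>. (u x + c * v x) * (grad \<phi> x \<bullet> i))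
      = (LINT x|\<mu>. u x * (grad \<phi> x \<bullet> i)) + c * (LINT x|\<mu>. v x * (grad \<phi> x \<bullet> i))"
    using I[OF u] I[OF v] by (simp add: distrib_right mult.assoc)
  also have "\<dots> = - ((LINT x|\<mu>. (G x \<bullet> i) * \<phi> x) + c * (LINT x|\<mu>. (H x \<bullet> i) * \<phi> x))"
    using u v \<phi> i by (simp add: sob_iff)
  also have "\<dots> = - (LINT x|\<mu>. ((G x + c *\<^sub>R H x) \<bullet> i) * \<phi> x)"
    using J[OF u, of i] J[OF v, of i] by (simp add: inner_add_left distrib_right mult.assoc)
  finally show "(LINT x|\<mu>. (u x + c * v x) * (grad \<phi> x \<bullet> i))
      = - (LINT x|\<mu>. ((G x + c *\<^sub>R H x) \<bullet> i) * \<phi> x)" .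
qed

lemma sob_diff: "sob u G \<Longrightarrow> sob v H \<Longrightarrow> sob (\<lambda>x. u x - v x) (\<lambda>x. G x - H x)"
  using sob_add[of u G v H "-1"] by simp

lemma sob_classical:
  assumes u: "\<And>x. (u has_derivative (\<lambda>h. G x \<bullet> h)) (at x)" and G: "continuous_on UNIV G"
  shows "sob u G"
proof -
  have "continuous_on UNIV u"
    using has_derivative_continuous[OF u] by (intro continuous_at_imp_continuous_on) simp
  with G show ?thesis
    by (simp add: sob_iff continuous_in_Lp integration_by_parts[OF open_dom _ u G])
qed

lemma sob_test: "\<phi> \<in> test_functions \<Omega> \<Longrightarrow> sob \<phi> (grad \<phi>)"
  by (intro sob_classical test_function_calculus(1,3))

lemma sob_zero: "sob (\<lambda>x. 0) (\<lambda>x. 0)"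
  by (rule sob_classical) auto

lemma bounded_test:
  assumes "\<phi> \<in> test_functions \<Omega>"
  obtains M where "\<And>x. norm (\<phi> x) \<le> M" "\<And>x. norm (grad \<phi> x) \<le> M"
proof -
  let ?K = "closure {x. \<phi> x \<noteq> 0}"
  have K: "compact ?K" using assms by (simp add: test_functions_def)
  note cal = test_function_calculus[OF assms]
  have "compact (\<phi> ` ?K)" "compact (grad \<phi> ` ?K)"
    by (rule compact_continuous_image[OF continuous_on_subset[OF cal(2)] K], simp)
       (rule compact_continuous_image[OF continuous_on_subset[OF cal(3)] K], simp)
  then obtain b c where bc: "\<forall>y\<in>\<phi> ` ?K. norm y \<le> b" "\<forall>y\<in>grad \<phi> ` ?K. norm y \<le> c"
    using compact_imp_bounded bounded_iff by metis
  have "norm (\<phi> x) \<le> max 0 (max b c)" "norm (grad \<phi> x) \<le> max 0 (max b c)" for x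
    using bc cal(4)[of x] by (cases "x \<in> ?K"; force simp: le_max_iff_disj)+
  then show ?thesis using that by blast
qed

proposition sob_limit:
  assumes uG: "\<And>k. sob (u k) (G k)" and v: "v \<in> Lp_on \<Omega> p" and H: "H \<in> Lp_on \<Omega> p"
    and lim_u: "(\<lambda>k. Lpow \<Omega> p (\<lambda>x. u k x - v x)) \<longlonglongrightarrow> 0"
    and lim_G: "(\<lambda>k. Lpow \<Omega> p (\<lambda>x. G k x - H x)) \<longlonglongrightarrow> 0"
  shows "sob v H"
  unfolding sob_iff
proof (intro conjI ballI v H)
  fix \<phi> and i :: 'a assume \<phi>: "\<phi> \<in> test_functions \<Omega>" and i: "i \<in> Basis"
  obtain M where M: "\<And>x. norm (\<phi> x) \<le> M" "\<And>x. norm (grad \<phi> x) \<le> M"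
    using bounded_test[OF \<phi>] by blast
  have meas: "f \<in> borel_measurable (\<mu>)" if "continuous_on UNIV f" for f :: "'a \<Rightarrow> 'c::euclidean_space"
    using Lp_onD(1)[OF continuous_in_Lp[OF that]] .
  note cal = test_function_calculus[OF \<phi>]
  have c: "continuous_on UNIV (\<lambda>x. grad \<phi> x \<bullet> i)" "continuous_on UNIV (\<lambda>x. \<phi> x *\<^sub>R i)"
    by (intro continuous_intros cal)+
  have b: "norm (grad \<phi> x \<bullet> i) \<le> M" "norm (\<phi> x *\<^sub>R i) \<le> M" for x
    using M[of x] i Basis_le_norm[OF i, of "grad \<phi> x"] by auto
  note I = test_integrable(2)[OF Lp_loc_integrable open_dom \<phi>]
    and J = test_integrable(1)[OF loc_integrable_inner[OF Lp_loc_integrable] open_dom \<phi>]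
  have "(\<lambda>k. LINT x|\<mu>. (grad \<phi> x \<bullet> i) \<bullet> (u k x - v x)) \<longlonglongrightarrow> 0"
    by (rule Lpow_tendsto_bounded_pairing[OF dom_lmeasurable p_ge_1 _ lim_u meas[OF c(1)] b(1)])
       (intro Lp_on_diff p_pos v sobD(1)[OF uG])
  moreover have "(LINT x|\<mu>. (grad \<phi> x \<bullet> i) \<bullet> (u k x - v x))
      = (LINT x|\<mu>. u k x * (grad \<phi> x \<bullet> i)) - (LINT x|\<mu>. v x * (grad \<phi> x \<bullet> i))" for k
    using I[OF sobD(1)[OF uG], of k i] I[OF v, of i]
    by (simp add: right_diff_distrib mult.commute)
  ultimately have 1: "(\<lambda>k. LINT x|\<mu>. u k x * (grad \<phi> x \<bullet> i))
      \<longlonglongrightarrow> (LINT x|\<mu>. v x * (grad \<phi> x \<bullet> i))"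
    by (simp add: LIM_zero_iff)
  have "(\<lambda>k. LINT x|\<mu>. (\<phi> x *\<^sub>R i) \<bullet> (G k x - H x)) \<longlonglongrightarrow> 0"
    by (rule Lpow_tendsto_bounded_pairing[OF dom_lmeasurable p_ge_1 _ lim_G meas[OF c(2)] b(2)])
       (intro Lp_on_diff p_pos H sobD(2)[OF uG])
  moreover have "(LINT x|\<mu>. (\<phi> x *\<^sub>R i) \<bullet> (G k x - H x))
      = (LINT x|\<mu>. (G k x \<bullet> i) * \<phi> x) - (LINT x|\<mu>. (H x \<bullet> i) * \<phi> x)" for k
    using J[OF sobD(2)[OF uG], of k i] J[OF H, of i]
    by (simp add: inner_diff_right right_diff_distrib mult.commute inner_commute)
  ultimately have "(\<lambda>k. LINT x|\<mu>. (G k x \<bullet> i) * \<phi> x)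
      \<longlonglongrightarrow> (LINT x|\<mu>. (H x \<bullet> i) * \<phi> x)"
    by (simp add: LIM_zero_iff)
  then have "(\<lambda>k. - (LINT x|\<mu>. (G k x \<bullet> i) * \<phi> x))
      \<longlonglongrightarrow> - (LINT x|\<mu>. (H x \<bullet> i) * \<phi> x)" by (rule tendsto_minus)
  moreover have "(LINT x|\<mu>. u k x * (grad \<phi> x \<bullet> i)) = - (LINT x|\<mu>. (G k x \<bullet> i) * \<phi> x)" for k
    using uG[of k] \<phi> i by (simp add: sob_iff)
  ultimately show "(LINT x|\<mu>. v x * (grad \<phi> x \<bullet> i)) = - (LINT x|\<mu>. (H x \<bullet> i) * \<phi> x)"
    using 1 by (simp add: LIMSEQ_unique)
qed

section \<open>Vanishing boundary values\<close>

text \<open>\<open>W1p_0 \<Omega> p\<close> in terms of approximating sequences of test functions, again with explicit gradient;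
  see \<open>W1p_0_imp_sob0\<close> and \<open>sob0_imp_W1p_0\<close>.\<close>

definition sob0 :: "('a \<Rightarrow> real) \<Rightarrow> ('a \<Rightarrow> 'a) \<Rightarrow> bool" where
  "sob0 w H \<longleftrightarrow> sob w H \<and> (\<exists>\<phi>. (\<forall>k::nat. \<phi> k \<in> test_functions \<Omega>) \<and>
     (\<lambda>k. Lpow \<Omega> p (\<lambda>x. w x - \<phi> k x)) \<longlonglongrightarrow> 0 \<and> (\<lambda>k. Lpow \<Omega> p (\<lambda>x. H x - grad (\<phi> k) x)) \<longlonglongrightarrow> 0)"

lemma sob0_sob: "sob0 w H \<Longrightarrow> sob w H"
  by (simp add: sob0_def)

lemma sob0I:
  assumes w: "sob w H"
    and "\<And>e. 0 < e \<Longrightarrow> \<exists>\<phi>\<in>test_functions \<Omega>. Lpow \<Omega> p (\<lambda>x. w x - \<phi> x) < e \<and> Lpow \<Omega> p (\<lambda>x. H x - grad \<phi> x) < e"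
  shows "sob0 w H"
proof -
  have "\<forall>k::nat. \<exists>\<phi>\<in>test_functions \<Omega>. Lpow \<Omega> p (\<lambda>x. w x - \<phi> x) < inverse (real (Suc k))
      \<and> Lpow \<Omega> p (\<lambda>x. H x - grad \<phi> x) < inverse (real (Suc k))"
    using assms(2) by simp
  then obtain \<phi> where \<phi>: "\<And>k. \<phi> k \<in> test_functions \<Omega>"
      "\<And>k. Lpow \<Omega> p (\<lambda>x. w x - \<phi> k x) < inverse (real (Suc k))"
      "\<And>k. Lpow \<Omega> p (\<lambda>x. H x - grad (\<phi> k) x) < inverse (real (Suc k))"
    by metis
  have "(\<lambda>k. Lpow \<Omega> p (\<lambda>x. w x - \<phi> k x)) \<longlonglongrightarrow> 0" "(\<lambda>k. Lpow \<Omega> p (\<lambda>x. H x - grad (\<phi> k) x)) \<longlonglongrightarrow> 0"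
    by (rule tendsto_sandwich[OF _ _ tendsto_const LIMSEQ_inverse_real_of_nat];
        use \<phi>(2,3) in \<open>simp add: Lpow_nonneg less_imp_le\<close>)+
  with w \<phi>(1) show ?thesis unfolding sob0_def by blast
qed

lemma W1p_norm_eq:
  assumes "sob v G"
  shows "W1p_norm \<Omega> p v = (Lpow \<Omega> p v + Lpow \<Omega> p G) powr (1 / p)"
proof -
  have "Lpow \<Omega> p (weak_grad \<Omega> v) = Lpow \<Omega> p G"
    using weak_grad_AE[OF assms] sobD(2)[OF assms] sobD(2)[OF sob_weak_grad[OF assms]]
    by (intro Lpow_cong_AE) (auto dest: Lp_onD)
  then show ?thesis by (simp add: W1p_norm_def Lpow_def)
qed

lemma powr_inverse_less_iff:
  "0 \<le> t \<Longrightarrow> 0 < e \<Longrightarrow> t powr (1 / p) < e \<longleftrightarrow> t < e powr p"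
  using p_pos powr_less_mono2[of p "t powr (1/p)" e] powr_less_mono2[of "1/p" t "e powr p"]
  by (auto simp: powr_powr)

lemma W1p_0_imp_sob0:
  assumes "w \<in> W1p_0 \<Omega> p" "sob w H"
  shows "sob0 w H"
proof (rule sob0I[OF assms(2)])
  fix e :: real assume e: "0 < e"
  then obtain \<phi> where \<phi>: "\<phi> \<in> test_functions \<Omega>" "W1p_norm \<Omega> p (\<lambda>x. w x - \<phi> x) < e powr (1 / p)"
    using assms(1) unfolding W1p_0_def mem_Collect_eq by (metis powr_gt_zero less_irrefl)
  have "Lpow \<Omega> p (\<lambda>x. w x - \<phi> x) + Lpow \<Omega> p (\<lambda>x. H x - grad \<phi> x) < (e powr (1 / p)) powr p"
    using \<phi>(2) e unfolding W1p_norm_eq[OF sob_diff[OF assms(2) sob_test[OF \<phi>(1)]]]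
    by (subst (asm) powr_inverse_less_iff) (auto simp: Lpow_nonneg)
  also have "(e powr (1 / p)) powr p = e" using e p_pos by (simp add: powr_powr)
  finally show "\<exists>\<phi>\<in>test_functions \<Omega>. Lpow \<Omega> p (\<lambda>x. w x - \<phi> x) < e \<and> Lpow \<Omega> p (\<lambda>x. H x - grad \<phi> x) < e"
    using \<phi>(1) Lpow_nonneg[of \<Omega> p "\<lambda>x. w x - \<phi> x"] Lpow_nonneg[of \<Omega> p "\<lambda>x. H x - grad \<phi> x"]
    by (intro bexI[of _ \<phi>]) auto
qed

lemma sob0_imp_W1p_0:
  assumes "sob0 w H"
  shows "w \<in> W1p_0 \<Omega> p"
proof -
  obtain \<phi> where \<phi>: "\<And>k. \<phi> k \<in> test_functions \<Omega>"
    and lim: "(\<lambda>k. Lpow \<Omega> p (\<lambda>x. w x - \<phi> k x)) \<longlonglongrightarrow> 0"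
      "(\<lambda>k. Lpow \<Omega> p (\<lambda>x. H x - grad (\<phi> k) x)) \<longlonglongrightarrow> 0" and w: "sob w H"
    using assms by (auto simp: sob0_def)
  have "\<exists>\<psi>\<in>test_functions \<Omega>. W1p_norm \<Omega> p (\<lambda>x. w x - \<psi> x) < e" if e: "0 < e" for e
  proof -
    have "(\<lambda>k. Lpow \<Omega> p (\<lambda>x. w x - \<phi> k x) + Lpow \<Omega> p (\<lambda>x. H x - grad (\<phi> k) x)) \<longlonglongrightarrow> 0 + 0"
      by (intro tendsto_add lim)
    then have "\<forall>\<^sub>F k in sequentially. Lpow \<Omega> p (\<lambda>x. w x - \<phi> k x) + Lpow \<Omega> p (\<lambda>x. H x - grad (\<phi> k) x) < e powr p"
      using e by (intro order_tendstoD(2)) auto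
    then obtain k where k: "Lpow \<Omega> p (\<lambda>x. w x - \<phi> k x) + Lpow \<Omega> p (\<lambda>x. H x - grad (\<phi> k) x) < e powr p"
      using eventually_happens'[OF sequentially_bot] by blast
    have "W1p_norm \<Omega> p (\<lambda>x. w x - \<phi> k x) < e"
      using k e unfolding W1p_norm_eq[OF sob_diff[OF w sob_test[OF \<phi>]]]
      by (subst powr_inverse_less_iff) (auto simp: Lpow_nonneg)
    with \<phi> show ?thesis by blast
  qed
  with sob_W1p[OF w] show ?thesis by (simp add: W1p_0_def)
qed

lemma Lpow_limit_add:
  fixes f g :: "nat \<Rightarrow> 'a \<Rightarrow> 'b::euclidean_space"
  assumes "\<And>k. f k \<in> Lp_on \<Omega> p" "\<And>k. g k \<in> Lp_on \<Omega> p"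
    and "(\<lambda>k. Lpow \<Omega> p (f k)) \<longlonglongrightarrow> 0" "(\<lambda>k. Lpow \<Omega> p (g k)) \<longlonglongrightarrow> 0"
  shows "(\<lambda>k. Lpow \<Omega> p (\<lambda>x. f k x + g k x)) \<longlonglongrightarrow> 0"
proof (rule tendsto_sandwich[OF _ _ tendsto_const])
  show "\<forall>\<^sub>F k in sequentially. Lpow \<Omega> p (\<lambda>x. f k x + g k x) \<le> 2 powr p * (Lpow \<Omega> p (f k) + Lpow \<Omega> p (g k))"
    using Lpow_add_le[OF p_pos assms(1,2)] by simp
  show "(\<lambda>k. 2 powr p * (Lpow \<Omega> p (f k) + Lpow \<Omega> p (g k))) \<longlonglongrightarrow> 0"
    using tendsto_mult[OF tendsto_const tendsto_add[OF assms(3,4)], of "2 powr p"] by simp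
qed (simp add: Lpow_nonneg)

lemma Lpow_scaleR: "Lpow \<Omega> p (\<lambda>x. c *\<^sub>R f x) = \<bar>c\<bar> powr p * Lpow \<Omega> p f"
  by (simp add: Lpow_def powr_mult)

lemma sob0_add:
  assumes w: "sob0 w H" and v: "sob0 v J"
  shows "sob0 (\<lambda>x. w x + c * v x) (\<lambda>x. H x + c *\<^sub>R J x)"
proof -
  obtain \<phi> where \<phi>: "\<And>k. \<phi> k \<in> test_functions \<Omega>"
    and lim1: "(\<lambda>k. Lpow \<Omega> p (\<lambda>x. w x - \<phi> k x)) \<longlonglongrightarrow> 0"
      "(\<lambda>k. Lpow \<Omega> p (\<lambda>x. H x - grad (\<phi> k) x)) \<longlonglongrightarrow> 0"
    using w by (auto simp: sob0_def)
  obtain \<psi> where \<psi>: "\<And>k. \<psi> k \<in> test_functions \<Omega>"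
    and lim2: "(\<lambda>k. Lpow \<Omega> p (\<lambda>x. v x - \<psi> k x)) \<longlonglongrightarrow> 0"
      "(\<lambda>k. Lpow \<Omega> p (\<lambda>x. J x - grad (\<psi> k) x)) \<longlonglongrightarrow> 0"
    using v by (auto simp: sob0_def)
  define \<theta> where "\<theta> k x = \<phi> k x + c * \<psi> k x" for k x
  have \<theta>: "\<theta> k \<in> test_functions \<Omega>" for k
    unfolding \<theta>_def by (intro test_functions_combine[OF \<phi> test_functions_combine(2)[OF \<psi> \<psi>]])
  have g: "grad (\<theta> k) x = grad (\<phi> k) x + c *\<^sub>R grad (\<psi> k) x" for k x
  proof -
    have "(\<theta> k has_derivative (\<lambda>h. grad (\<phi> k) x \<bullet> h + c * (grad (\<psi> k) x \<bullet> h))) (at x)"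
      unfolding \<theta>_def
      by (intro has_derivative_add has_derivative_mult_right test_function_calculus(1)[OF \<phi>] test_function_calculus(1)[OF \<psi>])
    from has_derivative_unique[OF this test_function_calculus(1)[OF \<theta>]]
    have "(grad (\<phi> k) x + c *\<^sub>R grad (\<psi> k) x) \<bullet> h = grad (\<theta> k) x \<bullet> h" for h
      by (simp add: inner_add_left fun_eq_iff)
    then show ?thesis by (metis vector_eq_ldot inner_commute)
  qed
  note ws = sob0_sob[OF w] and vs = sob0_sob[OF v] and \<phi>s = sob_test[OF \<phi>] and \<psi>s = sob_test[OF \<psi>]
  note mem = sobD(1)[OF sob_diff[OF ws \<phi>s]] sobD(2)[OF sob_diff[OF ws \<phi>s]]
    sobD(1)[OF sob_diff[OF vs \<psi>s]] sobD(2)[OF sob_diff[OF vs \<psi>s]]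
  have sc: "(\<lambda>k. Lpow \<Omega> p (\<lambda>x. c *\<^sub>R (v x - \<psi> k x))) \<longlonglongrightarrow> 0"
    "(\<lambda>k. Lpow \<Omega> p (\<lambda>x. c *\<^sub>R (J x - grad (\<psi> k) x))) \<longlonglongrightarrow> 0"
    unfolding Lpow_scaleR
    using tendsto_mult[OF tendsto_const lim2(1), of "\<bar>c\<bar> powr p"] tendsto_mult[OF tendsto_const lim2(2), of "\<bar>c\<bar> powr p"]
    by simp_all
  have "(\<lambda>k. Lpow \<Omega> p (\<lambda>x. (w x + c * v x) - \<theta> k x)) \<longlonglongrightarrow> 0"
    using Lpow_limit_add[OF mem(1) Lp_on_scaleR[OF mem(3)] lim1(1) sc(1)]
    by (simp add: \<theta>_def algebra_simps)
  moreover have "(\<lambda>k. Lpow \<Omega> p (\<lambda>x. (H x + c *\<^sub>R J x) - grad (\<theta> k) x)) \<longlonglongrightarrow> 0"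
    using Lpow_limit_add[OF mem(2) Lp_on_scaleR[OF mem(4)] lim1(2) sc(2)]
    by (simp add: g algebra_simps)
  ultimately show ?thesis
    unfolding sob0_def using sob_add[OF ws vs] \<theta> by blast
qed

lemma sob0_test: "\<phi> \<in> test_functions \<Omega> \<Longrightarrow> sob0 \<phi> (grad \<phi>)"
  unfolding sob0_def using p_pos by (intro conjI sob_test exI[of _ "\<lambda>_. \<phi>"]) (auto simp: Lpow_def)

lemma sob0_zero: "sob0 (\<lambda>x. 0) (\<lambda>x. 0)"
  by (rule W1p_0_imp_sob0[OF sob0_imp_W1p_0[OF sob0_test[OF zero_test_function]] sob_zero])

lemma sob0_closed:
  assumes w: "\<And>k. sob0 (w k) (H k)" and v: "v \<in> Lp_on \<Omega> p" and J: "J \<in> Lp_on \<Omega> p"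
    and lim_w: "(\<lambda>k. Lpow \<Omega> p (\<lambda>x. w k x - v x)) \<longlonglongrightarrow> 0"
    and lim_H: "(\<lambda>k. Lpow \<Omega> p (\<lambda>x. H k x - J x)) \<longlonglongrightarrow> 0"
  shows "sob0 v J"
proof (rule sob0I)
  note ws = sob0_sob[OF w]
  show vJ: "sob v J" by (rule sob_limit[OF ws v J lim_w lim_H])
  fix e :: real assume e: "0 < e"
  define d where "d = e / (2 powr p * 2)"
  have d: "0 < d" "2 powr p * (d + d) = e" using e by (auto simp: d_def)
  have "\<forall>\<^sub>F k in sequentially. Lpow \<Omega> p (\<lambda>x. w k x - v x) < d \<and> Lpow \<Omega> p (\<lambda>x. H k x - J x) < d"
    using order_tendstoD(2)[OF lim_w d(1)] order_tendstoD(2)[OF lim_H d(1)] by eventually_elim simp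
  then obtain k where k: "Lpow \<Omega> p (\<lambda>x. w k x - v x) < d" "Lpow \<Omega> p (\<lambda>x. H k x - J x) < d"
    using eventually_happens'[OF sequentially_bot] by blast
  obtain \<phi> where \<phi>: "\<And>j. \<phi> j \<in> test_functions \<Omega>"
    and lim: "(\<lambda>j. Lpow \<Omega> p (\<lambda>x. w k x - \<phi> j x)) \<longlonglongrightarrow> 0"
      "(\<lambda>j. Lpow \<Omega> p (\<lambda>x. H k x - grad (\<phi> j) x)) \<longlonglongrightarrow> 0"
    using w[of k] by (auto simp: sob0_def)
  have "\<forall>\<^sub>F j in sequentially. Lpow \<Omega> p (\<lambda>x. w k x - \<phi> j x) < d \<and> Lpow \<Omega> p (\<lambda>x. H k x - grad (\<phi> j) x) < d"
    using order_tendstoD(2)[OF lim(1) d(1)] order_tendstoD(2)[OF lim(2) d(1)] by eventually_elim simp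
  then obtain j where j: "Lpow \<Omega> p (\<lambda>x. w k x - \<phi> j x) < d" "Lpow \<Omega> p (\<lambda>x. H k x - grad (\<phi> j) x) < d"
    using eventually_happens'[OF sequentially_bot] by blast
  note s1 = sob_diff[OF vJ ws[of k]] and s2 = sob_diff[OF ws[of k] sob_test[OF \<phi>[of j]]]
  have "Lpow \<Omega> p (\<lambda>x. (v x - w k x) + (w k x - \<phi> j x)) \<le> 2 powr p * (Lpow \<Omega> p (\<lambda>x. v x - w k x) + Lpow \<Omega> p (\<lambda>x. w k x - \<phi> j x))"
    by (rule Lpow_add_le[OF p_pos sobD(1)[OF s1] sobD(1)[OF s2]])
  also have "\<dots> < 2 powr p * (d + d)"
    using k j by (intro mult_strict_left_mono add_strict_mono) (simp_all add: Lpow_minus_commute)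
  finally have a: "Lpow \<Omega> p (\<lambda>x. v x - \<phi> j x) < e" using d by simp
  have "Lpow \<Omega> p (\<lambda>x. (J x - H k x) + (H k x - grad (\<phi> j) x))
     \<le> 2 powr p * (Lpow \<Omega> p (\<lambda>x. J x - H k x) + Lpow \<Omega> p (\<lambda>x. H k x - grad (\<phi> j) x))"
    by (rule Lpow_add_le[OF p_pos sobD(2)[OF s1] sobD(2)[OF s2]])
  also have "\<dots> < 2 powr p * (d + d)"
    using k j by (intro mult_strict_left_mono add_strict_mono) (simp_all add: Lpow_minus_commute)
  finally have "Lpow \<Omega> p (\<lambda>x. J x - grad (\<phi> j) x) < e" using d by simp
  with a \<phi> show "\<exists>\<phi>\<in>test_functions \<Omega>. Lpow \<Omega> p (\<lambda>x. v x - \<phi> x) < e \<and> Lpow \<Omega> p (\<lambda>x. J x - grad \<phi> x) < e"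
    by blast
qed

end


section \<open>Poincare's inequality\<close>

text \<open>Young's inequality with a small parameter: either \<open>b \<le> e * a\<close> or \<open>a \<le> b / e\<close>.\<close>

lemma powr_mult_le_eps:
  fixes a b e p :: real
  assumes "1 < p" "0 < e" "0 \<le> a" "0 \<le> b"
  shows "a powr (p - 1) * b \<le> e * a powr p + (1 / e) powr (p - 1) * b powr p"
proof (cases "b \<le> e * a")
  case True
  have "a powr (p - 1) * a powr 1 = a powr p" by (simp only: powr_add[symmetric]) simp
  then have eq: "a powr (p - 1) * (e * a) = e * a powr p" using assms by simp
  have "a powr (p - 1) * b \<le> a powr (p - 1) * (e * a)" using True by (rule mult_left_mono) simp
  also have "\<dots> = e * a powr p" by (rule eq)
  finally show ?thesis by (simp add: add_increasing2)
next
  case False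
  have "b powr (p - 1) * b powr 1 = b powr p" by (simp only: powr_add[symmetric]) simp
  then have bp: "b powr (p - 1) * b = b powr p" using assms by simp
  have "a \<le> (1 / e) * b" using False assms by (simp add: field_simps)
  then have "a powr (p - 1) \<le> ((1 / e) * b) powr (p - 1)" using assms by (intro powr_mono2) auto
  also have "\<dots> = (1 / e) powr (p - 1) * b powr (p - 1)" using assms by (simp only: powr_mult)
  finally have "a powr (p - 1) * b \<le> (1 / e) powr (p - 1) * b powr (p - 1) * b"
    using assms by (intro mult_right_mono) auto
  then have "a powr (p - 1) * b \<le> (1 / e) powr (p - 1) * b powr p" by (simp only: mult.assoc bp)
  then show ?thesis using assms by (simp add: add_increasing)
qed

lemma DERIV_abs_powr:
  fixes t p :: real
  assumes "1 < p"
  shows "((\<lambda>t. \<bar>t\<bar> powr p) has_real_derivative p * flux p t) (at t)"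
proof -
  consider "0 < t" | "t < 0" | "t = 0" by linarith
  then show ?thesis
  proof cases
    case 1
    have "t powr (p - 2) * t powr 1 = t powr (p - 1)" by (simp only: powr_add[symmetric]) simp
    then have "((\<lambda>t. t powr p) has_real_derivative p * flux p t) (at t)"
      using has_real_derivative_powr[of t p] 1 by (simp add: flux_def)
    then show ?thesis
      by (rule has_field_derivative_transform_within_open[of _ _ _ "{0<..}"]) (use 1 in auto)
  next
    case 2
    have "(-t) powr (p - 2) * (-t) powr 1 = (-t) powr (p - 1)" by (simp only: powr_add[symmetric]) simp
    then have "(-t) powr (p - 1) * (- 1) = flux p t" using 2 by (simp add: flux_def)
    then have e: "p * (-t) powr (p - 1) * (- 1) = p * flux p t" by (simp only: mult.assoc)
    have "((\<lambda>t. (-t) powr p) has_real_derivative p * (-t) powr (p - 1) * (- 1)) (at t)"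
      by (rule DERIV_chain2[OF has_real_derivative_powr]) (use 2 in \<open>auto intro!: derivative_eq_intros\<close>)
    then have "((\<lambda>t. (-t) powr p) has_real_derivative p * flux p t) (at t)" unfolding e .
    then show ?thesis
      by (rule has_field_derivative_transform_within_open[of _ _ _ "{..<0}"]) (use 2 in auto)
  next
    case 3
    have "((\<lambda>h::real. norm h powr (p - 1)) \<longlongrightarrow> norm (0::real) powr (p - 1)) (at 0)"
      using assms by (intro tendsto_powr' tendsto_intros) auto
    then have l: "((\<lambda>h::real. \<bar>h\<bar> powr (p - 1)) \<longlongrightarrow> 0) (at 0)" using assms by simp
    have n: "norm (\<bar>h\<bar> powr p / h) = \<bar>h\<bar> powr (p - 1)" for h :: real
    proof (cases "h = 0")
      case False
      have "\<bar>h\<bar> powr (p - 1) * \<bar>h\<bar> powr 1 = \<bar>h\<bar> powr p" by (simp only: powr_add[symmetric]) simp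
      then show ?thesis using False by (simp add: field_simps)
    qed simp
    have "((\<lambda>h::real. \<bar>h\<bar> powr p / h) \<longlongrightarrow> 0) (at 0)"
      by (rule tendsto_norm_zero_cancel) (unfold n, rule l)
    then show ?thesis using 3 assms by (simp add: has_field_derivative_iff flux_def)
  qed
qed

context sobolev_domain
begin

text \<open>Integrating the derivative of \<open>(x \<bullet> i) * \<bar>\<phi> x\<bar> powr p\<close> in the coordinate direction \<open>i\<close> expresses
  the integral of \<open>\<bar>\<phi> x\<bar> powr p\<close> through a term containing \<open>grad \<phi>\<close>. Since \<open>x \<bullet> i\<close> is bounded on
  \<open>\<Omega>\<close>, Young's inequality with the parameter \<open>e\<close> absorbs half of the left-hand side.\<close>

proposition Poincare_test:
  obtains C where "0 \<le> C" "\<And>\<phi>. \<phi> \<in> test_functions \<Omega> \<Longrightarrow> Lpow \<Omega> p \<phi> \<le> C * Lpow \<Omega> p (grad \<phi>)"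
proof -
  obtain R where R: "0 < R" "\<And>x. x \<in> \<Omega> \<Longrightarrow> norm x \<le> R" using bounded_dom bounded_pos by blast
  obtain i :: 'a where i: "i \<in> Basis" using nonempty_Basis by blast
  \<comment> \<open>This value of \<open>e\<close> makes the absorbed term exactly half of the left-hand side.\<close>
  define e where "e = 1 / (2 * (R * p))"
  have e: "0 < e" "R * p * e = 1 / 2" using R p_pos by (auto simp: e_def)
  define C where "C = R * p * (1 / e) powr (p - 1)"
  have C: "0 \<le> C" using R p_pos by (simp add: C_def)
  have "Lpow \<Omega> p \<phi> \<le> (2 * C) * Lpow \<Omega> p (grad \<phi>)" if \<phi>: "\<phi> \<in> test_functions \<Omega>" for \<phi>
  proof -
    let ?K = "closure {x. \<phi> x \<noteq> 0}"
    have K: "compact ?K" "?K \<subseteq> \<Omega>" using \<phi> by (simp_all add: test_functions_def)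
    note cal = test_function_calculus[OF \<phi>]
    have z: "\<phi> x = 0" "grad \<phi> x = 0" if "x \<notin> ?K" for x using cal(4)[OF that] by auto
    define f where "f x = (x \<bullet> i) * \<bar>\<phi> x\<bar> powr p" for x
    define g where "g x = \<bar>\<phi> x\<bar> powr p + (x \<bullet> i) * (p * flux p (\<phi> x) * (grad \<phi> x \<bullet> i))" for x
    have cfl: "continuous_on UNIV (\<lambda>x. flux p (\<phi> x))"
      by (rule continuous_on_compose2[OF _ cal(2), of UNIV])
         (use continuous_flux[OF p_gt_1] in \<open>auto intro: continuous_at_imp_continuous_on\<close>)
    have cpw: "continuous_on UNIV (\<lambda>x. \<bar>\<phi> x\<bar> powr p)"
      using p_pos by (intro continuous_on_powr' continuous_intros cal(2)) auto
    have cg: "continuous_on UNIV g"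
      unfolding g_def by (intro continuous_intros cfl cpw cal)
    have zg: "g x = 0" if "x \<notin> ?K" for x using z[OF that] by (simp add: g_def)
    have "integral\<^sup>L lborel g = 0"
    proof (rule integral_directional_derivative_zero[OF K(1), of f g i])
      show "continuous_on UNIV f" unfolding f_def by (intro continuous_intros cpw)
      show "((\<lambda>t. f (x + t *\<^sub>R i)) has_real_derivative g x) (at 0)" for x
      proof -
        have 1: "((\<lambda>t. (x + t *\<^sub>R i) \<bullet> i) has_real_derivative 1) (at 0)"
          using i by (auto intro!: derivative_eq_intros simp: inner_add_left)
        have 2: "((\<lambda>t. \<bar>\<phi> (x + t *\<^sub>R i)\<bar> powr p) has_real_derivative p * flux p (\<phi> (x + 0 *\<^sub>R i)) * (grad \<phi> x \<bullet> i)) (at 0)"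
          by (rule DERIV_chain2[OF DERIV_abs_powr[OF p_gt_1] has_derivative_imp_directional[OF cal(1)]])
        from DERIV_mult[OF 1 2] show ?thesis by (simp add: f_def g_def mult.commute)
      qed
      show "f x = 0" if "x \<notin> ?K" for x unfolding f_def z(1)[OF that] by simp
    qed (fact cg zg)+
    moreover have "integral\<^sup>L (\<mu>) g = integral\<^sup>L lborel g"
      by (rule integral_lebesgue_on_compact_support[OF open_dom cg]) (use zg K(2) in blast)
    ultimately have g0: "integral\<^sup>L (\<mu>) g = 0" by simp
    have gi: "integrable (\<mu>) g"
      by (rule Lp_on_integrable(1)[OF dom_lmeasurable p_ge_1 continuous_in_Lp[OF cg]])
    have le: "(1/2) * norm (\<phi> x) powr p - C * norm (grad \<phi> x) powr p \<le> g x" if x: "x \<in> \<Omega>" for x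
    proof -
      have "\<bar>(x \<bullet> i) * (p * flux p (\<phi> x) * (grad \<phi> x \<bullet> i))\<bar> = \<bar>x \<bullet> i\<bar> * (p * (\<bar>\<phi> x\<bar> powr (p - 1) * \<bar>grad \<phi> x \<bullet> i\<bar>))"
        using norm_flux[of p "\<phi> x"] p_pos by (simp add: abs_mult)
      also have "\<dots> \<le> R * (p * (\<bar>\<phi> x\<bar> powr (p - 1) * norm (grad \<phi> x)))"
        using R x p_pos Basis_le_norm[OF i, of x] Basis_le_norm[OF i, of "grad \<phi> x"]
        by (intro mult_mono) (auto intro: order_trans)
      also have "\<dots> \<le> R * (p * (e * \<bar>\<phi> x\<bar> powr p + (1 / e) powr (p - 1) * norm (grad \<phi> x) powr p))"
        using R p_pos p_gt_1 e by (intro mult_left_mono powr_mult_le_eps) auto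
      also have "\<dots> = (R * p * e) * \<bar>\<phi> x\<bar> powr p + C * norm (grad \<phi> x) powr p"
        by (simp add: C_def algebra_simps)
      finally show ?thesis unfolding e(2) g_def by (simp add: abs_le_iff)
    qed
    note s = sob_test[OF \<phi>]
    have i1: "integrable (\<mu>) (\<lambda>x. (1/2) * norm (\<phi> x) powr p)"
      "integrable (\<mu>) (\<lambda>x. C * norm (grad \<phi> x) powr p)"
      using Lp_onD(2)[OF sobD(1)[OF s]] Lp_onD(2)[OF sobD(2)[OF s]] by simp_all
    have "(LINT x|\<mu>. (1/2) * norm (\<phi> x) powr p - C * norm (grad \<phi> x) powr p) \<le> integral\<^sup>L (\<mu>) g"
      by (rule integral_mono[OF Bochner_Integration.integrable_diff[OF i1] gi]) (use le in simp)
    also have "(LINT x|\<mu>. (1/2) * norm (\<phi> x) powr p - C * norm (grad \<phi> x) powr p)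
       = (1/2) * Lpow \<Omega> p \<phi> - C * Lpow \<Omega> p (grad \<phi>)"
      by (subst Bochner_Integration.integral_diff[OF i1]) (simp add: Lpow_def)
    finally show ?thesis using g0 by simp
  qed
  with C that[of "2 * C"] show ?thesis by simp
qed

corollary Poincare:
  obtains C where "0 \<le> C" "\<And>w H. sob0 w H \<Longrightarrow> Lpow \<Omega> p w \<le> C * Lpow \<Omega> p H"
proof -
  obtain C where C: "0 \<le> C" "\<And>\<phi>. \<phi> \<in> test_functions \<Omega> \<Longrightarrow> Lpow \<Omega> p \<phi> \<le> C * Lpow \<Omega> p (grad \<phi>)"
    using Poincare_test by blast
  define P where "P = (2 powr p :: real)"
  have P: "0 \<le> P" by (simp add: P_def)
  have "Lpow \<Omega> p w \<le> (P * C * P) * Lpow \<Omega> p H" if w: "sob0 w H" for w H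
  proof -
    obtain \<phi> where \<phi>: "\<And>k. \<phi> k \<in> test_functions \<Omega>"
      and lim: "(\<lambda>k. Lpow \<Omega> p (\<lambda>x. w x - \<phi> k x)) \<longlonglongrightarrow> 0"
        "(\<lambda>k. Lpow \<Omega> p (\<lambda>x. H x - grad (\<phi> k) x)) \<longlonglongrightarrow> 0"
      using w by (auto simp: sob0_def)
    note ws = sob0_sob[OF w] and \<phi>s = sob_test[OF \<phi>]
    have "Lpow \<Omega> p w \<le> P * (Lpow \<Omega> p (\<lambda>x. w x - \<phi> k x) + C * (P * (Lpow \<Omega> p (\<lambda>x. H x - grad (\<phi> k) x) + Lpow \<Omega> p H)))" for k
    proof -
      have "Lpow \<Omega> p (\<lambda>x. (w x - \<phi> k x) + \<phi> k x) \<le> P * (Lpow \<Omega> p (\<lambda>x. w x - \<phi> k x) + Lpow \<Omega> p (\<phi> k))"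
        unfolding P_def by (rule Lpow_add_le[OF p_pos sobD(1)[OF sob_diff[OF ws \<phi>s]] sobD(1)[OF \<phi>s]])
      moreover have "Lpow \<Omega> p (\<lambda>x. (grad (\<phi> k) x - H x) + H x) \<le> P * (Lpow \<Omega> p (\<lambda>x. grad (\<phi> k) x - H x) + Lpow \<Omega> p H)"
        unfolding P_def by (rule Lpow_add_le[OF p_pos sobD(2)[OF sob_diff[OF \<phi>s ws]] sobD(2)[OF ws]])
      moreover have "Lpow \<Omega> p (\<lambda>x. grad (\<phi> k) x - H x) = Lpow \<Omega> p (\<lambda>x. H x - grad (\<phi> k) x)"
        by (rule Lpow_minus_commute)
      ultimately have 1: "Lpow \<Omega> p w \<le> P * (Lpow \<Omega> p (\<lambda>x. w x - \<phi> k x) + Lpow \<Omega> p (\<phi> k))"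
        and 2: "Lpow \<Omega> p (grad (\<phi> k)) \<le> P * (Lpow \<Omega> p (\<lambda>x. H x - grad (\<phi> k) x) + Lpow \<Omega> p H)" by simp_all
      have "Lpow \<Omega> p (\<phi> k) \<le> C * (P * (Lpow \<Omega> p (\<lambda>x. H x - grad (\<phi> k) x) + Lpow \<Omega> p H))"
        using order_trans[OF C(2)[OF \<phi>] mult_left_mono[OF 2 C(1)]] .
      then show ?thesis using order_trans[OF 1 mult_left_mono[OF _ P]] by simp
    qed
    moreover have "(\<lambda>k. P * (Lpow \<Omega> p (\<lambda>x. w x - \<phi> k x) + C * (P * (Lpow \<Omega> p (\<lambda>x. H x - grad (\<phi> k) x) + Lpow \<Omega> p H))))
        \<longlonglongrightarrow> P * (0 + C * (P * (0 + Lpow \<Omega> p H)))"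
      by (intro tendsto_intros lim)
    ultimately have "Lpow \<Omega> p w \<le> P * (0 + C * (P * (0 + Lpow \<Omega> p H)))"
      by (intro LIMSEQ_le_const) auto
    then show ?thesis by (simp add: mult.assoc)
  qed
  moreover have "0 \<le> P * C * P" using P C by simp
  ultimately show ?thesis using that by blast
qed

section \<open>Weighted p-energies\<close>

definition weight :: "real \<Rightarrow> real \<Rightarrow> ('a \<Rightarrow> real) \<Rightarrow> bool" where
  "weight c M \<sigma> \<longleftrightarrow> 0 < c \<and> \<sigma> \<in> borel_measurable (\<mu>) \<and>
     (AE x in \<mu>. c \<le> \<sigma> x \<and> \<sigma> x \<le> M)"

abbreviation genergy :: "('a \<Rightarrow> real) \<Rightarrow> ('a \<Rightarrow> 'b::euclidean_space) \<Rightarrow> real" where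
  "genergy h G \<equiv> LINT x|\<mu>. h x * norm (G x) powr p"

abbreviation flux_pairing ::
  "('a \<Rightarrow> real) \<Rightarrow> ('a \<Rightarrow> 'b::euclidean_space) \<Rightarrow> ('a \<Rightarrow> 'b) \<Rightarrow> real" where
  "flux_pairing h G H \<equiv> LINT x|\<mu>. h x * (flux p (G x) \<bullet> H x)"

lemma weight_one: "weight 1 1 (\<lambda>_. 1)"
  by (simp add: weight_def)

lemma integrable_weighted:
  fixes f h :: "'a \<Rightarrow> real"
  assumes "f \<in> borel_measurable (\<mu>)" "AE x in \<mu>. \<bar>f x\<bar> \<le> M"
    and h: "integrable (\<mu>) h"
  shows "integrable (\<mu>) (\<lambda>x. f x * h x)"
proof (rule Bochner_Integration.integrable_bound[OF integrable_mult_right[OF h, of M]])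
  show "(\<lambda>x. f x * h x) \<in> borel_measurable (\<mu>)"
    using assms by (intro borel_measurable_times) auto
  show "AE x in \<mu>. norm (f x * h x) \<le> norm (M * h x)"
    using assms(2) by eventually_elim (auto simp: abs_mult intro!: mult_right_mono)
qed

lemma weight_abs_le: "weight c M \<sigma> \<Longrightarrow> AE x in \<mu>. \<bar>\<sigma> x\<bar> \<le> M"
  unfolding weight_def by (elim conjE) (erule eventually_mono, simp)

lemma weight_integrable:
  assumes "weight c M \<sigma>" "G \<in> Lp_on \<Omega> p"
  shows "integrable (\<mu>) (\<lambda>x. \<sigma> x * norm (G x) powr p)"
  using assms weight_abs_le
  by (intro integrable_weighted[of _ M] Lp_onD(2)) (auto simp: weight_def)

lemma genergy_nonneg: "weight c M \<sigma> \<Longrightarrow> 0 \<le> genergy \<sigma> G"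
  unfolding weight_def by (intro integral_nonneg_AE) (auto elim!: eventually_mono)

lemma genergy_cong:
  assumes "weight c M \<sigma>" "G \<in> Lp_on \<Omega> p" "H \<in> Lp_on \<Omega> p" "AE x in \<mu>. G x = H x"
  shows "genergy \<sigma> G = genergy \<sigma> H"
  by (rule integral_cong_AE)
     (use assms(4) weight_integrable[OF assms(1,2)] weight_integrable[OF assms(1,3)] in \<open>auto elim!: eventually_mono\<close>)

lemma energy_eq_genergy:
  assumes "weight c M \<sigma>" "sob u G"
  shows "energy \<Omega> p \<sigma> u = genergy \<sigma> G"
  using genergy_cong[OF assms(1) sobD(2)[OF sob_weak_grad[OF assms(2)]] sobD(2)[OF assms(2)] weak_grad_AE[OF assms(2)]]
  by (simp add: energy_def)

lemma flux_measurable: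
  fixes G :: "'a \<Rightarrow> 'b::euclidean_space"
  assumes [measurable]: "G \<in> borel_measurable (\<mu>)"
  shows "(\<lambda>x. flux p (G x)) \<in> borel_measurable (\<mu>)"
  unfolding flux_def by measurable

lemma flux_inner_bound:
  fixes a b :: "'b::real_inner"
  assumes "0 < e"
  shows "\<bar>flux p a \<bullet> b\<bar> \<le> e * norm a powr p + (1 / e) powr (p - 1) * norm b powr p"
proof -
  have "\<bar>flux p a \<bullet> b\<bar> \<le> norm a powr (p - 1) * norm b"
    using Cauchy_Schwarz_ineq2[of "flux p a" b] by (simp add: norm_flux)
  also have "\<dots> \<le> e * norm a powr p + (1 / e) powr (p - 1) * norm b powr p"
    using p_gt_1 assms by (intro powr_mult_le_eps) auto
  finally show ?thesis .
qed

lemma flux_pairing_integrable: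
  assumes "weight c M \<sigma>" "G \<in> Lp_on \<Omega> p" "H \<in> Lp_on \<Omega> p"
  shows "integrable (\<mu>) (\<lambda>x. \<sigma> x * (flux p (G x) \<bullet> H x))"
proof (rule integrable_weighted)
  note [measurable] = Lp_onD(1)[OF assms(2)] Lp_onD(1)[OF assms(3)] flux_measurable[OF Lp_onD(1)[OF assms(2)]]
  have i: "integrable (\<mu>) (\<lambda>x. norm (G x) powr p + norm (H x) powr p)"
    by (intro Bochner_Integration.integrable_add Lp_onD assms)
  show "integrable (\<mu>) (\<lambda>x. flux p (G x) \<bullet> H x)"
    by (rule Bochner_Integration.integrable_bound[OF i]) (use flux_inner_bound[of 1] in auto)
qed (use assms(1) weight_abs_le in \<open>auto simp: weight_def\<close>)

lemma flux_pairing_bound: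
  assumes \<sigma>: "weight c M \<sigma>" and G: "G \<in> Lp_on \<Omega> p" and H: "H \<in> Lp_on \<Omega> p" and e: "0 < e"
  shows "\<bar>LINT x|\<mu>. \<sigma> x * (flux p (G x) \<bullet> H x)\<bar> \<le> \<bar>M\<bar> * (e * Lpow \<Omega> p G + (1 / e) powr (p - 1) * Lpow \<Omega> p H)"
proof -
  have i: "integrable (\<mu>) (\<lambda>x. e * norm (G x) powr p)"
    "integrable (\<mu>) (\<lambda>x. (1 / e) powr (p - 1) * norm (H x) powr p)"
    by (intro integrable_mult_right Lp_onD G H)+
  have "\<bar>LINT x|\<mu>. \<sigma> x * (flux p (G x) \<bullet> H x)\<bar> \<le> (LINT x|\<mu>. \<bar>\<sigma> x * (flux p (G x) \<bullet> H x)\<bar>)"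
    using integral_norm_bound[of "\<mu>" "\<lambda>x. \<sigma> x * (flux p (G x) \<bullet> H x)"] by simp
  also have "\<dots> \<le> (LINT x|\<mu>. \<bar>M\<bar> * (e * norm (G x) powr p + (1 / e) powr (p - 1) * norm (H x) powr p))"
  proof (rule integral_mono_AE)
    show "AE x in \<mu>. \<bar>\<sigma> x * (flux p (G x) \<bullet> H x)\<bar> \<le> \<bar>M\<bar> * (e * norm (G x) powr p + (1 / e) powr (p - 1) * norm (H x) powr p)"
      using weight_abs_le[OF \<sigma>]
      by eventually_elim (use flux_inner_bound[OF e] in \<open>auto simp: abs_mult intro!: mult_mono\<close>)
  qed (intro integrable_abs flux_pairing_integrable[OF \<sigma> G H] integrable_mult_right Bochner_Integration.integrable_add i)+
  also have "\<dots> = \<bar>M\<bar> * (e * Lpow \<Omega> p G + (1 / e) powr (p - 1) * Lpow \<Omega> p H)"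
    using i Lp_onD(2)[OF G] Lp_onD(2)[OF H] by (simp add: Lpow_def)
  finally show ?thesis .
qed

text \<open>The bound of the previous lemma has two terms: \<open>e\<close> is chosen to make the one with \<open>G\<close> small, and
  then \<open>k\<close> to make the other one small.\<close>

lemma flux_pairing_tendsto:
  assumes \<sigma>: "weight c M \<sigma>" and G: "G \<in> Lp_on \<Omega> p" and D: "\<And>k. D k \<in> Lp_on \<Omega> p"
    and lim: "(\<lambda>k. Lpow \<Omega> p (D k)) \<longlonglongrightarrow> 0"
  shows "(\<lambda>k. LINT x|\<mu>. \<sigma> x * (flux p (G x) \<bullet> D k x)) \<longlonglongrightarrow> 0"
proof (rule LIMSEQ_I)
  fix r :: real assume r: "0 < r"
  define q where "q = \<bar>M\<bar> * Lpow \<Omega> p G + 1"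
  define e where "e = r / (2 * q)"
  have p1: "0 < q" unfolding q_def by (intro add_nonneg_pos) (auto simp: Lpow_nonneg)
  have e: "0 < e" using r p1 by (simp add: e_def)
  have "e * q = r / 2" using p1 by (simp add: e_def)
  moreover have "e * q = \<bar>M\<bar> * (e * Lpow \<Omega> p G) + e" by (simp add: q_def distrib_left mult.left_commute)
  ultimately have e2: "\<bar>M\<bar> * (e * Lpow \<Omega> p G) < r / 2" using e by linarith
  have "(\<lambda>k. \<bar>M\<bar> * ((1 / e) powr (p - 1) * Lpow \<Omega> p (D k))) \<longlonglongrightarrow> \<bar>M\<bar> * ((1 / e) powr (p - 1) * 0)"
    by (intro tendsto_intros lim)
  then have "\<forall>\<^sub>F k in sequentially. \<bar>M\<bar> * ((1 / e) powr (p - 1) * Lpow \<Omega> p (D k)) < r / 2"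
    using r by (intro order_tendstoD(2)) auto
  then have "\<forall>\<^sub>F k in sequentially. norm (flux_pairing \<sigma> G (D k) - 0) < r"
  proof eventually_elim
    case (elim k)
    then show ?case using flux_pairing_bound[OF \<sigma> G D e, of k] e2 by (simp add: distrib_left)
  qed
  then show "\<exists>n. \<forall>k\<ge>n. norm (flux_pairing \<sigma> G (D k) - 0) < r"
    by (simp add: eventually_sequentially)
qed

lemma genergy_tangent:
  assumes \<sigma>: "weight c M \<sigma>" and G: "G \<in> Lp_on \<Omega> p" and H: "H \<in> Lp_on \<Omega> p"
  shows "genergy \<sigma> G + p * flux_pairing \<sigma> G (\<lambda>x. H x - G x) \<le> genergy \<sigma> H"
proof -
  note i = weight_integrable[OF \<sigma> G] weight_integrable[OF \<sigma> H] flux_pairing_integrable[OF \<sigma> G Lp_on_diff[OF p_pos H G]]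
  have "genergy \<sigma> G + p * flux_pairing \<sigma> G (\<lambda>x. H x - G x)
      = (LINT x|\<mu>. \<sigma> x * norm (G x) powr p + p * (\<sigma> x * (flux p (G x) \<bullet> (H x - G x))))"
    using i by simp
  also have "\<dots> \<le> genergy \<sigma> H"
  proof (rule integral_mono_AE)
    have "norm (G x) powr p + p * (flux p (G x) \<bullet> (H x - G x)) \<le> norm (H x) powr p" for x
      using tangent_norm[OF p_gt_1, of "G x" "H x"]
      by (simp add: inner_diff_right flux_inner_self algebra_simps)
    then have *: "s * (norm (G x) powr p + p * (flux p (G x) \<bullet> (H x - G x))) \<le> s * norm (H x) powr p" if "0 \<le> s" for s x
      using that by (rule mult_left_mono)
    have "AE x in \<mu>. 0 \<le> \<sigma> x" using \<sigma> by (auto simp: weight_def elim!: eventually_mono)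
    then show "AE x in \<mu>. \<sigma> x * norm (G x) powr p + p * (\<sigma> x * (flux p (G x) \<bullet> (H x - G x))) \<le> \<sigma> x * norm (H x) powr p"
    proof eventually_elim
      case (elim x)
      have "\<sigma> x * norm (G x) powr p + p * (\<sigma> x * (flux p (G x) \<bullet> (H x - G x)))
          = \<sigma> x * (norm (G x) powr p + p * (flux p (G x) \<bullet> (H x - G x)))"
        by (simp add: distrib_left mult.left_commute)
      then show ?case using *[OF elim] by simp
    qed
  qed (use i in simp_all)
  finally show ?thesis .
qed

lemma genergy_uniform_convexity:
  assumes \<sigma>: "weight c M \<sigma>" and e: "0 < e"
  obtains C where "0 \<le> C" "\<And>G H :: 'a \<Rightarrow> 'a. G \<in> Lp_on \<Omega> p \<Longrightarrow> H \<in> Lp_on \<Omega> p \<Longrightarrow>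
     c * Lpow \<Omega> p (\<lambda>x. G x - H x) \<le> e * (genergy \<sigma> G + genergy \<sigma> H)
       + C * ((genergy \<sigma> G + genergy \<sigma> H) / 2 - genergy \<sigma> (\<lambda>x. (1/2) *\<^sub>R (G x + H x)))"
proof -
  obtain C where C: "0 \<le> C" "\<And>a b :: 'a. norm (a - b) powr p \<le> e * (norm a powr p + norm b powr p)
     + C * ((norm a powr p + norm b powr p) / 2 - norm ((1/2) *\<^sub>R (a + b)) powr p)"
    using powr_uniform_convexity[OF p_gt_1 e] by blast
  have "c * Lpow \<Omega> p (\<lambda>x. G x - H x) \<le> e * (genergy \<sigma> G + genergy \<sigma> H)
       + C * ((genergy \<sigma> G + genergy \<sigma> H) / 2 - genergy \<sigma> (\<lambda>x. (1/2) *\<^sub>R (G x + H x)))"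
    if G: "G \<in> Lp_on \<Omega> p" and H: "H \<in> Lp_on \<Omega> p" for G H :: "'a \<Rightarrow> 'a"
  proof -
    have mid: "(\<lambda>x. (1/2) *\<^sub>R (G x + H x)) \<in> Lp_on \<Omega> p" by (intro Lp_on_scaleR Lp_on_add p_pos G H)
    note i = weight_integrable[OF \<sigma> G] weight_integrable[OF \<sigma> H] weight_integrable[OF \<sigma> mid]
    let ?r = "\<lambda>x. e * (\<sigma> x * norm (G x) powr p + \<sigma> x * norm (H x) powr p)
       + C * ((\<sigma> x * norm (G x) powr p + \<sigma> x * norm (H x) powr p) / 2 - \<sigma> x * norm ((1/2) *\<^sub>R (G x + H x)) powr p)"
    have ir: "integrable (\<mu>) ?r"
      by (intro Bochner_Integration.integrable_add Bochner_Integration.integrable_diff integrable_mult_right integrable_divide i)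
    have "c * Lpow \<Omega> p (\<lambda>x. G x - H x) = (LINT x|\<mu>. c * norm (G x - H x) powr p)"
      by (simp add: Lpow_def)
    also have "\<dots> \<le> integral\<^sup>L (\<mu>) ?r"
    proof (rule integral_mono_AE)
      show "integrable (\<mu>) (\<lambda>x. c * norm (G x - H x) powr p)"
        by (intro integrable_mult_right Lp_onD(2) Lp_on_diff p_pos G H)
      have "AE x in \<mu>. 0 < c \<and> c \<le> \<sigma> x" using \<sigma> by (auto simp: weight_def elim!: eventually_mono)
      then show "AE x in \<mu>. c * norm (G x - H x) powr p \<le> ?r x"
      proof eventually_elim
        case (elim x)
        have "c * norm (G x - H x) powr p \<le> \<sigma> x * norm (G x - H x) powr p"
          using elim by (intro mult_right_mono) auto
        also have "\<dots> \<le> \<sigma> x * (e * (norm (G x) powr p + norm (H x) powr p)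
           + C * ((norm (G x) powr p + norm (H x) powr p) / 2 - norm ((1/2) *\<^sub>R (G x + H x)) powr p))"
          using elim by (intro mult_left_mono C(2)) auto
        also have "\<dots> = ?r x" by (simp add: algebra_simps add_divide_distrib)
        finally show ?case .
      qed
    qed (rule ir)
    also have "\<dots> = e * (genergy \<sigma> G + genergy \<sigma> H)
       + C * ((genergy \<sigma> G + genergy \<sigma> H) / 2 - genergy \<sigma> (\<lambda>x. (1/2) *\<^sub>R (G x + H x)))"
      using i by simp
    finally show ?thesis .
  qed
  with C(1) that show ?thesis by blast
qed

end


context sobolev_domain
begin

section \<open>Boundary data and energy minimizers\<close>

lemma trace_spaceE:
  assumes "f \<in> trace_space \<Omega> p"
  obtains u0 where "sob u0 (weak_grad \<Omega> u0)" "f = {\<lambda>x. u0 x + w x | w. w \<in> W1p_0 \<Omega> p}"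
  using assms by (auto simp: trace_space_def W1p_coset_def W1p_iff)

lemma W1p_0_sob0: "w \<in> W1p_0 \<Omega> p \<Longrightarrow> sob0 w (weak_grad \<Omega> w)"
  by (rule W1p_0_imp_sob0) (auto simp: W1p_0_def W1p_iff)

lemma trace_space_nonempty: "f \<in> trace_space \<Omega> p \<Longrightarrow> \<exists>u. u \<in> f"
  using sob0_imp_W1p_0[OF sob0_zero] by (auto elim!: trace_spaceE)

lemma trace_space_sob:
  assumes "f \<in> trace_space \<Omega> p" "u \<in> f"
  shows "sob u (weak_grad \<Omega> u)"
proof -
  obtain u0 where u0: "sob u0 (weak_grad \<Omega> u0)" "f = {\<lambda>x. u0 x + w x | w. w \<in> W1p_0 \<Omega> p}"
    using assms(1) by (rule trace_spaceE)
  then obtain w where w: "u = (\<lambda>x. u0 x + w x)" "w \<in> W1p_0 \<Omega> p" using assms(2) by auto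
  have "sob u (\<lambda>x. weak_grad \<Omega> u0 x + 1 *\<^sub>R weak_grad \<Omega> w x)"
    using sob_add[OF u0(1) sob0_sob[OF W1p_0_sob0[OF w(2)]], of 1] by (simp add: w(1))
  then show ?thesis by (rule sob_weak_grad)
qed

lemma trace_space_diff:
  assumes f: "f \<in> trace_space \<Omega> p" and "u \<in> f" "v \<in> f" and G: "sob u G" and H: "sob v H"
  shows "sob0 (\<lambda>x. u x - v x) (\<lambda>x. G x - H x)"
proof (rule W1p_0_imp_sob0[OF _ sob_diff[OF G H]])
  obtain u0 where u0: "f = {\<lambda>x. u0 x + w x | w. w \<in> W1p_0 \<Omega> p}"
    using f by (rule trace_spaceE)
  then obtain w w' where w: "u = (\<lambda>x. u0 x + w x)" "w \<in> W1p_0 \<Omega> p" "v = (\<lambda>x. u0 x + w' x)" "w' \<in> W1p_0 \<Omega> p"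
    using assms(2,3) by auto
  have "(\<lambda>x. w x + (-1) * w' x) \<in> W1p_0 \<Omega> p"
    by (rule sob0_imp_W1p_0[OF sob0_add[OF W1p_0_sob0 W1p_0_sob0]]) (fact w)+
  then show "(\<lambda>x. u x - v x) \<in> W1p_0 \<Omega> p" by (simp add: w)
qed

lemma trace_space_add:
  assumes f: "f \<in> trace_space \<Omega> p" and "u \<in> f" and w: "sob0 w H"
  shows "(\<lambda>x. u x + c * w x) \<in> f"
proof -
  obtain u0 where u0: "f = {\<lambda>x. u0 x + w x | w. w \<in> W1p_0 \<Omega> p}"
    using f by (rule trace_spaceE)
  then obtain w' where w': "u = (\<lambda>x. u0 x + w' x)" "w' \<in> W1p_0 \<Omega> p"
    using assms(2) by auto
  have "(\<lambda>x. w' x + c * w x) \<in> W1p_0 \<Omega> p"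
    by (rule sob0_imp_W1p_0[OF sob0_add[OF W1p_0_sob0[OF w'(2)] w]])
  then show ?thesis unfolding u0 w'(1) by (auto simp: add.assoc)
qed

definition minimizer :: "('a \<Rightarrow> real) \<Rightarrow> ('a \<Rightarrow> real) set \<Rightarrow> ('a \<Rightarrow> real) \<Rightarrow> bool" where
  "minimizer \<sigma> f u \<longleftrightarrow> u \<in> f \<and> (\<forall>v\<in>f. energy \<Omega> p \<sigma> u \<le> energy \<Omega> p \<sigma> v)"

lemma scaleR_midpoint:
  fixes a b :: "'b::real_vector"
  shows "a + (1/2) *\<^sub>R (b - a) = (1/2) *\<^sub>R (a + b)"
proof -
  have "a + (1/2) *\<^sub>R (b - a) = (1/2) *\<^sub>R (a + a) + (1/2) *\<^sub>R (b - a)"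
    by (simp only: scaleR_half_double)
  also have "\<dots> = (1/2) *\<^sub>R (a + b)" by (simp only: scaleR_add_right[symmetric]) simp
  finally show ?thesis .
qed

lemma midpoint_energy:
  assumes \<sigma>: "weight c M \<sigma>" and f: "f \<in> trace_space \<Omega> p" and m: "\<And>w. w \<in> f \<Longrightarrow> m \<le> energy \<Omega> p \<sigma> w"
    and u: "u \<in> f" "sob u G" and v: "v \<in> f" "sob v H"
  shows "m \<le> genergy \<sigma> (\<lambda>x. (1/2) *\<^sub>R (G x + H x))"
proof -
  have "m \<le> energy \<Omega> p \<sigma> (\<lambda>x. u x + (1/2) * (v x - u x))"
    by (rule m[OF trace_space_add[OF f u(1) trace_space_diff[OF f v(1) u(1) v(2) u(2)]]])
  then show ?thesis
    by (simp only: energy_eq_genergy[OF \<sigma> sob_add[OF u(2) sob_diff[OF v(2) u(2)]]] scaleR_midpoint)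
qed

text \<open>Midpoints have energy at least \<open>m\<close>, so the convexity gap of late members of the sequence is tiny,
  and uniform convexity bounds their distance.\<close>

lemma minimizing_sequence_Cauchy:
  fixes G :: "nat \<Rightarrow> 'a \<Rightarrow> 'a"
  assumes \<sigma>: "weight c M \<sigma>" and G: "\<And>k. G k \<in> Lp_on \<Omega> p"
    and m: "0 \<le> m" and upper: "\<And>k. genergy \<sigma> (G k) < m + inverse (real (Suc k))"
    and mid: "\<And>j k. m \<le> genergy \<sigma> (\<lambda>x. (1/2) *\<^sub>R (G j x + G k x))"
    and r: "0 < r"
  shows "\<exists>N. \<forall>j\<ge>N. \<forall>k\<ge>N. Lpow \<Omega> p (\<lambda>x. G j x - G k x) < r"
proof -
  have c: "0 < c" using \<sigma> by (simp add: weight_def)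
  \<comment> \<open>Two energies are at most \<open>2 * (m + 1)\<close>, which leaves half of \<open>c * r\<close> for the convexity gap.\<close>
  define e where "e = c * r / (4 * (m + 1))"
  have e: "0 < e" "e * (2 * (m + 1)) = c * r / 2" using c r m by (auto simp: e_def field_simps)
  obtain C where C: "0 \<le> C" "\<And>G H :: 'a \<Rightarrow> 'a. G \<in> Lp_on \<Omega> p \<Longrightarrow> H \<in> Lp_on \<Omega> p \<Longrightarrow>
     c * Lpow \<Omega> p (\<lambda>x. G x - H x) \<le> e * (genergy \<sigma> G + genergy \<sigma> H)
       + C * ((genergy \<sigma> G + genergy \<sigma> H) / 2 - genergy \<sigma> (\<lambda>x. (1/2) *\<^sub>R (G x + H x)))"
    using genergy_uniform_convexity[OF \<sigma> e(1)] by blast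
  define d where "d n = inverse (real (Suc n))" for n
  have "d \<longlonglongrightarrow> 0" unfolding d_def by (rule LIMSEQ_inverse_real_of_nat)
  then have "(\<lambda>n. C * d n) \<longlonglongrightarrow> C * 0" by (intro tendsto_intros)
  then have "\<forall>\<^sub>F n in sequentially. C * d n < c * r / 2"
    using c r by (intro order_tendstoD(2)) auto
  then obtain N where N: "C * d N < c * r / 2"
    using eventually_happens'[OF sequentially_bot] by blast
  have "Lpow \<Omega> p (\<lambda>x. G j x - G k x) < r" if jk: "N \<le> j" "N \<le> k" for j k
  proof -
    let ?s = "genergy \<sigma> (G j) + genergy \<sigma> (G k)"
    have i: "d j \<le> d N" "d k \<le> d N"
      using jk by (auto simp: d_def intro!: le_imp_inverse_le)
    have i1: "d N \<le> 1" by (simp add: d_def field_simps)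
    have "genergy \<sigma> (G j) \<le> m + d N" "genergy \<sigma> (G k) \<le> m + d N"
      using order_trans[OF less_imp_le[OF upper[of j, folded d_def]] add_left_mono[OF i(1)]]
        order_trans[OF less_imp_le[OF upper[of k, folded d_def]] add_left_mono[OF i(2)]] .
    then have s: "?s \<le> (m + d N) + (m + d N)" by (rule add_mono)
    then have "e * ?s \<le> e * (2 * (m + 1))" using e(1) i1 by (intro mult_left_mono) auto
    moreover have "?s / 2 - genergy \<sigma> (\<lambda>x. (1/2) *\<^sub>R (G j x + G k x)) \<le> d N"
      using s mid[of j k] by argo
    then have "C * (?s / 2 - genergy \<sigma> (\<lambda>x. (1/2) *\<^sub>R (G j x + G k x))) \<le> C * d N"
      using C(1) by (rule mult_left_mono)
    ultimately have "c * Lpow \<Omega> p (\<lambda>x. G j x - G k x) < c * r"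
      using C(2)[OF G G, of j k] e(2) N by linarith
    then show ?thesis using c by simp
  qed
  then show ?thesis by blast
qed

text \<open>The direct method, with strong convergence of the gradients of a minimizing sequence instead of a
  weakly convergent subsequence. Poincare's inequality makes the functions converge too, the
  closedness of \<open>sob0\<close> keeps the limit in the coset, and the tangent inequality at the limit
  shows that its energy does not exceed the infimum.\<close>

theorem minimizer_exists:
  assumes \<sigma>: "weight c M \<sigma>" and f: "f \<in> trace_space \<Omega> p"
  shows "\<exists>u. minimizer \<sigma> f u"
proof -
  define m where "m = (INF v\<in>f. energy \<Omega> p \<sigma> v)"
  obtain u0 where u0: "u0 \<in> f" using trace_space_nonempty[OF f] by blast
  define G0 where "G0 = weak_grad \<Omega> u0"
  have s0: "sob u0 G0" using trace_space_sob[OF f u0] by (simp add: G0_def)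
  have E: "energy \<Omega> p \<sigma> v = genergy \<sigma> H" if "sob v H" for v H
    using energy_eq_genergy[OF \<sigma> that] .
  have Enn: "0 \<le> energy \<Omega> p \<sigma> v" if "v \<in> f" for v
    using E[OF trace_space_sob[OF f that]] genergy_nonneg[OF \<sigma>] by simp
  have bdd: "bdd_below (energy \<Omega> p \<sigma> ` f)" using Enn by (intro bdd_belowI2[of _ 0])
  have m_le: "m \<le> energy \<Omega> p \<sigma> v" if "v \<in> f" for v
    unfolding m_def by (rule cINF_lower[OF bdd that])
  have m0: "0 \<le> m" unfolding m_def using u0 Enn by (intro cINF_greatest) auto
  have "\<exists>v\<in>f. energy \<Omega> p \<sigma> v < m + inverse (real (Suc k))" for k
  proof (rule ccontr)
    assume "\<not> ?thesis"
    then have "m + inverse (real (Suc k)) \<le> m"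
      unfolding m_def using u0 by (intro cINF_greatest) (auto simp: not_less)
    then show False by simp
  qed
  then obtain u where u: "\<And>k. u k \<in> f" "\<And>k. energy \<Omega> p \<sigma> (u k) < m + inverse (real (Suc k))"
    by metis
  define G where "G k = weak_grad \<Omega> (u k)" for k
  have s: "sob (u k) (G k)" for k using trace_space_sob[OF f u(1)] by (simp add: G_def)
  note G_Lp = sobD(2)[OF s]
  have upper: "genergy \<sigma> (G k) < m + inverse (real (Suc k))" for k using u(2)[of k] E[OF s] by simp
  have w0: "sob0 (\<lambda>x. u k x - u0 x) (\<lambda>x. G k x - G0 x)" for k
    by (rule trace_space_diff[OF f u(1) u0 s s0])
  have mid: "m \<le> genergy \<sigma> (\<lambda>x. (1/2) *\<^sub>R (G j x + G k x))" for j k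
    by (rule midpoint_energy[OF \<sigma> f m_le u(1) s u(1) s])
  note Cauchy_G = minimizing_sequence_Cauchy[OF \<sigma> G_Lp m0 upper mid]
  obtain H where H: "H \<in> Lp_on \<Omega> p" "(\<lambda>k. Lpow \<Omega> p (\<lambda>x. G k x - H x)) \<longlonglongrightarrow> 0"
    using Lp_on_complete[OF p_pos G_Lp Cauchy_G] by blast
  obtain C where C: "0 \<le> C" "\<And>w H. sob0 w H \<Longrightarrow> Lpow \<Omega> p w \<le> C * Lpow \<Omega> p H"
    using Poincare by blast
  define w where "w k x = u k x - u0 x" for k x
  have w_Lp: "w k \<in> Lp_on \<Omega> p" for k
    using sobD(1)[OF sob0_sob[OF w0]] by (simp add: w_def[abs_def])
  have Cauchy_w: "\<exists>N. \<forall>j\<ge>N. \<forall>k\<ge>N. Lpow \<Omega> p (\<lambda>x. w j x - w k x) < r" if r: "0 < r" for r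
  proof -
    have "0 < r / (C + 1)" using r C(1) by simp
    from Cauchy_G[OF this] obtain N where N: "\<And>j k. N \<le> j \<Longrightarrow> N \<le> k \<Longrightarrow> Lpow \<Omega> p (\<lambda>x. G j x - G k x) < r / (C + 1)"
      by blast
    have "Lpow \<Omega> p (\<lambda>x. w j x - w k x) < r" if "N \<le> j" "N \<le> k" for j k
    proof -
      have "Lpow \<Omega> p (\<lambda>x. u j x - u k x) \<le> C * Lpow \<Omega> p (\<lambda>x. G j x - G k x)"
        by (rule C(2)[OF trace_space_diff[OF f u(1) u(1) s s]])
      also have "\<dots> \<le> C * (r / (C + 1))" using N[OF that] C(1) by (intro mult_left_mono) auto
      also have "\<dots> < r" using r C(1) by (simp add: field_simps)
      finally show ?thesis by (simp add: w_def)
    qed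
    then show ?thesis by blast
  qed
  obtain v where v: "v \<in> Lp_on \<Omega> p" "(\<lambda>k. Lpow \<Omega> p (\<lambda>x. w k x - v x)) \<longlonglongrightarrow> 0"
    using Lp_on_complete[OF p_pos w_Lp Cauchy_w] by blast
  have s_v: "sob0 v (\<lambda>x. H x - G0 x)"
  proof (rule sob0_closed[of w "\<lambda>k x. G k x - G0 x"])
    show "sob0 (w k) (\<lambda>x. G k x - G0 x)" for k using w0[of k] by (simp add: w_def[abs_def])
    show "(\<lambda>x. H x - G0 x) \<in> Lp_on \<Omega> p" by (rule Lp_on_diff[OF p_pos H(1) sobD(2)[OF s0]])
  qed (use v H(2) in simp_all)
  have mem: "(\<lambda>x. u0 x + 1 * v x) \<in> f" by (rule trace_space_add[OF f u0 s_v])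
  have sob_lim: "sob (\<lambda>x. u0 x + 1 * v x) (\<lambda>x. G0 x + 1 *\<^sub>R (H x - G0 x))"
    by (rule sob_add[OF s0 sob0_sob[OF s_v]])
  have "genergy \<sigma> H \<le> m"
  proof (rule LIMSEQ_le_const)
    have "(\<lambda>k. LINT x|\<mu>. \<sigma> x * (flux p (H x) \<bullet> (G k x - H x))) \<longlonglongrightarrow> 0"
      by (rule flux_pairing_tendsto[OF \<sigma> H(1) Lp_on_diff[OF p_pos G_Lp H(1)] H(2)])
    then have "(\<lambda>k. (m + inverse (real (Suc k))) - p * flux_pairing \<sigma> H (\<lambda>x. G k x - H x))
        \<longlonglongrightarrow> (m + 0) - p * 0"
      by (intro tendsto_intros LIMSEQ_inverse_real_of_nat)
    then show "(\<lambda>k. (m + inverse (real (Suc k))) - p * flux_pairing \<sigma> H (\<lambda>x. G k x - H x))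
        \<longlonglongrightarrow> m" by simp
    have "genergy \<sigma> H \<le> (m + inverse (real (Suc k))) - p * flux_pairing \<sigma> H (\<lambda>x. G k x - H x)" for k
      using genergy_tangent[OF \<sigma> H(1) G_Lp[of k]] upper[of k] by linarith
    then show "\<exists>N. \<forall>k\<ge>N. genergy \<sigma> H \<le> (m + inverse (real (Suc k))) - p * flux_pairing \<sigma> H (\<lambda>x. G k x - H x)"
      by blast
  qed
  moreover have "energy \<Omega> p \<sigma> (\<lambda>x. u0 x + 1 * v x) = genergy \<sigma> H" using E[OF sob_lim] by simp
  ultimately have "minimizer \<sigma> f (\<lambda>x. u0 x + 1 * v x)"
    unfolding minimizer_def using mem m_le by fastforce
  then show ?thesis by blast
qed

lemma p_potential_minimizer:
  assumes "weight c M \<sigma>" "f \<in> trace_space \<Omega> p"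
  shows "minimizer \<sigma> f (p_potential \<Omega> p \<sigma> f)"
proof -
  obtain u where "minimizer \<sigma> f u" using minimizer_exists[OF assms] by blast
  then have "is_arg_min (energy \<Omega> p \<sigma>) (\<lambda>x. x \<in> f) u"
    by (auto simp: minimizer_def is_arg_min_def not_less)
  then have "is_arg_min (energy \<Omega> p \<sigma>) (\<lambda>x. x \<in> f) (p_potential \<Omega> p \<sigma> f)"
    unfolding p_potential_def arg_min_on_def arg_min_def
    by (rule someI[of "is_arg_min (energy \<Omega> p \<sigma>) (\<lambda>x. x \<in> f)"])
  then show ?thesis by (auto simp: minimizer_def is_arg_min_def not_less)
qed

text \<open>The tangent inequality at the displaced gradient \<open>F k = G + t k *\<^sub>R H\<close>, compared with minimality of
  \<open>u\<close>, gives the sign of the pairing at \<open>F k\<close>; dominated convergence then removes the displacement.\<close>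

lemma directional_derivative_nonneg:
  assumes \<sigma>: "weight c M \<sigma>" and f: "f \<in> trace_space \<Omega> p" and u: "minimizer \<sigma> f u"
    and G: "sob u G" and w: "sob0 w H"
  shows "0 \<le> flux_pairing \<sigma> G H"
proof -
  note GL = sobD(2)[OF G] and HL = sobD(2)[OF sob0_sob[OF w]]
  define t where "t k = inverse (real (Suc k))" for k
  have t: "0 < t k" "t k \<le> 1" for k by (auto simp: t_def field_simps)
  define F where "F k x = G x + t k *\<^sub>R H x" for k x
  have sF: "sob (\<lambda>x. u x + t k * w x) (F k)" for k
    unfolding F_def by (rule sob_add[OF G sob0_sob[OF w]])
  note FL = sobD(2)[OF sF]
  have nn: "0 \<le> flux_pairing \<sigma> (F k) H" for k
  proof -
    have "genergy \<sigma> G \<le> genergy \<sigma> (F k)"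
      using u trace_space_add[OF f _ w, of u "t k"] energy_eq_genergy[OF \<sigma> G] energy_eq_genergy[OF \<sigma> sF]
      unfolding minimizer_def by metis
    moreover have "genergy \<sigma> (F k) + p * flux_pairing \<sigma> (F k) (\<lambda>x. G x - F k x) \<le> genergy \<sigma> G"
      by (rule genergy_tangent[OF \<sigma> FL GL])
    moreover have "flux_pairing \<sigma> (F k) (\<lambda>x. G x - F k x)
       = - t k * flux_pairing \<sigma> (F k) H"
      unfolding integral_mult_right_zero[symmetric] by (simp add: F_def mult.left_commute)
    ultimately have "0 \<le> (p * t k) * flux_pairing \<sigma> (F k) H"
      by simp
    moreover have "0 < p * t k" using t(1) p_pos by simp
    ultimately show ?thesis by (simp only: zero_le_mult_iff) linarith
  qed
  have tl: "t \<longlonglongrightarrow> 0" unfolding t_def by (rule LIMSEQ_inverse_real_of_nat)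
  have "(\<lambda>k. LINT x|\<mu>. \<sigma> x * (flux p (F k x) \<bullet> H x)) \<longlonglongrightarrow> (flux_pairing \<sigma> G H)"
  proof (rule integral_dominated_convergence)
    let ?b = "\<lambda>x. 2 powr p * (norm (G x) powr p + norm (H x) powr p) + norm (H x) powr p"
    show "integrable (\<mu>) (\<lambda>x. \<bar>M\<bar> * ?b x)"
      by (intro integrable_mult_right Bochner_Integration.integrable_add Lp_onD(2) GL HL)
    show "AE x in \<mu>. (\<lambda>k. \<sigma> x * (flux p (F k x) \<bullet> H x)) \<longlonglongrightarrow> \<sigma> x * (flux p (G x) \<bullet> H x)"
    proof (rule AE_I2)
      fix x
      have "(\<lambda>k. F k x) \<longlonglongrightarrow> G x + 0 *\<^sub>R H x" unfolding F_def by (intro tendsto_intros tl)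
      then have "(\<lambda>k. flux p (F k x)) \<longlonglongrightarrow> flux p (G x)"
        using isCont_tendsto_compose[OF continuous_flux[OF p_gt_1, of "G x"]] by simp
      then show "(\<lambda>k. \<sigma> x * (flux p (F k x) \<bullet> H x)) \<longlonglongrightarrow> \<sigma> x * (flux p (G x) \<bullet> H x)"
        by (intro tendsto_intros)
    qed
    fix k
    have "\<bar>flux p (F k x) \<bullet> H x\<bar> \<le> ?b x" for x
    proof -
      have "\<bar>flux p (F k x) \<bullet> H x\<bar> \<le> norm (F k x) powr p + norm (H x) powr p"
        using flux_inner_bound[of 1 "F k x" "H x"] by simp
      also have "norm (F k x) powr p \<le> 2 powr p * (norm (G x) powr p + norm (t k *\<^sub>R H x) powr p)"
        unfolding F_def by (rule norm_add_powr_le[OF p_pos])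
      also have "norm (t k *\<^sub>R H x) powr p \<le> norm (H x) powr p"
        using t[of k] p_pos by (intro powr_mono2) (auto intro: mult_left_le_one_le)
      finally show ?thesis by simp
    qed
    then show "AE x in \<mu>. norm (\<sigma> x * (flux p (F k x) \<bullet> H x)) \<le> \<bar>M\<bar> * ?b x"
      using weight_abs_le[OF \<sigma>] by (auto simp: abs_mult elim!: eventually_mono intro!: mult_mono)
  qed (use flux_pairing_integrable[OF \<sigma> GL HL] flux_pairing_integrable[OF \<sigma> FL HL] in \<open>simp_all add: borel_measurable_integrable\<close>)
  then show ?thesis by (rule LIMSEQ_le_const) (use nn in blast)
qed

proposition Euler_Lagrange:
  assumes \<sigma>: "weight c M \<sigma>" and f: "f \<in> trace_space \<Omega> p" and u: "minimizer \<sigma> f u"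
    and G: "sob u G" and w: "sob0 w H"
  shows "flux_pairing \<sigma> G H = 0"
proof -
  have "sob0 (\<lambda>x. 0 + (-1) * w x) (\<lambda>x. 0 + (-1) *\<^sub>R H x)" by (rule sob0_add[OF sob0_zero w])
  then have "sob0 (\<lambda>x. - w x) (\<lambda>x. - H x)" by simp
  from directional_derivative_nonneg[OF \<sigma> f u G this] directional_derivative_nonneg[OF \<sigma> f u G w]
  show ?thesis by simp
qed

lemma minimizerI_Euler_Lagrange:
  assumes \<sigma>: "weight c M \<sigma>" and f: "f \<in> trace_space \<Omega> p" and u: "u \<in> f" and G: "sob u G"
    and EL: "\<And>w H. sob0 w H \<Longrightarrow> (flux_pairing \<sigma> G H) = 0"
  shows "minimizer \<sigma> f u"
  unfolding minimizer_def
proof (intro conjI ballI u)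
  fix v assume v: "v \<in> f"
  note s = trace_space_sob[OF f v]
  have "flux_pairing \<sigma> G (\<lambda>x. weak_grad \<Omega> v x - G x) = 0"
    by (rule EL[OF trace_space_diff[OF f v u s G]])
  then show "energy \<Omega> p \<sigma> u \<le> energy \<Omega> p \<sigma> v"
    using genergy_tangent[OF \<sigma> sobD(2)[OF G] sobD(2)[OF s]]
    by (simp add: energy_eq_genergy[OF \<sigma> G] energy_eq_genergy[OF \<sigma> s])
qed

text \<open>The sequence alternating between the two minimizers is minimizing, hence Cauchy.\<close>

lemma minimizer_gradient_unique:
  assumes \<sigma>: "weight c M \<sigma>" and f: "f \<in> trace_space \<Omega> p"
    and u: "minimizer \<sigma> f u" "sob u G" and v: "minimizer \<sigma> f v" "sob v H"
  shows "AE x in \<mu>. G x = H x"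
proof -
  note GL = sobD(2)[OF u(2)] and HL = sobD(2)[OF v(2)]
  have uf: "u \<in> f" and vf: "v \<in> f" using u v by (auto simp: minimizer_def)
  define m where "m = genergy \<sigma> G"
  have m: "energy \<Omega> p \<sigma> u = m" "genergy \<sigma> H = m"
    using u v uf vf energy_eq_genergy[OF \<sigma> u(2)] energy_eq_genergy[OF \<sigma> v(2)]
    unfolding minimizer_def m_def by (metis order_antisym)+
  have min: "m \<le> energy \<Omega> p \<sigma> w" if "w \<in> f" for w using u(1) that m(1) by (auto simp: minimizer_def)
  define w where "w k = (if even k then u else v)" for k :: nat
  define F where "F k = (if even k then G else H)" for k :: nat
  have w: "w k \<in> f" "sob (w k) (F k)" for k using u v uf vf by (simp_all add: w_def F_def)
  have upper: "genergy \<sigma> (F k) < m + inverse (real (Suc k))" for k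
    using m(2) by (simp add: F_def m_def)
  have mid: "m \<le> genergy \<sigma> (\<lambda>x. (1/2) *\<^sub>R (F j x + F k x))" for j k
    by (rule midpoint_energy[OF \<sigma> f min w w])
  note Cauchy = minimizing_sequence_Cauchy[OF \<sigma> sobD(2)[OF w(2)] genergy_nonneg[OF \<sigma>, of G, folded m_def] upper mid]
  have "Lpow \<Omega> p (\<lambda>x. G x - H x) = 0"
  proof (rule ccontr)
    assume "Lpow \<Omega> p (\<lambda>x. G x - H x) \<noteq> 0"
    then have "0 < Lpow \<Omega> p (\<lambda>x. G x - H x)" using Lpow_nonneg[of \<Omega> p "\<lambda>x. G x - H x"] by simp
    from Cauchy[OF this] obtain N where N: "\<And>j k. N \<le> j \<Longrightarrow> N \<le> k \<Longrightarrow>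
        Lpow \<Omega> p (\<lambda>x. F j x - F k x) < Lpow \<Omega> p (\<lambda>x. G x - H x)" by blast
    show False using N[of "2 * N" "Suc (2 * N)"] by (simp add: F_def)
  qed
  then have "AE x in \<mu>. norm (G x - H x) powr p = 0"
    unfolding Lpow_def using Lp_onD(2)[OF Lp_on_diff[OF p_pos GL HL]]
    by (subst (asm) integral_nonneg_eq_0_iff_AE) auto
  then show ?thesis by eventually_elim (simp add: powr_eq_0_iff)
qed

section \<open>Quadratic forms of the Dirichlet-Neumann maps\<close>

text \<open>By the Euler-Lagrange equation the representative \<open>v\<close> chosen in \<^const>\<open>DN\<close> may be replaced by the
  minimizer, and then the pairing is the energy.\<close>

proposition DN_diagonal:
  assumes \<sigma>: "weight c M \<sigma>" and f: "f \<in> trace_space \<Omega> p" and u: "minimizer \<sigma> f u" and G: "sob u G"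
  shows "DN \<Omega> p \<sigma> f f = genergy \<sigma> G"
proof -
  define P where "P = weak_grad \<Omega> (p_potential \<Omega> p \<sigma> f)"
  define v where "v = (SOME v. v \<in> f)"
  note pot = p_potential_minimizer[OF \<sigma> f]
  have vf: "v \<in> f" unfolding v_def using trace_space_nonempty[OF f] by (rule someI_ex)
  have pf: "p_potential \<Omega> p \<sigma> f \<in> f" using pot by (simp add: minimizer_def)
  have sP: "sob (p_potential \<Omega> p \<sigma> f) P" unfolding P_def by (rule trace_space_sob[OF f pf])
  note sv = trace_space_sob[OF f vf]
  note PL = sobD(2)[OF sP] and vL = sobD(2)[OF sv]
  have "DN \<Omega> p \<sigma> f f = (LINT x|\<mu>. \<sigma> x * (flux p (P x) \<bullet> weak_grad \<Omega> v x))"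
    by (simp add: DN_def Let_def P_def v_def flux_def mult.assoc)
  also have "\<dots> = (LINT x|\<mu>. \<sigma> x * norm (P x) powr p + \<sigma> x * (flux p (P x) \<bullet> (weak_grad \<Omega> v x - P x)))"
    by (intro Bochner_Integration.integral_cong) (simp_all add: inner_diff_right flux_inner_self algebra_simps)
  also have "\<dots> = genergy \<sigma> P + flux_pairing \<sigma> P (\<lambda>x. weak_grad \<Omega> v x - P x)"
    by (rule Bochner_Integration.integral_add[OF weight_integrable[OF \<sigma> PL] flux_pairing_integrable[OF \<sigma> PL Lp_on_diff[OF p_pos vL PL]]])
  also have "\<dots> = genergy \<sigma> P"
    using Euler_Lagrange[OF \<sigma> f pot sP trace_space_diff[OF f vf pf sv sP]] by simp
  also have "\<dots> = genergy \<sigma> G"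
    by (rule genergy_cong[OF \<sigma> PL sobD(2)[OF G] minimizer_gradient_unique[OF \<sigma> f pot sP u G]])
  finally show ?thesis .
qed

lemma DN_test_diagonal:
  assumes f: "f \<in> trace_space \<Omega> p" and u: "minimizer (\<lambda>_. 1) f u" and G: "sob u G"
    and B: "B \<subseteq> \<Omega>" "B \<in> sets lebesgue"
  shows "DN_test \<Omega> p B f f = genergy (indicator B) G"
proof -
  define P where "P = weak_grad \<Omega> (p_potential \<Omega> p (\<lambda>_. 1) f)"
  note pot = p_potential_minimizer[OF weight_one f]
  have sP: "sob (p_potential \<Omega> p (\<lambda>_. 1) f) P"
    unfolding P_def using trace_space_sob[OF f] pot by (simp add: minimizer_def)
  have "norm (P x) powr (p - 2) * (P x \<bullet> P x) = norm (P x) powr p" for x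
    using flux_inner_self[of p "P x"] by (simp add: flux_def)
  then have "DN_test \<Omega> p B f f = (LINT x|lebesgue_on B. norm (P x) powr p)"
    by (simp add: DN_test_def Let_def P_def)
  also have "\<dots> = genergy (indicator B) P"
  proof -
    have "(\<lambda>x. indicator B x * norm (P x) powr p) = (\<lambda>x. indicator \<Omega> x *\<^sub>R (indicator B x * norm (P x) powr p))"
      using B(1) by (auto simp: indicator_def fun_eq_iff)
    moreover have "(LINT x|lebesgue_on B. norm (P x) powr p) = (LINT x|lebesgue. indicator B x * norm (P x) powr p)"
      using B(2) by (simp add: integral_restrict_space)
    moreover have "genergy (indicator B) P
        = (LINT x|lebesgue. indicator \<Omega> x *\<^sub>R (indicator B x * norm (P x) powr p))"
      by (rule integral_restrict_space) simp
    ultimately show ?thesis by (simp only:)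
  qed
  also have "\<dots> = genergy (indicator B) G"
  proof (rule integral_cong_AE)
    have Bm: "indicat_real B \<in> borel_measurable (\<mu>)"
      using B(2) by (intro measurable_restrict_space1 borel_measurable_indicator)
    show "(\<lambda>x. indicator B x * norm (P x) powr p) \<in> borel_measurable (\<mu>)"
      "(\<lambda>x. indicator B x * norm (G x) powr p) \<in> borel_measurable (\<mu>)"
      using Lp_onD(2)[OF sobD(2)[OF sP]] Lp_onD(2)[OF sobD(2)[OF G]] Bm
      by (auto intro!: borel_measurable_times)
    show "AE x in \<mu>. indicator B x * norm (P x) powr p = indicator B x * norm (G x) powr p"
      using minimizer_gradient_unique[OF weight_one f pot sP u G] by (auto elim!: eventually_mono)
  qed
  finally show ?thesis .
qed

lemma weight_powr_integrable:
  assumes \<sigma>: "weight c M \<sigma>" and G: "G \<in> Lp_on \<Omega> p"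
  shows "integrable (\<mu>) (\<lambda>x. \<sigma> x powr (- (1 / (p - 1))) * norm (G x) powr p)"
proof (rule integrable_weighted[OF _ _ Lp_onD(2)[OF G]])
  have [measurable]: "\<sigma> \<in> borel_measurable (\<mu>)" and c: "0 < c"
    using \<sigma> by (auto simp: weight_def)
  show "(\<lambda>x. \<sigma> x powr (- (1 / (p - 1)))) \<in> borel_measurable (\<mu>)" by measurable
  have "AE x in \<mu>. c \<le> \<sigma> x" using \<sigma> by (auto simp: weight_def elim!: eventually_mono)
  then show "AE x in \<mu>. \<bar>\<sigma> x powr (- (1 / (p - 1)))\<bar> \<le> c powr (- (1 / (p - 1)))"
    by eventually_elim (use c p_gt_1 in \<open>auto intro!: powr_mono2'\<close>)
qed

text \<open>The upper bound holds because \<open>u\<close> competes with the minimizer for \<open>\<sigma>\<close>. For the lower bound let \<open>H\<close>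
  be the gradient of that minimizer. The weighted tangent inequality bounds the energy of \<open>H\<close>
  below by \<open>p * (flux p G \<bullet> H)\<close> minus a multiple of \<open>norm G powr p\<close>, and the Euler-Lagrange
  equation for \<open>u\<close> replaces \<open>H\<close> by \<open>G\<close> in the pairing.\<close>

theorem DN_monotonicity:
  assumes \<sigma>: "weight c M \<sigma>" and f: "f \<in> trace_space \<Omega> p" and u: "minimizer (\<lambda>_. 1) f u" and G: "sob u G"
  shows "DN \<Omega> p \<sigma> f f - DN0 \<Omega> p f f \<le> genergy (\<lambda>x. \<sigma> x - 1) G"
    and "genergy (\<lambda>x. (p - 1) * (1 - \<sigma> x powr (- (1 / (p - 1))))) G
      \<le> DN \<Omega> p \<sigma> f f - DN0 \<Omega> p f f"
proof -
  define v where "v = p_potential \<Omega> p \<sigma> f"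
  define H where "H = weak_grad \<Omega> v"
  have v: "minimizer \<sigma> f v" unfolding v_def by (rule p_potential_minimizer[OF \<sigma> f])
  have uf: "u \<in> f" and vf: "v \<in> f" using u v by (auto simp: minimizer_def)
  have H: "sob v H" unfolding H_def by (rule trace_space_sob[OF f vf])
  note GL = sobD(2)[OF G] and HL = sobD(2)[OF H]
  have D: "DN \<Omega> p \<sigma> f f = genergy \<sigma> H" "DN0 \<Omega> p f f = genergy (\<lambda>_. 1) G"
    by (rule DN_diagonal[OF \<sigma> f v H], rule DN_diagonal[OF weight_one f u G])
  note i1 = weight_integrable[OF weight_one GL] and iG = weight_integrable[OF \<sigma> GL]
    and iH = weight_integrable[OF \<sigma> HL] and iP = weight_powr_integrable[OF \<sigma> GL]
  have "genergy \<sigma> H \<le> genergy \<sigma> G"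
    using v uf unfolding minimizer_def energy_eq_genergy[OF \<sigma> G, symmetric] energy_eq_genergy[OF \<sigma> H, symmetric] by blast
  moreover have "genergy \<sigma> G - genergy (\<lambda>_. 1) G = genergy (\<lambda>x. \<sigma> x - 1) G"
    unfolding Bochner_Integration.integral_diff[OF iG i1, symmetric] by (simp add: left_diff_distrib)
  ultimately show "DN \<Omega> p \<sigma> f f - DN0 \<Omega> p f f \<le> genergy (\<lambda>x. \<sigma> x - 1) G"
    using D by simp
  let ?s = "\<lambda>x. \<sigma> x powr (- (1 / (p - 1)))"
  have "flux_pairing (\<lambda>_. 1) G (\<lambda>x. H x - G x) = 0"
    by (rule Euler_Lagrange[OF weight_one f u G trace_space_diff[OF f vf uf H G]])
  moreover have "flux_pairing (\<lambda>_. 1) G (\<lambda>x. H x - G x)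
     = flux_pairing (\<lambda>_. 1) G H - genergy (\<lambda>_. 1) G"
    unfolding Bochner_Integration.integral_diff[OF flux_pairing_integrable[OF weight_one GL HL] i1, symmetric]
    by (simp add: inner_diff_right flux_inner_self)
  ultimately have EL: "flux_pairing (\<lambda>_. 1) G H = genergy (\<lambda>_. 1) G" by simp
  have "(LINT x|\<mu>. p * (1 * (flux p (G x) \<bullet> H x)))
     \<le> (LINT x|\<mu>. \<sigma> x * norm (H x) powr p + (p - 1) * (?s x * norm (G x) powr p))"
  proof (rule integral_mono_AE)
    have "AE x in \<mu>. 0 < \<sigma> x"
      using \<sigma> by (auto simp: weight_def elim!: eventually_mono)
    then show "AE x in \<mu>. p * (1 * (flux p (G x) \<bullet> H x)) \<le> \<sigma> x * norm (H x) powr p + (p - 1) * (?s x * norm (G x) powr p)"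
      by eventually_elim (use tangent_norm_weighted[OF p_gt_1] in \<open>simp add: mult.assoc\<close>)
  qed (intro integrable_mult_right flux_pairing_integrable[OF weight_one GL HL] Bochner_Integration.integrable_add iH iP)+
  then have "p * genergy (\<lambda>_. 1) G \<le> genergy \<sigma> H + (p - 1) * genergy (\<lambda>x. ?s x) G"
    using iH iP EL by simp
  moreover have "genergy (\<lambda>x. (p - 1) * (1 - ?s x)) G
     = (p - 1) * (genergy (\<lambda>_. 1) G - genergy (\<lambda>x. ?s x) G)"
    unfolding Bochner_Integration.integral_diff[OF i1 iP, symmetric] integral_mult_right_zero[symmetric]
    by (simp add: algebra_simps)
  ultimately show "genergy (\<lambda>x. (p - 1) * (1 - ?s x)) G \<le> DN \<Omega> p \<sigma> f f - DN0 \<Omega> p f f"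
    unfolding D by (simp add: algebra_simps)
qed

end


section \<open>Wolff's exponential p-harmonic functions\<close>

text \<open>The differential equation for the angle is autonomous, so it is solved by inverting the explicit
  time function \<open>T\<close>, whose derivative \<open>D / (p - 1)\<close> is positive.\<close>

lemma wolff_angle_exists:
  fixes p :: real
  assumes p: "1 < p"
  obtains \<theta> :: "real \<Rightarrow> real" where
    "\<And>t. (\<theta> has_real_derivative (p - 1) / ((p - 1) * (sin (\<theta> t))\<^sup>2 + (cos (\<theta> t))\<^sup>2)) (at t)"
proof -
  \<comment> \<open>\<open>T\<close> is the primitive of \<open>D / (p - 1)\<close> that vanishes at zero.\<close>
  define D where "D \<psi> = (p - 1) * (sin \<psi>)\<^sup>2 + (cos \<psi>)\<^sup>2" for \<psi> :: real
  define T where "T \<psi> = (p * \<psi> / 2 - (p - 2) * (sin \<psi> * cos \<psi>) / 2) / (p - 1)" for \<psi> :: real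
  have D_pos: "0 < D \<psi>" for \<psi>
  proof (cases "sin \<psi> = 0")
    case True
    then show ?thesis using sin_cos_squared_add[of \<psi>] by (simp add: D_def)
  next
    case False
    then show ?thesis using p by (simp add: D_def add_pos_nonneg)
  qed
  have T': "(T has_real_derivative D \<psi> / (p - 1)) (at \<psi>)" for \<psi>
  proof -
    have "(T has_real_derivative (p / 2 - (p - 2) * (cos \<psi> * cos \<psi> - sin \<psi> * sin \<psi>) / 2) / (p - 1)) (at \<psi>)"
      unfolding T_def using p by (auto intro!: derivative_eq_intros)
    moreover have "p / 2 - (p - 2) * (cos \<psi> * cos \<psi> - sin \<psi> * sin \<psi>) / 2 = D \<psi>"
    proof -
      have cc: "cos \<psi> * cos \<psi> = 1 - sin \<psi> * sin \<psi>"
        using sin_cos_squared_add3[of \<psi>] by linarith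
      show ?thesis unfolding D_def power2_eq_square cc by (simp add: field_simps)
    qed
    ultimately show ?thesis by simp
  qed
  have mono: "T x < T y" if "x < y" for x y
    using DERIV_pos_imp_increasing[OF that] T' D_pos p by (meson diff_gt_0_iff_gt divide_pos_pos)
  have cont: "isCont T x" for x using T' DERIV_isCont by blast
  have surj: "\<exists>x. T x = y" for y
  proof -
    \<comment> \<open>Large enough that the linear term of \<open>T\<close> dominates its oscillation on both sides.\<close>
    define b where "b = 2 * \<bar>(p - 1) * y\<bar> + \<bar>p - 2\<bar>"
    have b: "0 \<le> b" by (simp add: b_def)
    have sc: "\<bar>(p - 2) * (sin \<psi> * cos \<psi>)\<bar> \<le> \<bar>p - 2\<bar>" for \<psi> :: real
    proof -
      have "\<bar>sin \<psi> * cos \<psi>\<bar> \<le> 1 * 1" unfolding abs_mult by (intro mult_mono) auto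
      then have "\<bar>p - 2\<bar> * \<bar>sin \<psi> * cos \<psi>\<bar> \<le> \<bar>p - 2\<bar> * 1" by (intro mult_left_mono) auto
      then show ?thesis by (simp add: abs_mult)
    qed
    have pb: "b \<le> p * b" using mult_right_mono[of 1 p b] p b by simp
    have "(p - 1) * y \<le> (p - 1) * T b"
    proof -
      have "(p - 1) * T b = p * b / 2 - (p - 2) * (sin b * cos b) / 2" using p by (simp add: T_def)
      then show ?thesis using sc[of b] pb unfolding b_def by argo
    qed
    moreover have "(p - 1) * T (- b) \<le> (p - 1) * y"
    proof -
      have "(p - 1) * T (- b) = - (p * b / 2) + (p - 2) * (sin b * cos b) / 2" using p by (simp add: T_def)
      then show ?thesis using sc[of b] pb unfolding b_def by argo
    qed
    ultimately have "T (- b) \<le> y" "y \<le> T b" using p by simp_all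
    then show ?thesis using IVT[of T "- b" y b] b cont by auto
  qed
  define \<theta> where "\<theta> y = (SOME x. T x = y)" for y
  have inj: "T x = T y \<Longrightarrow> x = y" for x y using mono[of x y] mono[of y x] by (cases x y rule: linorder_cases) auto
  have T\<theta>: "T (\<theta> y) = y" for y
    unfolding \<theta>_def by (rule someI_ex[OF surj])
  have \<theta>T: "\<theta> (T x) = x" for x by (rule inj[OF T\<theta>])
  have "(\<theta> has_real_derivative inverse (D (\<theta> t) / (p - 1))) (at t)" for t
  proof (rule DERIV_inverse_function[of T _ _ _ "t - 1" "t + 1"])
    show "(T has_real_derivative D (\<theta> t) / (p - 1)) (at (\<theta> t))" by (rule T')
    show "D (\<theta> t) / (p - 1) \<noteq> 0" using D_pos[of "\<theta> t"] p by simp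
    have "isCont \<theta> (T (\<theta> t))"
      by (rule isCont_inverse_function[of 1 "\<theta> t" \<theta> T]) (auto simp: \<theta>T cont)
    then show "isCont \<theta> t" by (simp add: T\<theta>)
  qed (auto simp: T\<theta>)
  then show ?thesis using that[of \<theta>] by (simp add: D_def)
qed

text \<open>The function \<open>\<lambda>(x, y). exp x * a y\<close> is \<open>p\<close>-harmonic when \<open>a\<close> solves a second-order equation that is
  homogeneous of degree one in \<open>(a, a')\<close>. In polar coordinates \<open>a = N cos \<theta>\<close>,
  \<open>a' = - N sin \<theta>\<close> it splits into the equation for \<open>\<theta>\<close> solved above and
  \<open>N = exp (k sin\<^sup>2 \<theta>)\<close> with \<open>k = (p - 2) / (2 (p - 1))\<close>. In particular \<open>N\<close> lies between two
  positive constants. The last property of the statement says that the flux is divergence free.\<close>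

proposition wolff_profile:
  fixes p :: real
  assumes p: "1 < p"
  obtains a a1 b1 N :: "real \<Rightarrow> real" and r0 r1 :: real where
    "\<And>t. (a has_real_derivative a1 t) (at t)" "continuous_on UNIV a1"
    "\<And>t. (N t)\<^sup>2 = (a t)\<^sup>2 + (a1 t)\<^sup>2" "0 < r0" "\<And>t. r0 \<le> N t" "\<And>t. N t \<le> r1"
    "\<And>t. ((\<lambda>t. N t powr (p - 2) * a t) has_real_derivative b1 t) (at t)" "continuous_on UNIV b1"
    "\<And>t. ((\<lambda>t. N t powr (p - 2) * a1 t) has_real_derivative - (p - 1) * (N t powr (p - 2) * a t)) (at t)"
proof -
  obtain \<theta> where "\<And>t. (\<theta> has_real_derivative (p - 1) / ((p - 1) * (sin (\<theta> t))\<^sup>2 + (cos (\<theta> t))\<^sup>2)) (at t)"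
    using wolff_angle_exists[OF p] by blast
  moreover define D where "D t = (p - 1) * (sin (\<theta> t))\<^sup>2 + (cos (\<theta> t))\<^sup>2" for t
  ultimately have \<theta>: "(\<theta> has_real_derivative (p - 1) / D t) (at t)" for t by simp
  have D: "0 < D t" for t
  proof (cases "sin (\<theta> t) = 0")
    case True
    then show ?thesis using sin_cos_squared_add[of "\<theta> t"] by (simp add: D_def)
  next
    case False
    then show ?thesis using p by (simp add: D_def add_pos_nonneg)
  qed
  have sc: "(cos (\<theta> t))\<^sup>2 = 1 - (sin (\<theta> t))\<^sup>2" for t by (rule cos_squared_eq)
  have D_alt: "D t = 1 + (p - 2) * (sin (\<theta> t))\<^sup>2" for t unfolding D_def sc by (simp add: algebra_simps)
  have c\<theta>: "continuous_on UNIV \<theta>" using DERIV_isCont[OF \<theta>] by (simp add: continuous_at_imp_continuous_on)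
  define k where "k = (p - 2) / (2 * (p - 1))"
  have k: "2 * (p - 1) * k = p - 2" using p by (simp add: k_def)
  define E where "E q t = exp (q * k * (sin (\<theta> t))\<^sup>2)" for q t
  have E': "(E q has_real_derivative E q t * (2 * q * k * sin (\<theta> t) * cos (\<theta> t) * ((p - 1) / D t))) (at t)" for q t
    unfolding E_def by (auto intro!: derivative_eq_intros \<theta> simp: power2_eq_square)
  have cE: "continuous_on UNIV (E q)" for q using DERIV_isCont[OF E'] by (simp add: continuous_at_imp_continuous_on)
  define a where "a t = E 1 t * cos (\<theta> t)" for t
  define a1 where "a1 t = - (E 1 t * sin (\<theta> t))" for t
  define b1 where "b1 t = E (p - 1) t * (2 * (p - 1) * k * sin (\<theta> t) * cos (\<theta> t) * ((p - 1) / D t)) * cos (\<theta> t)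
      - E (p - 1) t * (sin (\<theta> t) * ((p - 1) / D t))" for t
  have N: "E 1 t powr (p - 2) * E 1 t = E (p - 1) t" for t
  proof -
    have "E 1 t powr (p - 2) * E 1 t = exp (k * (sin (\<theta> t))\<^sup>2 * (p - 2) + k * (sin (\<theta> t))\<^sup>2)"
      by (simp add: E_def exp_powr_real exp_add)
    also have "k * (sin (\<theta> t))\<^sup>2 * (p - 2) + k * (sin (\<theta> t))\<^sup>2 = (p - 1) * k * (sin (\<theta> t))\<^sup>2"
      by (simp add: algebra_simps)
    finally show ?thesis by (simp add: E_def)
  qed
  have Na: "E 1 t powr (p - 2) * a t = E (p - 1) t * cos (\<theta> t)"
    "E 1 t powr (p - 2) * a1 t = - (E (p - 1) t * sin (\<theta> t))" for t
    using N[of t] by (simp_all add: a_def a1_def flip: mult.assoc)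
  show ?thesis
  proof (rule that[of a a1 "E 1" "exp (- \<bar>k\<bar>)" "exp \<bar>k\<bar>" b1])
    fix t
    have ks: "\<bar>k * (sin (\<theta> t))\<^sup>2\<bar> \<le> \<bar>k\<bar>"
      using mult_left_mono[of "(sin (\<theta> t))\<^sup>2" 1 "\<bar>k\<bar>"] by (simp add: abs_mult abs_square_le_1)
    show "exp (- \<bar>k\<bar>) \<le> E 1 t" "E 1 t \<le> exp \<bar>k\<bar>" using ks by (simp_all add: E_def abs_le_iff)
    show "(E 1 t)\<^sup>2 = (a t)\<^sup>2 + (a1 t)\<^sup>2"
      by (simp add: a_def a1_def power_mult_distrib sc algebra_simps)
    show "(a has_real_derivative a1 t) (at t)"
    proof -
      have "(a has_real_derivative E 1 t * (2 * 1 * k * sin (\<theta> t) * cos (\<theta> t) * ((p - 1) / D t)) * cos (\<theta> t)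
          + E 1 t * (- sin (\<theta> t) * ((p - 1) / D t))) (at t)"
        unfolding a_def by (rule derivative_eq_intros E' \<theta> refl | simp)+
      moreover have "E 1 t * (2 * 1 * k * sin (\<theta> t) * cos (\<theta> t) * ((p - 1) / D t)) * cos (\<theta> t)
          + E 1 t * (- sin (\<theta> t) * ((p - 1) / D t))
        = E 1 t * sin (\<theta> t) / D t * ((2 * (p - 1) * k) * (cos (\<theta> t))\<^sup>2 - (p - 1))"
        by (simp add: power2_eq_square algebra_simps diff_divide_distrib add_divide_distrib)
      moreover have "(2 * (p - 1) * k) * (cos (\<theta> t))\<^sup>2 - (p - 1) = - D t"
        unfolding k D_alt sc by (simp add: algebra_simps)
      ultimately show ?thesis using D[of t] by (simp add: a1_def)
    qed
    show "((\<lambda>t. E 1 t powr (p - 2) * a t) has_real_derivative b1 t) (at t)"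
      unfolding Na b1_def by (rule derivative_eq_intros E' \<theta> refl | simp)+
    show "((\<lambda>t. E 1 t powr (p - 2) * a1 t) has_real_derivative - (p - 1) * (E 1 t powr (p - 2) * a t)) (at t)"
    proof -
      have "((\<lambda>t. - (E (p - 1) t * sin (\<theta> t))) has_real_derivative
          - (E (p - 1) t * (2 * (p - 1) * k * sin (\<theta> t) * cos (\<theta> t) * ((p - 1) / D t)) * sin (\<theta> t)
          + E (p - 1) t * (cos (\<theta> t) * ((p - 1) / D t)))) (at t)"
        by (rule derivative_eq_intros E' \<theta> refl | simp)+
      moreover have "- (E (p - 1) t * (2 * (p - 1) * k * sin (\<theta> t) * cos (\<theta> t) * ((p - 1) / D t)) * sin (\<theta> t)
          + E (p - 1) t * (cos (\<theta> t) * ((p - 1) / D t)))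
        = - (p - 1) * (E (p - 1) t * cos (\<theta> t)) / D t * ((2 * (p - 1) * k) * (sin (\<theta> t))\<^sup>2 + 1)"
        by (simp add: power2_eq_square algebra_simps diff_divide_distrib add_divide_distrib)
      moreover have "(2 * (p - 1) * k) * (sin (\<theta> t))\<^sup>2 + 1 = D t" unfolding k D_alt by simp
      ultimately show ?thesis unfolding Na using D[of t] by simp
    qed
  next
    have cD: "continuous_on UNIV D" unfolding D_def by (intro continuous_intros c\<theta>)
    have D0: "D t \<noteq> 0" for t using D[of t] by simp
    show "continuous_on UNIV a1" unfolding a1_def by (intro continuous_intros c\<theta> cE)
    show "continuous_on UNIV b1" unfolding b1_def by (intro continuous_intros c\<theta> cE cD) (simp_all add: D0)
  qed simp
qed

lemma has_derivative_exp_profile: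
  fixes \<rho> \<tau> x :: "'a::real_inner"
  assumes "\<And>t. (h has_real_derivative h1 t) (at t)"
  shows "((\<lambda>x. exp (k * (x \<bullet> \<rho>)) * h (s * (x \<bullet> \<tau>))) has_derivative
     (\<lambda>y. (exp (k * (x \<bullet> \<rho>)) *\<^sub>R ((k * h (s * (x \<bullet> \<tau>))) *\<^sub>R \<rho> + (s * h1 (s * (x \<bullet> \<tau>))) *\<^sub>R \<tau>)) \<bullet> y)) (at x)"
proof -
  have 1: "((\<lambda>x. h (s * (x \<bullet> \<tau>))) has_derivative (\<lambda>y. (s * (y \<bullet> \<tau>)) * h1 (s * (x \<bullet> \<tau>)))) (at x)"
    by (rule has_derivative_eq_rhs[OF has_derivative_compose[OF _ assms[unfolded has_field_derivative_def]]])
       (auto intro!: derivative_eq_intros)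
  have 2: "((\<lambda>x. exp (k * (x \<bullet> \<rho>))) has_derivative (\<lambda>y. (k * (y \<bullet> \<rho>)) * exp (k * (x \<bullet> \<rho>)))) (at x)"
    by (rule has_derivative_eq_rhs[OF has_derivative_compose[OF _ DERIV_exp[unfolded has_field_derivative_def]]])
       (auto intro!: derivative_eq_intros)
  show ?thesis
    by (rule has_derivative_eq_rhs[OF has_derivative_mult[OF 2 1]])
       (auto simp: inner_add_left inner_commute algebra_simps)
qed

context sobolev_domain
begin

text \<open>The Euler-Lagrange equation extends from test functions to \<open>sob0\<close> by density, and by convexity it is
  sufficient for minimality.\<close>

lemma weak_p_harmonic_minimizer:
  assumes u: "\<And>x. (u has_derivative (\<lambda>h. G x \<bullet> h)) (at x)" and G: "continuous_on UNIV G"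
    and test: "\<And>\<phi>. \<phi> \<in> test_functions \<Omega> \<Longrightarrow> (LINT x|\<mu>. flux p (G x) \<bullet> grad \<phi> x) = 0"
  shows "W1p_coset \<Omega> p u \<in> trace_space \<Omega> p" "sob u G" "minimizer (\<lambda>_. 1) (W1p_coset \<Omega> p u) u"
proof -
  show s: "sob u G" by (rule sob_classical[OF u G])
  show f: "W1p_coset \<Omega> p u \<in> trace_space \<Omega> p" using sob_W1p[OF s] by (simp add: trace_space_def)
  have "(\<lambda>x. u x + 0) \<in> W1p_coset \<Omega> p u"
    unfolding W1p_coset_def mem_Collect_eq using sob0_imp_W1p_0[OF sob0_zero]
    by (intro exI[of _ "\<lambda>x. 0"]) simp
  then have mem: "u \<in> W1p_coset \<Omega> p u" by simp
  note GL = sobD(2)[OF s]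
  show "minimizer (\<lambda>_. 1) (W1p_coset \<Omega> p u) u"
  proof (rule minimizerI_Euler_Lagrange[OF weight_one f mem s])
    fix w H assume w: "sob0 w H"
    then obtain \<phi> where \<phi>: "\<And>k. \<phi> k \<in> test_functions \<Omega>"
      and lim: "(\<lambda>k. Lpow \<Omega> p (\<lambda>x. H x - grad (\<phi> k) x)) \<longlonglongrightarrow> 0" by (auto simp: sob0_def)
    note HL = sobD(2)[OF sob0_sob[OF w]] and \<phi>L = sobD(2)[OF sob_test[OF \<phi>]]
    have "(\<lambda>k. LINT x|\<mu>. 1 * (flux p (G x) \<bullet> (H x - grad (\<phi> k) x))) \<longlonglongrightarrow> 0"
      by (rule flux_pairing_tendsto[OF weight_one GL Lp_on_diff[OF p_pos HL \<phi>L] lim])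
    moreover have "flux_pairing (\<lambda>_. 1) G (\<lambda>x. H x - grad (\<phi> k) x)
        = flux_pairing (\<lambda>_. 1) G H" for k
      using flux_pairing_integrable[OF weight_one GL HL] flux_pairing_integrable[OF weight_one GL \<phi>L[of k]] test[OF \<phi>[of k]]
      by (simp add: inner_diff_right)
    ultimately show "flux_pairing (\<lambda>_. 1) G H = 0"
      by (simp add: LIMSEQ_const_iff)
  qed
qed

text \<open>The solutions are \<open>u x = exp (s (x \<bullet> \<rho>)) * a (s (x \<bullet> \<tau>))\<close>. What matters is that \<open>r0\<close> and \<open>r1\<close> do not
  depend on the frequency \<open>s\<close>.\<close>

theorem wolff_solutions:
  fixes \<rho> \<tau> :: 'a
  assumes \<rho>: "norm \<rho> = 1" and \<tau>: "norm \<tau> = 1" and orth: "\<rho> \<bullet> \<tau> = 0"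
  obtains r0 r1 :: real where "0 < r0"
    "\<And>s. 0 < s \<Longrightarrow> \<exists>f u G. f \<in> trace_space \<Omega> p \<and> minimizer (\<lambda>_. 1) f u \<and> sob u G \<and>
      (\<forall>x. s * exp (s * (x \<bullet> \<rho>)) * r0 \<le> norm (G x) \<and> norm (G x) \<le> s * exp (s * (x \<bullet> \<rho>)) * r1)"
proof -
  obtain a a1 b1 N :: "real \<Rightarrow> real" and r0 r1 :: real where
    a: "\<And>t. (a has_real_derivative a1 t) (at t)" and ca1: "continuous_on UNIV a1"
    and N: "\<And>t. (N t)\<^sup>2 = (a t)\<^sup>2 + (a1 t)\<^sup>2" and r0: "0 < r0" "\<And>t. r0 \<le> N t" and r1: "\<And>t. N t \<le> r1"
    and b: "\<And>t. ((\<lambda>t. N t powr (p - 2) * a t) has_real_derivative b1 t) (at t)" and cb1: "continuous_on UNIV b1"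
    and d: "\<And>t. ((\<lambda>t. N t powr (p - 2) * a1 t) has_real_derivative - (p - 1) * (N t powr (p - 2) * a t)) (at t)"
  proof (rule wolff_profile[OF p_gt_1], goal_cases)
    case 1
    from 1(1)[OF 1(2-)] show ?case .
  qed
  have N0: "0 < N t" for t using r0(1) r0(2)[of t] by linarith
  have ca: "continuous_on UNIV a" using DERIV_isCont[OF a] by (simp add: continuous_at_imp_continuous_on)
  define b where "b t = N t powr (p - 2) * a t" for t
  define d where "d t = N t powr (p - 2) * a1 t" for t
  have b': "(b has_real_derivative b1 t) (at t)" and d': "(d has_real_derivative - (p - 1) * b t) (at t)" for t
    using b[of t] d[of t] by (simp_all add: b_def[abs_def] d_def[abs_def])
  have cb: "continuous_on UNIV b" using DERIV_isCont[OF b'] by (simp add: continuous_at_imp_continuous_on)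
  have cc: "continuous_on UNIV (\<lambda>x::'a. h (s * (x \<bullet> \<tau>)))" if "continuous_on UNIV h" for h :: "real \<Rightarrow> real" and s
    by (rule continuous_on_compose2[OF that]) (auto intro!: continuous_intros)
  have "\<exists>f u G. f \<in> trace_space \<Omega> p \<and> minimizer (\<lambda>_. 1) f u \<and> sob u G \<and>
      (\<forall>x. s * exp (s * (x \<bullet> \<rho>)) * r0 \<le> norm (G x) \<and> norm (G x) \<le> s * exp (s * (x \<bullet> \<rho>)) * r1)"
    if s: "0 < s" for s
  proof -
    define u where "u x = exp (s * (x \<bullet> \<rho>)) * a (s * (x \<bullet> \<tau>))" for x
    define V where "V x = a (s * (x \<bullet> \<tau>)) *\<^sub>R \<rho> + a1 (s * (x \<bullet> \<tau>)) *\<^sub>R \<tau>" for x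
    define G where "G x = (s * exp (s * (x \<bullet> \<rho>))) *\<^sub>R V x" for x
    have u': "(u has_derivative (\<lambda>h. G x \<bullet> h)) (at x)" for x
      using has_derivative_exp_profile[OF a, of s \<rho> s \<tau> x]
      by (simp add: u_def[abs_def] G_def V_def scaleR_add_right mult_ac)
    have cG: "continuous_on UNIV G"
      unfolding G_def V_def by (intro continuous_intros cc ca ca1)
    have nV: "norm (V x) = N (s * (x \<bullet> \<tau>))" for x
    proof -
      have "(norm (V x))\<^sup>2 = (a (s * (x \<bullet> \<tau>)))\<^sup>2 + (a1 (s * (x \<bullet> \<tau>)))\<^sup>2"
        unfolding V_def using \<rho> \<tau> orth
        by (simp add: norm_add_Pythagorean orthogonal_def)
      then have "(norm (V x))\<^sup>2 = (N (s * (x \<bullet> \<tau>)))\<^sup>2" by (simp only: N)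
      then show ?thesis using N0 by (simp add: power2_eq_iff_nonneg less_imp_le)
    qed
    have nG: "norm (G x) = s * exp (s * (x \<bullet> \<rho>)) * N (s * (x \<bullet> \<tau>))" for x
      using s by (simp add: G_def nV)
    define k where "k = (p - 1) * s"
    have fl: "flux p (G x) = s powr (p - 1) *\<^sub>R ((exp (k * (x \<bullet> \<rho>)) * b (s * (x \<bullet> \<tau>))) *\<^sub>R \<rho> + (exp (k * (x \<bullet> \<rho>)) * d (s * (x \<bullet> \<tau>))) *\<^sub>R \<tau>)" for x
    proof -
      have sc: "flux p (c *\<^sub>R z) = c powr (p - 1) *\<^sub>R flux p z" if "0 < c" for c and z :: 'a
      proof -
        have "c powr (p - 2) * c powr 1 = c powr (p - 1)" by (simp only: powr_add[symmetric]) simp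
        then show ?thesis using that by (simp add: flux_def powr_mult)
      qed
      have fV: "flux p (V x) = b (s * (x \<bullet> \<tau>)) *\<^sub>R \<rho> + d (s * (x \<bullet> \<tau>)) *\<^sub>R \<tau>"
        unfolding flux_def nV by (simp add: V_def b_def d_def scaleR_add_right)
      have fG: "flux p (G x) = (s * exp (s * (x \<bullet> \<rho>))) powr (p - 1) *\<^sub>R flux p (V x)"
        unfolding G_def using s by (intro sc) simp
      have pw: "(s * exp (s * (x \<bullet> \<rho>))) powr (p - 1) = s powr (p - 1) * exp (k * (x \<bullet> \<rho>))"
        using s by (simp add: powr_mult exp_powr_real k_def mult_ac)
      show ?thesis unfolding fG fV pw by (simp add: scaleR_add_right mult.assoc)
    qed
    have "(LINT x|\<mu>. flux p (G x) \<bullet> grad \<phi> x) = 0" if \<phi>: "\<phi> \<in> test_functions \<Omega>" for \<phi>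
    proof -
      define F1 where "F1 x = exp (k * (x \<bullet> \<rho>)) * b (s * (x \<bullet> \<tau>))" for x
      define F2 where "F2 x = exp (k * (x \<bullet> \<rho>)) * d (s * (x \<bullet> \<tau>))" for x
      define G1 where "G1 x = exp (k * (x \<bullet> \<rho>)) *\<^sub>R ((k * b (s * (x \<bullet> \<tau>))) *\<^sub>R \<rho> + (s * b1 (s * (x \<bullet> \<tau>))) *\<^sub>R \<tau>)" for x
      define G2 where "G2 x = exp (k * (x \<bullet> \<rho>)) *\<^sub>R ((k * d (s * (x \<bullet> \<tau>))) *\<^sub>R \<rho> + (s * (- (p - 1) * b (s * (x \<bullet> \<tau>)))) *\<^sub>R \<tau>)" for x
      have F1: "(F1 has_derivative (\<lambda>h. G1 x \<bullet> h)) (at x)" and F2: "(F2 has_derivative (\<lambda>h. G2 x \<bullet> h)) (at x)" for x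
        using has_derivative_exp_profile[OF b', of k \<rho> s \<tau> x] has_derivative_exp_profile[OF d', of k \<rho> s \<tau> x]
        unfolding F1_def[abs_def] F2_def[abs_def] G1_def G2_def by simp_all
      have cd: "continuous_on UNIV d" using DERIV_isCont[OF d'] by (simp add: continuous_at_imp_continuous_on)
      have c1: "continuous_on UNIV G1" and c2: "continuous_on UNIV G2"
        unfolding G1_def G2_def by (intro continuous_intros cc cb cb1 cd)+
      note ibp1 = integration_by_parts[OF open_dom \<phi> F1 c1, of \<rho>]
        and ibp2 = integration_by_parts[OF open_dom \<phi> F2 c2, of \<tau>]
      note i1 = test_integrable[OF Lp_loc_integrable[OF sobD(1)[OF sob_classical[OF F1 c1]]] open_dom \<phi>]
        and i2 = test_integrable[OF Lp_loc_integrable[OF sobD(1)[OF sob_classical[OF F2 c2]]] open_dom \<phi>]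
      have nn: "\<rho> \<bullet> \<rho> = 1" "\<tau> \<bullet> \<tau> = 1" "\<tau> \<bullet> \<rho> = 0" using \<rho> \<tau> orth by (simp_all add: dot_square_norm inner_commute)
      have div: "G2 x \<bullet> \<tau> = - (G1 x \<bullet> \<rho>)" for x
        by (simp add: G1_def G2_def inner_add_left nn orth k_def algebra_simps)
      have pt: "flux p (G x) \<bullet> grad \<phi> x
          = s powr (p - 1) * (F1 x * (grad \<phi> x \<bullet> \<rho>) + F2 x * (grad \<phi> x \<bullet> \<tau>))" for x
        unfolding fl F1_def F2_def by (simp add: inner_add_left inner_commute[of "grad \<phi> x"])
      have "(LINT x|\<mu>. flux p (G x) \<bullet> grad \<phi> x)
         = s powr (p - 1) * ((LINT x|\<mu>. F1 x * (grad \<phi> x \<bullet> \<rho>)) + (LINT x|\<mu>. F2 x * (grad \<phi> x \<bullet> \<tau>)))"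
        unfolding Bochner_Integration.integral_add[OF i1(2) i2(2), symmetric] integral_mult_right_zero[symmetric] pt ..
      also have "\<dots> = 0" unfolding ibp1 ibp2 div by simp
      finally show ?thesis .
    qed
    note h = weak_p_harmonic_minimizer[OF u' cG this]
    have "s * exp (s * (x \<bullet> \<rho>)) * r0 \<le> norm (G x) \<and> norm (G x) \<le> s * exp (s * (x \<bullet> \<rho>)) * r1" for x
      unfolding nG using s r0(2) r1 by (simp add: mult_left_mono)
    with h show ?thesis by blast
  qed
  with r0(1) that show ?thesis by blast
qed

end


section \<open>Localization outside a half-space\<close>

context sobolev_domain
begin

lemma positive_measure_beyond:
  fixes B :: "'a set"
  assumes B: "B \<in> sets lebesgue" and pos: "B - {x. x \<bullet> \<rho> \<le> t} \<notin> null_sets lebesgue"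
  obtains \<delta> where "0 < \<delta>" "B \<inter> {x. t + \<delta> \<le> x \<bullet> \<rho>} \<in> sets lebesgue" "B \<inter> {x. t + \<delta> \<le> x \<bullet> \<rho>} \<notin> null_sets lebesgue"
proof -
  let ?S = "\<lambda>n. B \<inter> {x. t + inverse (real (Suc n)) \<le> x \<bullet> \<rho>}"
  have S: "?S n \<in> sets lebesgue" for n
  proof -
    have "closed {x. t + inverse (real (Suc n)) \<le> x \<bullet> \<rho>}"
      by (intro closed_Collect_le continuous_intros)
    then show ?thesis using B by (intro sets.Int) auto
  qed
  have "B - {x. x \<bullet> \<rho> \<le> t} \<subseteq> (\<Union>n. ?S n)"
  proof
    fix x assume x: "x \<in> B - {x. x \<bullet> \<rho> \<le> t}"
    then obtain n where "inverse (real (Suc n)) < x \<bullet> \<rho> - t"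
      using reals_Archimedean[of "x \<bullet> \<rho> - t"] by auto
    with x show "x \<in> (\<Union>n. ?S n)" by (intro UN_I[of n]) auto
  qed
  moreover have "B - {x. x \<bullet> \<rho> \<le> t} \<in> sets lebesgue"
  proof -
    have "closed {x. x \<bullet> \<rho> \<le> t}" by (intro closed_Collect_le continuous_intros)
    then show ?thesis using B by (intro sets.Diff) auto
  qed
  ultimately have "\<exists>n. ?S n \<notin> null_sets lebesgue"
    using pos null_sets_UN[of ?S lebesgue] null_sets_subset by blast
  then show ?thesis using S that by (meson inverse_positive_iff_positive of_nat_0_less_iff zero_less_Suc)
qed

lemma integrable_indicator_energy:
  assumes "B \<in> sets lebesgue" "G \<in> Lp_on \<Omega> p"
  shows "integrable (\<mu>) (\<lambda>x. indicator B x * norm (G x) powr p)"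
  by (rule integrable_weighted[OF _ _ Lp_onD(2)[OF assms(2)], of _ 1])
     (use assms(1) in \<open>auto intro!: measurable_restrict_space1 borel_measurable_indicator simp: indicator_def\<close>)

text \<open>A set of positive measure in \<open>B\<close> lies at distance \<open>\<delta>\<close> beyond the half-space. There the energy
  density of Wolff's solution of frequency \<open>s\<close> exceeds the one in the half-space by the factor
  \<open>exp (p s \<delta>)\<close>, up to constants independent of \<open>s\<close>. The constants \<open>X\<close> and \<open>Y\<close> collect these.\<close>

proposition localized_energy:
  fixes \<rho> :: 'a and B :: "'a set"
  assumes dim: "2 \<le> DIM('a)" and \<rho>: "norm \<rho> = 1"
    and B: "B \<subseteq> \<Omega>" "B \<in> sets lebesgue" and pos: "B - {x. x \<bullet> \<rho> \<le> t} \<notin> null_sets lebesgue"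
    and \<alpha>: "0 < \<alpha>" and K: "0 \<le> K"
  obtains f u G where "f \<in> trace_space \<Omega> p" "minimizer (\<lambda>_. 1) f u" "sob u G"
    "(LINT x|\<mu>. K * (indicator {x. x \<bullet> \<rho> \<le> t} x * norm (G x) powr p))
       < \<alpha> * genergy (indicator B) G"
proof -
  obtain y where y: "y \<noteq> 0" "orthogonal \<rho> y" using orthogonal_to_vector_exists[OF dim] by blast
  define \<tau> where "\<tau> = y /\<^sub>R norm y"
  have \<tau>: "norm \<tau> = 1" "\<rho> \<bullet> \<tau> = 0" using y by (auto simp: \<tau>_def orthogonal_def)
  obtain \<delta> where \<delta>: "0 < \<delta>" and S: "B \<inter> {x. t + \<delta> \<le> x \<bullet> \<rho>} \<in> sets lebesgue"
      "B \<inter> {x. t + \<delta> \<le> x \<bullet> \<rho>} \<notin> null_sets lebesgue"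
    using positive_measure_beyond[OF B(2) pos] by blast
  define S where "S = B \<inter> {x. t + \<delta> \<le> x \<bullet> \<rho>}"
  have SL: "S \<in> sets lebesgue" "S \<subseteq> \<Omega>" using S B by (auto simp: S_def)
  have Slm: "S \<in> lmeasurable" by (rule fmeasurableI2[OF dom_lmeasurable SL(2,1)])
  have mS: "0 < measure lebesgue S"
  proof -
    have "emeasure lebesgue S \<noteq> 0" using S SL by (auto simp: S_def null_sets_def)
    then show ?thesis using Slm by (metis emeasure_eq_measure2 ennreal_0 measure_nonneg order_le_less)
  qed
  obtain r0 r1 :: real where r0: "0 < r0" and W: "\<And>s. 0 < s \<Longrightarrow> \<exists>f u G. f \<in> trace_space \<Omega> p \<and> minimizer (\<lambda>_. 1) f u \<and> sob u G \<and>
      (\<forall>x. s * exp (s * (x \<bullet> \<rho>)) * r0 \<le> norm (G x) \<and> norm (G x) \<le> s * exp (s * (x \<bullet> \<rho>)) * r1)"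
    using wolff_solutions[OF \<rho> \<tau>] by blast
  define X where "X = K * (r1 powr p * measure lebesgue \<Omega>)"
  define Y where "Y = \<alpha> * (r0 powr p * measure lebesgue S)"
  have X: "0 \<le> X" using K by (simp add: X_def)
  have Y: "0 < Y" using \<alpha> r0 mS by (simp add: Y_def)
  \<comment> \<open>Since \<open>1 + z \<le> exp z\<close>, this frequency is high enough for \<open>X < exp (p * s * \<delta>) * Y\<close>.\<close>
  define s where "s = (X / Y + 1) / (p * \<delta>)"
  have s: "0 < s" using X Y \<delta> p_pos by (simp add: s_def add_nonneg_pos)
  have "X / Y < exp (p * s * \<delta>)"
  proof -
    have "p * s * \<delta> = X / Y + 1" using \<delta> p_pos by (simp add: s_def)
    then show ?thesis using exp_ge_add_one_self[of "p * s * \<delta>"] by linarith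
  qed
  then have XY: "X < exp (p * s * \<delta>) * Y" using Y by (simp add: field_simps)
  obtain f u G where f: "f \<in> trace_space \<Omega> p" "minimizer (\<lambda>_. 1) f u" "sob u G"
    and G: "\<And>x. s * exp (s * (x \<bullet> \<rho>)) * r0 \<le> norm (G x)" "\<And>x. norm (G x) \<le> s * exp (s * (x \<bullet> \<rho>)) * r1"
    using W[OF s] by blast
  have r1: "0 \<le> r1" using order_trans[OF norm_ge_zero G(2)[of 0]] s by (simp add: zero_le_mult_iff)
  define c where "c = s powr p * exp (p * s * t)"
  have c: "0 < c" using s by (simp add: c_def)
  have pw: "(s * exp (s * z) * r) powr p = s powr p * exp (p * s * z) * r powr p" if "0 \<le> r" for z r :: real
    using s that by (simp add: powr_mult exp_powr_real mult_ac)
  note ind = integrable_indicator_energy[OF _ sobD(2)[OF f(3)]]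
  have constS: "integrable (\<mu>) (\<lambda>x. indicator A x * (k::real))" "(LINT x|\<mu>. indicator A x * k) = measure lebesgue A * k"
    if A: "A \<in> lmeasurable" "A \<subseteq> \<Omega>" for A k
  proof -
    have AL: "A \<in> sets lebesgue" using A(1) by (simp add: fmeasurableD)
    have eq: "(\<lambda>x. indicator \<Omega> x *\<^sub>R (indicator A x * k)) = (\<lambda>x. indicator A x * k)"
      using A(2) by (auto simp: fun_eq_iff indicator_def)
    have i: "integrable lebesgue (\<lambda>x. indicator A x * k)"
      by (intro integrable_mult_left) (rule A(1)[unfolded lmeasurable_iff_integrable])
    show "integrable (\<mu>) (\<lambda>x. indicator A x * k)"
      by (subst integrable_restrict_space, simp) (unfold eq, rule i)
    show "(LINT x|\<mu>. indicator A x * k) = measure lebesgue A * k"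
      by (subst integral_restrict_space) (use AL in \<open>simp_all add: eq del: real_scaleR_def\<close>)
  qed
  have "(LINT x|\<mu>. K * (indicator {x. x \<bullet> \<rho> \<le> t} x * norm (G x) powr p))
      \<le> (LINT x|\<mu>. indicator \<Omega> x * (K * (c * r1 powr p)))"
  proof (rule integral_mono)
    have "closed {x. x \<bullet> \<rho> \<le> t}" by (intro closed_Collect_le continuous_intros)
    then show "integrable (\<mu>) (\<lambda>x. K * (indicator {x. x \<bullet> \<rho> \<le> t} x * norm (G x) powr p))"
      by (intro integrable_mult_right ind) auto
    show "integrable (\<mu>) (\<lambda>x. indicator \<Omega> x * (K * (c * r1 powr p)))"
      by (rule constS(1)[OF dom_lmeasurable]) simp
    fix x assume "x \<in> space (\<mu>)"
    then have x: "x \<in> \<Omega>" by simp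
    have "indicator {x. x \<bullet> \<rho> \<le> t} x * norm (G x) powr p \<le> c * r1 powr p"
    proof (cases "x \<bullet> \<rho> \<le> t")
      case True
      have "norm (G x) powr p \<le> s powr p * exp (p * s * (x \<bullet> \<rho>)) * r1 powr p"
        unfolding pw[OF r1, symmetric] using p_pos G(2) by (intro powr_mono2) auto
      also have "\<dots> \<le> s powr p * exp (p * s * t) * r1 powr p"
        using True s p_pos by (intro mult_right_mono mult_left_mono) auto
      finally show ?thesis using True by (simp add: c_def)
    next
      case False
      then show ?thesis using c by simp
    qed
    then show "K * (indicator {x. x \<bullet> \<rho> \<le> t} x * norm (G x) powr p) \<le> indicator \<Omega> x * (K * (c * r1 powr p))"
      using K x by (simp add: mult_left_mono)
  qed
  also have "\<dots> = c * X"
    using constS(2)[OF dom_lmeasurable] by (simp add: X_def mult_ac)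
  also have "\<dots> < c * (exp (p * s * \<delta>) * Y)" using XY c by simp
  also have "\<dots> = \<alpha> * (LINT x|\<mu>. indicator S x * (c * exp (p * s * \<delta>) * r0 powr p))"
    unfolding constS(2)[OF Slm SL(2)] Y_def by (simp add: mult_ac)
  also have "\<dots> \<le> \<alpha> * genergy (indicator B) G"
  proof (rule mult_left_mono[OF integral_mono])
    show "integrable (\<mu>) (\<lambda>x. indicator S x * (c * exp (p * s * \<delta>) * r0 powr p))"
      by (rule constS(1)[OF Slm SL(2)])
    show "integrable (\<mu>) (\<lambda>x. indicator B x * norm (G x) powr p)" by (rule ind[OF B(2)])
    show "indicator S x * (c * exp (p * s * \<delta>) * r0 powr p) \<le> indicator B x * norm (G x) powr p" for x
    proof (cases "x \<in> S")
      case True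
      then have x: "x \<in> B" "t + \<delta> \<le> x \<bullet> \<rho>" by (auto simp: S_def)
      have "c * exp (p * s * \<delta>) * r0 powr p = s powr p * exp (p * s * (t + \<delta>)) * r0 powr p"
        by (simp add: c_def exp_add distrib_left)
      also have "\<dots> \<le> s powr p * exp (p * s * (x \<bullet> \<rho>)) * r0 powr p"
        using x s p_pos by (intro mult_right_mono mult_left_mono) auto
      also have "\<dots> = (s * exp (s * (x \<bullet> \<rho>)) * r0) powr p" using r0 by (simp add: pw)
      also have "\<dots> \<le> norm (G x) powr p"
        using p_pos G(1) s r0 by (intro powr_mono2) auto
      finally show ?thesis using x True by simp
    qed simp
  qed (use \<alpha> in simp)
  finally show ?thesis using that f by blast
qed

text \<open>The union of open null sets in the definition of \<^const>\<open>ess_support\<close> can be taken countable by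
  Lindelof's theorem.\<close>

lemma AE_zero_outside_ess_support: "AE x in \<mu>. x \<notin> ess_support \<Omega> h \<longrightarrow> h x = 0"
proof -
  let ?F = "{U. open U \<and> U \<subseteq> \<Omega> \<and> (AE x in lebesgue_on U. h x = 0)}"
  obtain F where F: "F \<subseteq> ?F" "countable F" "\<Union>F = \<Union>?F"
    using Lindelof[of ?F] by blast
  have "AE x in lebesgue. \<forall>U\<in>F. x \<in> U \<longrightarrow> h x = 0"
    unfolding AE_ball_countable[OF F(2)]
  proof
    fix U assume "U \<in> F"
    then have "open U" "AE x in lebesgue_on U. h x = 0" using F(1) by auto
    then show "AE x in lebesgue. x \<in> U \<longrightarrow> h x = 0" by (simp add: AE_restrict_space_iff)
  qed
  then have "AE x in lebesgue. x \<in> \<Omega> \<longrightarrow> (x \<notin> ess_support \<Omega> h \<longrightarrow> h x = 0)"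
  proof eventually_elim
    case (elim x)
    show ?case unfolding ess_support_def F(3)[symmetric] using elim by blast
  qed
  then show ?thesis by (simp add: AE_restrict_space_iff)
qed

text \<open>If \<open>B\<close> left a half-space containing the support, Wolff's solutions would violate \<open>bound\<close>, whose
  right-hand side only sees that half-space. By Lindelof's theorem countably many
  half-spaces suffice for the convex hull.\<close>

theorem support_localization:
  fixes B :: "'a set"
  assumes dim: "2 \<le> DIM('a)" and B: "B \<subseteq> \<Omega>" "B \<in> sets lebesgue"
    and \<alpha>: "0 < \<alpha>" and h: "h \<in> borel_measurable (\<mu>)" "AE x in \<mu>. \<bar>h x\<bar> \<le> K"
    and h0: "\<And>x. k x = 0 \<Longrightarrow> h x = 0"
    and bound: "\<And>f u G. f \<in> trace_space \<Omega> p \<Longrightarrow> minimizer (\<lambda>_. 1) f u \<Longrightarrow> sob u G \<Longrightarrow>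
      \<alpha> * genergy (indicator B) G \<le> genergy h G"
  shows "B - ess_conv (ess_support \<Omega> k) \<in> null_sets lebesgue"
proof -
  let ?A = "ess_support \<Omega> k"
  have unit: "B - {x. x \<bullet> \<rho> \<le> t} \<in> null_sets lebesgue"
    if \<rho>: "norm \<rho> = 1" and A: "?A - {x. x \<bullet> \<rho> \<le> t} \<in> null_sets lebesgue" for \<rho> t
  proof (rule ccontr)
    assume pos: "B - {x. x \<bullet> \<rho> \<le> t} \<notin> null_sets lebesgue"
    obtain f u G where f: "f \<in> trace_space \<Omega> p" "minimizer (\<lambda>_. 1) f u" "sob u G"
      and lt: "(LINT x|\<mu>. \<bar>K\<bar> * (indicator {x. x \<bullet> \<rho> \<le> t} x * norm (G x) powr p))
       < \<alpha> * genergy (indicator B) G"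
      using localized_energy[OF dim \<rho> B pos \<alpha> abs_ge_zero[of K]] by blast
    note iG = Lp_onD(2)[OF sobD(2)[OF f(3)]]
    have "genergy h G \<le> (LINT x|\<mu>. \<bar>K\<bar> * (indicator {x. x \<bullet> \<rho> \<le> t} x * norm (G x) powr p))"
    proof (rule integral_mono_AE)
      show "integrable (\<mu>) (\<lambda>x. h x * norm (G x) powr p)" by (rule integrable_weighted[OF h iG])
      have "closed {x. x \<bullet> \<rho> \<le> t}" by (intro closed_Collect_le continuous_intros)
      then show "integrable (\<mu>) (\<lambda>x. \<bar>K\<bar> * (indicator {x. x \<bullet> \<rho> \<le> t} x * norm (G x) powr p))"
        by (intro integrable_mult_right integrable_indicator_energy[OF _ sobD(2)[OF f(3)]]) auto
      have "AE x in lebesgue. x \<notin> ?A - {x. x \<bullet> \<rho> \<le> t}" by (rule AE_not_in[OF A])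
      then have "AE x in \<mu>. x \<notin> ?A - {x. x \<bullet> \<rho> \<le> t}"
        by (auto simp: AE_restrict_space_iff elim!: eventually_mono)
      then show "AE x in \<mu>. h x * norm (G x) powr p \<le> \<bar>K\<bar> * (indicator {x. x \<bullet> \<rho> \<le> t} x * norm (G x) powr p)"
        using h(2) AE_zero_outside_ess_support[of k]
      proof eventually_elim
        case (elim x)
        show ?case
        proof (cases "x \<bullet> \<rho> \<le> t")
          case True
          have "h x \<le> \<bar>K\<bar>" using elim(2) by linarith
          then show ?thesis using True by (simp add: mult_right_mono)
        next
          case False
          then have "h x = 0" using elim h0 by blast
          then show ?thesis by simp
        qed
      qed
    qed
    with bound[OF f] lt show False by linarith
  qed
  have half: "B - {x. x \<bullet> \<rho> \<le> t} \<in> null_sets lebesgue"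
    if A: "?A - {x. x \<bullet> \<rho> \<le> t} \<in> null_sets lebesgue" for \<rho> t
  proof (cases "\<rho> = 0")
    case False
    then have eq: "{x. x \<bullet> \<rho> \<le> t} = {x. x \<bullet> (\<rho> /\<^sub>R norm \<rho>) \<le> t / norm \<rho>}"
      by (auto simp: field_simps)
    have "norm (\<rho> /\<^sub>R norm \<rho>) = 1" using False by simp
    from unit[OF this A[unfolded eq]] show ?thesis unfolding eq .
  next
    case True
    \<comment> \<open>For \<open>\<rho> = 0\<close> the half-space is everything or empty. If it is empty, the support is a null set and
      a genuine half-space that misses the bounded set \<open>\<Omega>\<close> can be used instead.\<close>
    show ?thesis
    proof (cases "0 \<le> t")
      case True
      then show ?thesis using \<open>\<rho> = 0\<close> by simp
    next
      case False
      obtain e :: 'a where e: "e \<in> Basis" using nonempty_Basis by blast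
      obtain R where R: "\<And>x. x \<in> \<Omega> \<Longrightarrow> norm x \<le> R" using bounded_dom bounded_iff by blast
      have "?A \<in> null_sets lebesgue" using A False \<open>\<rho> = 0\<close> by simp
      then have "?A - {x. x \<bullet> e \<le> - R - 1} \<in> null_sets lebesgue"
      proof (rule null_set_Diff)
        have "closed {x. x \<bullet> e \<le> - R - 1}" by (intro closed_Collect_le continuous_intros)
        then show "{x. x \<bullet> e \<le> - R - 1} \<in> sets lebesgue" by auto
      qed
      then have "B - {x. x \<bullet> e \<le> - R - 1} \<in> null_sets lebesgue" using e by (intro unit) auto
      moreover have "B \<inter> {x. x \<bullet> e \<le> - R - 1} = {}"
      proof -
        have "- R \<le> x \<bullet> e" if "x \<in> B" for x
          using R[of x] B(1) that Basis_le_norm[OF e, of x] by auto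
        then show ?thesis by force
      qed
      ultimately have "B \<in> null_sets lebesgue" by (simp add: Diff_triv)
      then show ?thesis using False \<open>\<rho> = 0\<close> by simp
    qed
  qed
  let ?H = "{- {x. x \<bullet> \<rho> \<le> t} | \<rho> t. ?A - {x. x \<bullet> \<rho> \<le> t} \<in> null_sets lebesgue}"
  have "open S" if SH: "S \<in> ?H" for S
  proof -
    obtain \<rho> t where S: "S = - {x. x \<bullet> \<rho> \<le> t}" using SH by blast
    have "closed {x. x \<bullet> \<rho> \<le> t}" by (intro closed_Collect_le continuous_intros)
    then show ?thesis unfolding S by (rule open_Compl)
  qed
  then obtain F where F: "F \<subseteq> ?H" "countable F" "\<Union>F = \<Union>?H" using Lindelof[of ?H] by blast
  have "B - ess_conv ?A = B \<inter> \<Union>?H" unfolding ess_conv_def by blast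
  also have "\<dots> = (\<Union>S\<in>F. B \<inter> S)" unfolding F(3)[symmetric] by blast
  also have "\<dots> \<in> null_sets lebesgue"
  proof (rule null_sets_UN'[OF F(2)])
    fix S assume "S \<in> F"
    then obtain \<rho> t where S: "S = - {x. x \<bullet> \<rho> \<le> t}" "?A - {x. x \<bullet> \<rho> \<le> t} \<in> null_sets lebesgue" using F(1) by blast
    then show "B \<inter> S \<in> null_sets lebesgue" using half by (simp add: Diff_eq)
  qed
  finally show ?thesis .
qed

section \<open>Comparison with the test operators\<close>

lemma Linf_plus_weight:
  assumes "\<sigma> \<in> Linf_plus \<Omega>"
  obtains c M where "weight c M \<sigma>"
proof -
  have m: "\<sigma> \<in> borel_measurable (\<mu>)"
    and up: "esssup (\<mu>) (\<lambda>x. ereal \<bar>\<sigma> x\<bar>) < \<infinity>"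
    and lo: "0 < - esssup (\<mu>) (\<lambda>x. ereal (- \<sigma> x))"
    using assms by (auto simp: Linf_plus_def essinf_def)
  obtain M where M: "esssup (\<mu>) (\<lambda>x. ereal \<bar>\<sigma> x\<bar>) < ereal M"
    using ereal_dense2[OF up] by blast
  have "esssup (\<mu>) (\<lambda>x. ereal (- \<sigma> x)) < 0" using lo by (simp add: ereal_less_uminus_reorder)
  then obtain b where b: "esssup (\<mu>) (\<lambda>x. ereal (- \<sigma> x)) < ereal b" "ereal b < 0"
    using ereal_dense2 by blast
  have "AE x in \<mu>. - b \<le> \<sigma> x \<and> \<sigma> x \<le> M"
    using esssup_AE[of "\<lambda>x. ereal \<bar>\<sigma> x\<bar>" "\<mu>"] esssup_AE[of "\<lambda>x. ereal (- \<sigma> x)" "\<mu>"]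
  proof eventually_elim
    case (elim x)
    have "ereal \<bar>\<sigma> x\<bar> < ereal M" "ereal (- \<sigma> x) < ereal b"
      using le_less_trans[OF elim(1) M] le_less_trans[OF elim(2) b(1)] .
    then show ?case by auto
  qed
  with m b(2) have "weight (- b) M \<sigma>" by (simp add: weight_def)
  then show ?thesis by (rule that)
qed

lemma AE_on_subset:
  assumes "B \<subseteq> \<Omega>" "B \<in> sets lebesgue"
  shows "(AE x in lebesgue_on B. P x) \<longleftrightarrow> (AE x in \<mu>. x \<in> B \<longrightarrow> P x)"
proof -
  have "(AE x in lebesgue. x \<in> B \<longrightarrow> P x) \<longleftrightarrow> (AE x in lebesgue. x \<in> \<Omega> \<longrightarrow> x \<in> B \<longrightarrow> P x)"
    using assms(1) by (intro AE_cong) auto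
  then show ?thesis using assms(2) by (simp add: AE_restrict_space_iff)
qed

lemma not_AE_contradictory:
  assumes "B \<subseteq> \<Omega>" "B \<in> sets lebesgue" "0 < emeasure lebesgue B"
    and "AE x in \<mu>. x \<in> B \<longrightarrow> P x" "AE x in \<mu>. \<not> P x"
  shows False
proof -
  have "AE x in \<mu>. x \<in> B \<longrightarrow> False" using assms(4,5) by eventually_elim simp
  then have "AE x in lebesgue. x \<notin> B"
    using AE_on_subset[OF assms(1,2), of "\<lambda>_. False"] assms(2) by (simp add: AE_restrict_space_iff)
  then have "B \<in> null_sets lebesgue" using assms(2) by (simp add: AE_iff_null_sets)
  then show False using assms(3) by (simp add: null_sets_def)
qed

text \<open>The lower bound of \<open>DN_monotonicity\<close> has a nonnegative integrand, which on \<open>B\<close> is at least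
  the stated multiple of the energy density.\<close>

theorem DN_lower_estimate:
  assumes \<sigma>: "weight c M \<sigma>" and B: "B \<subseteq> \<Omega>" "B \<in> sets lebesgue"
    and ge1: "AE x in \<mu>. 1 \<le> \<sigma> x" and geB: "AE x in lebesgue_on B. 1 + \<alpha> \<le> \<sigma> x" and \<alpha>: "0 < \<alpha>"
  shows "DN_le \<Omega> p (\<lambda>f g. DN0 \<Omega> p f g + (p - 1) * (1 - (1 + \<alpha>) powr (- (1 / (p - 1)))) * DN_test \<Omega> p B f g) (DN \<Omega> p \<sigma>)"
  unfolding DN_le_def
proof
  fix f assume f: "f \<in> trace_space \<Omega> p"
  define u where "u = p_potential \<Omega> p (\<lambda>_. 1) f"
  have u: "minimizer (\<lambda>_. 1) f u" unfolding u_def by (rule p_potential_minimizer[OF weight_one f])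
  then have G: "sob u (weak_grad \<Omega> u)" using trace_space_sob[OF f] by (simp add: minimizer_def)
  let ?G = "weak_grad \<Omega> u" and ?q = "- (1 / (p - 1))"
  let ?k = "(p - 1) * (1 - (1 + \<alpha>) powr ?q)"
  note GL = sobD(2)[OF G]
  have i: "integrable (\<mu>) (\<lambda>x. (p - 1) * (1 - \<sigma> x powr ?q) * norm (?G x) powr p)"
  proof -
    have "integrable (\<mu>) (\<lambda>x. (p - 1) * (norm (?G x) powr p - \<sigma> x powr ?q * norm (?G x) powr p))"
      by (intro integrable_mult_right Bochner_Integration.integrable_diff Lp_onD(2)[OF GL] weight_powr_integrable[OF \<sigma> GL])
    then show ?thesis by (simp add: algebra_simps)
  qed
  have "?k * DN_test \<Omega> p B f f = (LINT x|\<mu>. ?k * (indicator B x * norm (?G x) powr p))"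
    by (simp add: DN_test_diagonal[OF f u G B])
  also have "\<dots> \<le> genergy (\<lambda>x. (p - 1) * (1 - \<sigma> x powr ?q)) ?G"
  proof (rule integral_mono_AE[OF integrable_mult_right[OF integrable_indicator_energy[OF B(2) GL]] i])
    have "AE x in \<mu>. x \<in> B \<longrightarrow> 1 + \<alpha> \<le> \<sigma> x" using geB by (simp only: AE_on_subset[OF B])
    then show "AE x in \<mu>. ?k * (indicator B x * norm (?G x) powr p) \<le> (p - 1) * (1 - \<sigma> x powr ?q) * norm (?G x) powr p"
      using ge1
    proof eventually_elim
      case (elim x)
      have le1: "\<sigma> x powr ?q \<le> 1" using powr_mono2'[of ?q 1 "\<sigma> x"] elim(2) p_gt_1 by simp
      show ?case
      proof (cases "x \<in> B")
        case True
        then have "\<sigma> x powr ?q \<le> (1 + \<alpha>) powr ?q" using elim(1) \<alpha> p_gt_1 by (intro powr_mono2') auto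
        then show ?thesis using True p_gt_1 by (auto intro!: mult_right_mono)
      next
        case False
        then show ?thesis using le1 p_gt_1 by simp
      qed
    qed
  qed
  also have "\<dots> \<le> DN \<Omega> p \<sigma> f f - DN0 \<Omega> p f f" by (rule DN_monotonicity(2)[OF \<sigma> f u G])
  finally show "0 \<le> DN \<Omega> p \<sigma> f f - (DN0 \<Omega> p f f + ?k * DN_test \<Omega> p B f f)" by simp
qed

theorem DN_upper_estimate:
  assumes \<sigma>: "weight c M \<sigma>" and B: "B \<subseteq> \<Omega>" "B \<in> sets lebesgue"
    and le1: "AE x in \<mu>. \<sigma> x \<le> 1" and leB: "AE x in lebesgue_on B. \<sigma> x \<le> 1 - \<alpha>"
  shows "DN_le \<Omega> p (DN \<Omega> p \<sigma>) (\<lambda>f g. DN0 \<Omega> p f g - \<alpha> * DN_test \<Omega> p B f g)"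
  unfolding DN_le_def
proof
  fix f assume f: "f \<in> trace_space \<Omega> p"
  define u where "u = p_potential \<Omega> p (\<lambda>_. 1) f"
  have u: "minimizer (\<lambda>_. 1) f u" unfolding u_def by (rule p_potential_minimizer[OF weight_one f])
  then have G: "sob u (weak_grad \<Omega> u)" using trace_space_sob[OF f] by (simp add: minimizer_def)
  let ?G = "weak_grad \<Omega> u"
  note GL = sobD(2)[OF G]
  have i: "integrable (\<mu>) (\<lambda>x. (\<sigma> x - 1) * norm (?G x) powr p)"
    using Bochner_Integration.integrable_diff[OF weight_integrable[OF \<sigma> GL] Lp_onD(2)[OF GL]]
    by (simp add: left_diff_distrib)
  have "DN \<Omega> p \<sigma> f f - DN0 \<Omega> p f f \<le> genergy (\<lambda>x. \<sigma> x - 1) ?G"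
    by (rule DN_monotonicity(1)[OF \<sigma> f u G])
  also have "\<dots> \<le> (LINT x|\<mu>. - \<alpha> * (indicator B x * norm (?G x) powr p))"
  proof (rule integral_mono_AE[OF i integrable_mult_right[OF integrable_indicator_energy[OF B(2) GL]]])
    have "AE x in \<mu>. x \<in> B \<longrightarrow> \<sigma> x \<le> 1 - \<alpha>" using leB by (simp only: AE_on_subset[OF B])
    then show "AE x in \<mu>. (\<sigma> x - 1) * norm (?G x) powr p \<le> - \<alpha> * (indicator B x * norm (?G x) powr p)"
      using le1
    proof eventually_elim
      case (elim x)
      show ?case
      proof (cases "x \<in> B")
        case True
        then have "\<sigma> x - 1 \<le> - \<alpha>" using elim(1) by simp
        then have "(\<sigma> x - 1) * norm (?G x) powr p \<le> - \<alpha> * norm (?G x) powr p" by (rule mult_right_mono) simp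
        then show ?thesis using True by simp
      next
        case False
        then show ?thesis using elim(2) by (simp add: mult_nonpos_nonneg)
      qed
    qed
  qed
  also have "\<dots> = - \<alpha> * DN_test \<Omega> p B f f"
    by (simp only: DN_test_diagonal[OF f u G B] integral_mult_right_zero)
  finally show "0 \<le> DN0 \<Omega> p f f - \<alpha> * DN_test \<Omega> p B f f - DN \<Omega> p \<sigma> f f" by simp
qed

text \<open>Combined with the upper bound of \<open>DN_monotonicity\<close>, the test inequality controls the energy in \<open>B\<close>
  by an integral over the set where \<open>\<sigma>\<close> differs from 1.\<close>

theorem DN_lower_test_localizes:
  assumes dim: "2 \<le> DIM('a)" and \<sigma>: "weight c M \<sigma>" and B: "B \<subseteq> \<Omega>" "B \<in> sets lebesgue" and \<alpha>: "0 < \<alpha>"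
    and le: "DN_le \<Omega> p (\<lambda>f g. DN0 \<Omega> p f g + \<alpha> * DN_test \<Omega> p B f g) (DN \<Omega> p \<sigma>)"
  shows "B - ess_conv (ess_support \<Omega> (\<lambda>x. \<bar>\<sigma> x - 1\<bar>)) \<in> null_sets lebesgue"
proof (rule support_localization[OF dim B \<alpha>, of "\<lambda>x. \<sigma> x - 1" "\<bar>M\<bar> + 1"])
  show "(\<lambda>x. \<sigma> x - 1) \<in> borel_measurable (\<mu>)" using \<sigma> by (auto simp: weight_def)
  show "AE x in \<mu>. \<bar>\<sigma> x - 1\<bar> \<le> \<bar>M\<bar> + 1"
    using weight_abs_le[OF \<sigma>] by eventually_elim linarith
  fix f u G assume f: "f \<in> trace_space \<Omega> p" and u: "minimizer (\<lambda>_. 1) f u" and G: "sob u G"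
  have "\<alpha> * DN_test \<Omega> p B f f \<le> DN \<Omega> p \<sigma> f f - DN0 \<Omega> p f f"
    using le f by (auto simp: DN_le_def algebra_simps)
  also have "\<dots> \<le> genergy (\<lambda>x. \<sigma> x - 1) G"
    by (rule DN_monotonicity(1)[OF \<sigma> f u G])
  finally show "\<alpha> * genergy (indicator B) G \<le> genergy (\<lambda>x. \<sigma> x - 1) G"
    by (simp add: DN_test_diagonal[OF f u G B])
qed simp

text \<open>As before, with the lower bound of \<open>DN_monotonicity\<close>.\<close>

theorem DN_upper_test_localizes:
  assumes dim: "2 \<le> DIM('a)" and \<sigma>: "weight c M \<sigma>" and B: "B \<subseteq> \<Omega>" "B \<in> sets lebesgue" and \<alpha>: "0 < \<alpha>"
    and le: "DN_le \<Omega> p (DN \<Omega> p \<sigma>) (\<lambda>f g. DN0 \<Omega> p f g - \<alpha> * DN_test \<Omega> p B f g)"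
  shows "B - ess_conv (ess_support \<Omega> (\<lambda>x. \<bar>\<sigma> x - 1\<bar>)) \<in> null_sets lebesgue"
proof -
  let ?q = "- (1 / (p - 1))"
  let ?h = "\<lambda>x. (p - 1) * (\<sigma> x powr ?q - 1)"
  have [measurable]: "\<sigma> \<in> borel_measurable (\<mu>)" and c: "0 < c"
    using \<sigma> by (auto simp: weight_def)
  show ?thesis
  proof (rule support_localization[OF dim B \<alpha>, of ?h "(p - 1) * (c powr ?q + 1)"])
    show "?h \<in> borel_measurable (\<mu>)" by measurable
    have "AE x in \<mu>. c \<le> \<sigma> x" using \<sigma> by (auto simp: weight_def elim!: eventually_mono)
    then show "AE x in \<mu>. \<bar>?h x\<bar> \<le> (p - 1) * (c powr ?q + 1)"
    proof eventually_elim
      case (elim x)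
      have "\<sigma> x powr ?q \<le> c powr ?q" using elim c p_gt_1 by (intro powr_mono2') auto
      moreover have "0 \<le> \<sigma> x powr ?q" by simp
      ultimately have "\<bar>\<sigma> x powr ?q - 1\<bar> \<le> c powr ?q + 1" by linarith
      then show ?case using p_gt_1 by (simp add: abs_mult)
    qed
    fix f u G assume f: "f \<in> trace_space \<Omega> p" and u: "minimizer (\<lambda>_. 1) f u" and G: "sob u G"
    have "(p - 1) * (1 - \<sigma> x powr ?q) * norm (G x) powr p = - (?h x * norm (G x) powr p)" for x
      by (simp add: algebra_simps)
    then have "- genergy ?h G = genergy (\<lambda>x. (p - 1) * (1 - \<sigma> x powr ?q)) G"
      by (simp only: Bochner_Integration.integral_minus)
    also have "\<dots> \<le> DN \<Omega> p \<sigma> f f - DN0 \<Omega> p f f" by (rule DN_monotonicity(2)[OF \<sigma> f u G])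
    also have "\<dots> \<le> - (\<alpha> * DN_test \<Omega> p B f f)"
      using le f by (auto simp: DN_le_def algebra_simps)
    finally show "\<alpha> * genergy (indicator B) G \<le> genergy ?h G"
      by (simp add: DN_test_diagonal[OF f u G B])
  qed simp
qed

end

theorem theorem3p1:
  fixes \<Omega> B :: "(real ^ 'n) set"
    and \<sigma> :: "real ^ 'n \<Rightarrow> real"
    and p \<alpha> :: real
  assumes "CARD('n) \<ge> 2"
    and "1 < p"
    and "open \<Omega>" and "bounded \<Omega>"
    and "\<sigma> \<in> Linf_plus \<Omega>"
    and "(AE x in lebesgue_on \<Omega>. \<sigma> x \<ge> 1) \<or> (AE x in lebesgue_on \<Omega>. \<sigma> x \<le> 1)"
    and "B \<subseteq> \<Omega>" and "B \<in> sets lebesgue" and "emeasure lebesgue B > 0"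
    and "\<alpha> > 0"
  shows
    "((AE x in lebesgue_on B. \<sigma> x \<ge> 1 + \<alpha>) \<longrightarrow>
        (let \<alpha>' = (p - 1) * (1 - (1 + \<alpha>) powr (- (1 / (p - 1)))) in
           \<alpha>' > 0 \<and>
           DN_le \<Omega> p (\<lambda>f g. DN0 \<Omega> p f g + \<alpha>' * DN_test \<Omega> p B f g) (DN \<Omega> p \<sigma>)))
     \<and> ((AE x in lebesgue_on B. \<sigma> x \<le> 1 - \<alpha>) \<longrightarrow>
          DN_le \<Omega> p (DN \<Omega> p \<sigma>) (\<lambda>f g. DN0 \<Omega> p f g - \<alpha> * DN_test \<Omega> p B f g))
     \<and> (DN_le \<Omega> p (\<lambda>f g. DN0 \<Omega> p f g + \<alpha> * DN_test \<Omega> p B f g) (DN \<Omega> p \<sigma>) \<longrightarrow>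
          B - ess_conv (ess_support \<Omega> (\<lambda>x. \<bar>\<sigma> x - 1\<bar>)) \<in> null_sets lebesgue)
     \<and> (DN_le \<Omega> p (DN \<Omega> p \<sigma>) (\<lambda>f g. DN0 \<Omega> p f g - \<alpha> * DN_test \<Omega> p B f g) \<longrightarrow>
          B - ess_conv (ess_support \<Omega> (\<lambda>x. \<bar>\<sigma> x - 1\<bar>)) \<in> null_sets lebesgue)"
proof -
  interpret sobolev_domain \<Omega> p by standard (fact assms)+
  have dim: "2 \<le> DIM(real ^ 'n)" using assms(1) by simp
  obtain c M where \<sigma>: "weight c M \<sigma>" using Linf_plus_weight[OF assms(5)] by blast
  note B = assms(7,8) and \<alpha> = assms(10)
  have "0 < (p - 1) * (1 - (1 + \<alpha>) powr (- (1 / (p - 1))))"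
    using powr_less_mono2_neg[of "- (1 / (p - 1))" 1 "1 + \<alpha>"] \<alpha> assms(2) by simp
  moreover have "AE x in lebesgue_on \<Omega>. 1 \<le> \<sigma> x" if geB: "AE x in lebesgue_on B. 1 + \<alpha> \<le> \<sigma> x"
  proof (rule ccontr)
    assume "\<not> ?thesis"
    then have "AE x in lebesgue_on \<Omega>. \<sigma> x \<le> 1" using assms(6) by blast
    then have "AE x in lebesgue_on \<Omega>. \<not> 1 + \<alpha> \<le> \<sigma> x" by eventually_elim (use \<alpha> in linarith)
    then show False using not_AE_contradictory[OF B assms(9)] geB by (simp only: AE_on_subset[OF B])
  qed
  moreover have "AE x in lebesgue_on \<Omega>. \<sigma> x \<le> 1" if leB: "AE x in lebesgue_on B. \<sigma> x \<le> 1 - \<alpha>"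
  proof (rule ccontr)
    assume "\<not> ?thesis"
    then have "AE x in lebesgue_on \<Omega>. 1 \<le> \<sigma> x" using assms(6) by blast
    then have "AE x in lebesgue_on \<Omega>. \<not> \<sigma> x \<le> 1 - \<alpha>" by eventually_elim (use \<alpha> in linarith)
    then show False using not_AE_contradictory[OF B assms(9)] leB by (simp only: AE_on_subset[OF B])
  qed
  ultimately show ?thesis
    using DN_lower_estimate[OF \<sigma> B _ _ \<alpha>] DN_upper_estimate[OF \<sigma> B]
      DN_lower_test_localizes[OF dim \<sigma> B \<alpha>] DN_upper_test_localizes[OF dim \<sigma> B \<alpha>]
    unfolding Let_def by blast
qed

end
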